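(* For $\lambda \in \,]0,e^{-1}[$ let $E_\lambda(z) = \lambda e^z$, let $J(E_\lambda) \subseteq \mathbb C$ be the Julia set of $E_\lambda$, and let $\phi : J(E_\lambda) \to \mathbb R$ be $\phi(z) = \log |z|$. For each $\lambda \in \,]0,e^{-1}[$ and each $\beta \geq HD(J_r(E_\lambda))$ there is a $\beta\phi$-conformal measure for $E_\lambda : J(E_\lambda) \to J(E_\lambda)$. For $\beta > HD(J_r(E_\lambda))$ the $\beta\phi$-conformal measures are dissipative.
   Context: $J(E_\lambda)$ is a closed subset of $\mathbb C$ with $E_\lambda^{-1}(J(E_\lambda)) = J(E_\lambda)$, $0 \notin J(E_\lambda)$, and $E_\lambda : J(E_\lambda) \to J(E_\lambda)$ is a local homeomorphism. The radial Julia set is $J_r(E_\lambda) = \{ z \in J(E_\lambda) : \liminf_n |E_\lambda^n(z)| < \infty\}$ and $HD$ denotes Hausdorff dimension. For a continuous $\psi : J(E_\lambda) \to \mathbb R$, a $\psi$-conformal measure is a regular non-zero Borel measure $m$ (finite on compact sets, possibly infinite) on $J(E_\lambda)$ such that $m(E_\lambda(A)) = \int_A e^{\psi}\, dm$ for every Borel set $A \subseteq J(E_\lambda)$ on which $E_\lambda$ is injective. Such a measure is dissipative when $J(E_\lambda)$ is, up to an $m$-null set, the union of a countable collection of Borel sets $D \subseteq J(E_\lambda)$ which are wandering, i.e. $D \cap E_\lambda^{-k}(D) = \emptyset$ for all $k = 1,2,3,\dots$. *)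

theory Defs
  imports "HOL-Complex_Analysis.Complex_Analysis"
begin

definition exp_map :: "real \<Rightarrow> complex \<Rightarrow> complex" where
  "exp_map l z = complex_of_real l * exp z"

(* Normality with respect to the spherical metric for holomorphic functions on a connected open set:
   locally uniform convergence to a finite limit or to the constant infinity. *)
definition normal_family_on :: "complex set \<Rightarrow> (complex \<Rightarrow> complex) set \<Rightarrow> bool" where
  "normal_family_on U \<F> \<longleftrightarrow>
     (\<forall>s :: nat \<Rightarrow> complex \<Rightarrow> complex. range s \<subseteq> \<F> \<longrightarrow>
       (\<exists>r :: nat \<Rightarrow> nat. strict_mono r \<and>
         ((\<exists>g. \<forall>K. compact K \<and> K \<subseteq> U \<longrightarrow> uniform_limit K (\<lambda>n. s (r n)) g sequentially) \<or>
          (\<forall>K. compact K \<and> K \<subseteq> U \<longrightarrow>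
             (\<forall>B::real. \<forall>\<^sub>F n in sequentially. \<forall>z\<in>K. B < cmod (s (r n) z))))))"

definition fatou_set :: "(complex \<Rightarrow> complex) \<Rightarrow> complex set" where
  "fatou_set f =
     {z. \<exists>U. open U \<and> connected U \<and> z \<in> U \<and> normal_family_on U (range (\<lambda>n. f ^^ n))}"

definition julia_set :: "(complex \<Rightarrow> complex) \<Rightarrow> complex set" where
  "julia_set f = - fatou_set f"

definition radial_julia_set :: "(complex \<Rightarrow> complex) \<Rightarrow> complex set" where
  "radial_julia_set f =
     {z \<in> julia_set f. liminf (\<lambda>n. ereal (cmod ((f ^^ n) z))) < \<infinity>}"

(* The term of U in an s-dimensional covering sum, with the convention 0^0 = 1 for nonempty U
   (whereas 0 powr 0 = 0). *)
definition diam_pow :: "real \<Rightarrow> 'a::metric_space set \<Rightarrow> ennreal" where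
  "diam_pow s U =
     (if U = {} then 0 else if s = 0 then 1 else ennreal (diameter U powr s))"

(* Boundedness is explicit because diameter is only meaningful for bounded sets. *)
definition hausdorff_measure :: "real \<Rightarrow> 'a::metric_space set \<Rightarrow> ennreal" where
  "hausdorff_measure s A =
     (SUP \<delta>\<in>{0<..}. INF U\<in>{U :: nat \<Rightarrow> 'a set.
          A \<subseteq> (\<Union>i. U i) \<and> (\<forall>i. bounded (U i) \<and> diameter (U i) \<le> \<delta>)}.
        \<Sum>i. diam_pow s (U i))"

definition hausdorff_dim :: "'a::metric_space set \<Rightarrow> ereal" where
  "hausdorff_dim A = (INF s\<in>{s. 0 \<le> s \<and> hausdorff_measure s A = 0}. ereal s)"

definition regular_borel_measure_on :: "complex set \<Rightarrow> complex measure \<Rightarrow> bool" where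
  "regular_borel_measure_on X m \<longleftrightarrow>
     sets m = sets (restrict_space borel X) \<and>
     (\<forall>K. compact K \<and> K \<subseteq> X \<longrightarrow> emeasure m K < \<infinity>) \<and>
     (\<forall>A\<in>sets m.
        emeasure m A = (INF U\<in>{U. openin (top_of_set X) U \<and> A \<subseteq> U}. emeasure m U) \<and>
        emeasure m A = (SUP K\<in>{K. compact K \<and> K \<subseteq> A}. emeasure m K))"

(* Here T maps X to X. When T is a local homeomorphism, T ` A is Borel for Borel A, so
   emeasure m (T ` A) is not the default value for non-measurable sets. *)
definition conformal_measure ::
  "(complex \<Rightarrow> complex) \<Rightarrow> complex set \<Rightarrow> (complex \<Rightarrow> real) \<Rightarrow> complex measure \<Rightarrow> bool" where
  "conformal_measure T X \<psi> m \<longleftrightarrow>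
     regular_borel_measure_on X m \<and> emeasure m X \<noteq> 0 \<and>
     (\<forall>A\<in>sets m. inj_on T A \<longrightarrow>
        emeasure m (T ` A) = (\<integral>\<^sup>+z\<in>A. ennreal (exp (\<psi> z)) \<partial>m))"

definition wandering :: "('a \<Rightarrow> 'a) \<Rightarrow> 'a set \<Rightarrow> bool" where
  "wandering T D \<longleftrightarrow> (\<forall>k\<ge>1. D \<inter> (T ^^ k) -` D = {})"

definition dissipative :: "('a \<Rightarrow> 'a) \<Rightarrow> 'a measure \<Rightarrow> bool" where
  "dissipative T m \<longleftrightarrow>
     (\<exists>\<D>. countable \<D> \<and> \<D> \<subseteq> sets m \<and> (\<forall>D\<in>\<D>. wandering T D) \<and>
          space m - \<Union>\<D> \<in> null_sets m)"

end

(* Let q > 1 be the repelling fixed point of E on the real axis. The Julia set is the set of points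
whose forward orbit stays in the half-plane Re z >= q; there E expands by the factor q, and its
inverse branches Log(z/l) + 2 pi i j map this half-plane into itself with distortion controlled by
|log|z| - log|w|| <= |z - w|.

The key fact is that for beta > HD(J_r) the series of word weights to the power -beta, taken over
all compositions of inverse branches that map q into a fixed ball, converges. Otherwise, for some
s > HD(J_r), finitely many compositions of one fixed length would form an iterated function system
whose contraction rates satisfy sum c_a^s >= 1, and its invariant set, which consists of radial
points, would have dimension at least s.

Existence: weigh the backward orbit of a point x so that the resulting measure is beta-conformal
except at x, normalise it on a ball, let x tend to infinity inside the Julia set (and beta decrease
to its limit), and take a vague limit; all bounds are local, so the limit may be infinite.

Dissipativity: the series and the Borel-Cantelli lemma show that almost every point escapes to
infinity, and the last visit to a ball decomposes the escaping points into wandering sets. *)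

theory Submission
  imports Defs "HOL-Probability.Probability" "HOL-Real_Asymp.Real_Asymp"
begin

text \<open>The distortion constant does not depend on the length of a word. Hence, at an exponent s
  above the dimension, one constant bounds the sums over the words of length n for all n at once.
  Weights are at least q^n, so passing from s to a larger beta makes the series geometric. This
  requires a strict inequality, and at beta = HD(J_r) a measure is obtained only as a limit.

  The Julia set is unbounded, so total masses are out of control. The fixed point q replaces them:
  iterating the branch that fixes q compares every ball with the unit ball around q, with a constant
  independent of the base point x. Giving the unit ball mass 1 therefore bounds all balls and keeps
  the limit from vanishing, while the defect at x leaves every compact set as x moves away.

  Weak limits are formed on the line. A weight makes all measures finite, a Borel section of a
  space-filling curve lifts them to [0, 1], and the curve brings the limit back to the
  plane.\<close>

section \<open>Lower bounds for the Hausdorff measure of self-similar sets\<close>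

text \<open>The mass of \<open>U\<close> after \<open>n\<close> steps of the random iteration that starts at \<open>x0\<close> and applies
  \<open>f a\<close> with probability \<open>p a\<close>: a finite stand-in for the self-similar measure.\<close>

primrec ifs_mass ::
  "'i set \<Rightarrow> ('i \<Rightarrow> real) \<Rightarrow> ('i \<Rightarrow> 'a \<Rightarrow> 'a) \<Rightarrow> 'a \<Rightarrow> nat \<Rightarrow> 'a set \<Rightarrow> real" where
  "ifs_mass F p f x0 0 U = (if x0 \<in> U then 1 else 0)"
| "ifs_mass F p f x0 (Suc n) U = (\<Sum>a\<in>F. p a * ifs_mass F p f x0 n (f a -` U))"

text \<open>After n steps there are only finitely many atoms, so subadditivity holds for arbitrary
  sets. Finite index sets are enough because a cover of a compact set is thinned out before its mass
  is counted.\<close>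

lemma ifs_mass_Union_le:
  assumes "\<And>a. a \<in> F \<Longrightarrow> 0 \<le> p a" "finite I"
  shows "ifs_mass F p f x0 n (\<Union>i\<in>I. U i) \<le> (\<Sum>i\<in>I. ifs_mass F p f x0 n (U i))"
proof (induction n arbitrary: U)
  case 0
  show ?case
  proof (cases "x0 \<in> (\<Union>i\<in>I. U i)")
    case True
    then obtain i where "i \<in> I" "x0 \<in> U i" by blast
    then have "1 = ifs_mass F p f x0 0 (U i)" by simp
    also have "\<dots> \<le> (\<Sum>i\<in>I. ifs_mass F p f x0 0 (U i))"
      by (rule member_le_sum) (use \<open>i \<in> I\<close> assms in auto)
    finally show ?thesis by (metis True ifs_mass.simps(1))
  qed (auto intro!: sum_nonneg)
next
  case (Suc n)
  have "ifs_mass F p f x0 (Suc n) (\<Union>i\<in>I. U i)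
      = (\<Sum>a\<in>F. p a * ifs_mass F p f x0 n (\<Union>i\<in>I. f a -` U i))"
    by (simp add: vimage_UN)
  also have "\<dots> \<le> (\<Sum>a\<in>F. p a * (\<Sum>i\<in>I. ifs_mass F p f x0 n (f a -` U i)))"
    by (intro sum_mono mult_left_mono Suc assms)
  also have "\<dots> = (\<Sum>i\<in>I. ifs_mass F p f x0 (Suc n) (U i))"
    by (simp add: sum_distrib_left) (rule sum.swap)
  finally show ?case .
qed

lemma ifs_mass_eq_1:
  assumes "(\<Sum>a\<in>F. p a) = 1" "x0 \<in> \<Lambda>" "\<And>a x. a \<in> F \<Longrightarrow> x \<in> \<Lambda> \<Longrightarrow> f a x \<in> \<Lambda>" "\<Lambda> \<subseteq> U"
  shows "ifs_mass F p f x0 n U = 1"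
  using assms(4)
proof (induction n arbitrary: U)
  case (Suc n)
  have "ifs_mass F p f x0 n (f a -` U) = 1" if "a \<in> F" for a
    by (rule Suc.IH) (use assms(3) that Suc.prems in auto)
  then show ?case using assms(1) by simp
qed (use assms(2) in auto)

lemma ifs_mass_le_1:
  assumes "(\<Sum>a\<in>F. p a) = 1" "\<And>a. a \<in> F \<Longrightarrow> 0 \<le> p a"
  shows "ifs_mass F p f x0 n U \<le> 1"
proof (induction n arbitrary: U)
  case (Suc n)
  have "(\<Sum>a\<in>F. p a * ifs_mass F p f x0 n (f a -` U)) \<le> (\<Sum>a\<in>F. p a * 1)"
    by (intro sum_mono mult_left_mono Suc assms)
  then show ?case using assms(1) by simp
qed simp

lemma ifs_mass_eq_0:
  assumes "x0 \<in> \<Lambda>" "\<And>a x. a \<in> F \<Longrightarrow> x \<in> \<Lambda> \<Longrightarrow> f a x \<in> \<Lambda>" "U \<inter> \<Lambda> = {}"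
  shows "ifs_mass F p f x0 n U = 0"
  using assms(3)
proof (induction n arbitrary: U)
  case (Suc n)
  have "ifs_mass F p f x0 n (f a -` U) = 0" if "a \<in> F" for a
    by (rule Suc.IH) (use assms(2) that Suc.prems in auto)
  then show ?case by simp
qed (use assms(1) in auto)

text \<open>A set of diameter less than \<open>\<delta>\<close> meets at most one of the pieces \<open>f a ` \<Lambda>\<close>; pulling it back
  by that map enlarges its diameter at most by \<open>1 / c a\<close>, which the factor \<open>p a\<close> compensates.\<close>

lemma ifs_mass_le_diam:
  fixes f :: "'i \<Rightarrow> 'a::metric_space \<Rightarrow> 'a"
  assumes F: "finite F" and x0: "x0 \<in> \<Lambda>"
    and inv: "\<And>a x. a \<in> F \<Longrightarrow> x \<in> \<Lambda> \<Longrightarrow> f a x \<in> \<Lambda>"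
    and c: "\<And>a. a \<in> F \<Longrightarrow> 0 < c a"
    and exp: "\<And>a x y. a \<in> F \<Longrightarrow> x \<in> \<Lambda> \<Longrightarrow> y \<in> \<Lambda> \<Longrightarrow> c a * dist x y \<le> dist (f a x) (f a y)"
    and \<delta>: "0 < \<delta>"
    and sep: "\<And>a b x y. a \<in> F \<Longrightarrow> b \<in> F \<Longrightarrow> a \<noteq> b \<Longrightarrow> x \<in> \<Lambda> \<Longrightarrow> y \<in> \<Lambda> \<Longrightarrow> \<delta> \<le> dist (f a x) (f b y)"
    and p: "\<And>a. a \<in> F \<Longrightarrow> 0 \<le> p a" "\<And>a. a \<in> F \<Longrightarrow> p a \<le> c a powr t" "(\<Sum>a\<in>F. p a) = 1"
    and \<theta>: "\<And>a. a \<in> F \<Longrightarrow> p a \<le> \<theta>" "0 \<le> \<theta>" and t: "0 \<le> t"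
    and D: "\<And>x y. x \<in> U \<inter> \<Lambda> \<Longrightarrow> y \<in> U \<inter> \<Lambda> \<Longrightarrow> dist x y \<le> D" "0 \<le> D"
  shows "ifs_mass F p f x0 n U \<le> (D / \<delta>) powr t + \<theta> ^ n"
  using D
\<comment> \<open>The summand \<open>\<theta> ^ n\<close> is the price of stopping after n steps: an
  atom has diameter 0 and may still carry that much mass. For n = 0 the summand is 1 and the bound
  is trivial.\<close>
proof (induction n arbitrary: U D)
  case (Suc n)
  define A where "A = {a\<in>F. f a -` U \<inter> \<Lambda> \<noteq> {}}"
  have fA: "finite A" using F by (simp add: A_def)
  have "(\<Sum>a\<in>F. p a * ifs_mass F p f x0 n (f a -` U)) = (\<Sum>a\<in>A. p a * ifs_mass F p f x0 n (f a -` U))"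
  proof (rule sum.mono_neutral_right)
    show "\<forall>a\<in>F - A. p a * ifs_mass F p f x0 n (f a -` U) = 0"
      using ifs_mass_eq_0[of x0 \<Lambda> F f, OF x0 inv] by (auto simp: A_def)
  qed (use F A_def in auto)
  then have eq: "ifs_mass F p f x0 (Suc n) U = (\<Sum>a\<in>A. p a * ifs_mass F p f x0 n (f a -` U))" by simp
  consider "A = {}" | a where "A = {a}" | a b where "a \<in> A" "b \<in> A" "a \<noteq> b" by blast
  then show ?case
  proof cases
    case 1
    with eq \<theta> show ?thesis by simp
  next
    case 2
    then have a: "a \<in> F" by (auto simp: A_def)
    have "ifs_mass F p f x0 n (f a -` U) \<le> (D / c a / \<delta>) powr t + \<theta> ^ n"
    proof (rule Suc.IH)
      show "dist x y \<le> D / c a" if "x \<in> f a -` U \<inter> \<Lambda>" "y \<in> f a -` U \<inter> \<Lambda>" for x y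
      proof -
        have "c a * dist x y \<le> dist (f a x) (f a y)" using exp a that by auto
        also have "\<dots> \<le> D" using Suc.prems(1) inv a that by auto
        finally show ?thesis using c[OF a] by (simp add: field_simps)
      qed
    qed (use Suc.prems c[OF a] in auto)
    then have "ifs_mass F p f x0 (Suc n) U \<le> p a * ((D / c a / \<delta>) powr t + \<theta> ^ n)"
      using eq 2 p(1)[OF a] by (simp add: mult_left_mono)
    also have "\<dots> \<le> c a powr t * (D / c a / \<delta>) powr t + \<theta> * \<theta> ^ n"
      unfolding distrib_left by (intro add_mono mult_right_mono p a \<theta>) (use \<theta> in auto)
    also have "c a powr t * (D / c a / \<delta>) powr t = (D / \<delta>) powr t"
      using c[OF a] \<delta> Suc.prems(2) by (subst powr_mult[symmetric]) auto
    finally show ?thesis by simp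
  next
    case 3
    then obtain x y where "x \<in> f a -` U \<inter> \<Lambda>" "y \<in> f b -` U \<inter> \<Lambda>" by (auto simp: A_def)
    moreover from 3 have "a \<in> F" "b \<in> F" by (auto simp: A_def)
    ultimately have "\<delta> \<le> dist (f a x) (f b y)" "dist (f a x) (f b y) \<le> D"
      using sep 3 Suc.prems(1) inv by auto
    then have "1 \<le> D / \<delta>" using \<delta> by simp
    then have "1 \<le> (D / \<delta>) powr t" using t ge_one_powr_ge_zero by blast
    moreover have "ifs_mass F p f x0 (Suc n) U \<le> 1" using ifs_mass_le_1[OF p(3,1)] .
    ultimately show ?thesis using \<theta> by (smt (verit) zero_le_power)
  qed
qed (use \<theta> in auto)

lemma finite_disjoint_compact_separated:
  fixes K :: "'i \<Rightarrow> 'a::metric_space set"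
  assumes "finite F" "\<And>a. a \<in> F \<Longrightarrow> compact (K a)" "\<And>a b. a \<in> F \<Longrightarrow> b \<in> F \<Longrightarrow> a \<noteq> b \<Longrightarrow> K a \<inter> K b = {}"
  obtains \<delta> where "0 < \<delta>"
    "\<And>a b x y. a \<in> F \<Longrightarrow> b \<in> F \<Longrightarrow> a \<noteq> b \<Longrightarrow> x \<in> K a \<Longrightarrow> y \<in> K b \<Longrightarrow> \<delta> \<le> dist x y"
proof -
  have "\<exists>d>0. \<forall>x\<in>K a. \<forall>y\<in>K b. a \<noteq> b \<longrightarrow> d \<le> dist x y" if "a \<in> F" "b \<in> F" for a b
  proof (cases "a = b")
    case False
    show ?thesis
    proof (cases "K a \<times> K b = {}")
      case False
      have "compact (K a \<times> K b)" using assms(2) that by (intro compact_Times)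
      moreover have "continuous_on (K a \<times> K b) (\<lambda>z. dist (fst z) (snd z))" by (intro continuous_intros)
      ultimately obtain z where z: "z \<in> K a \<times> K b" "\<And>w. w \<in> K a \<times> K b \<Longrightarrow> dist (fst z) (snd z) \<le> dist (fst w) (snd w)"
        using False continuous_attains_inf[of "K a \<times> K b" "\<lambda>z. dist (fst z) (snd z)"] by blast
      have "fst z \<noteq> snd z" using z(1) assms(3)[OF that \<open>a \<noteq> b\<close>] by auto
      then show ?thesis using z(2) by (intro exI[of _ "dist (fst z) (snd z)"]) auto
    qed (auto intro: exI[of _ 1])
  qed (auto intro: exI[of _ 1])
  then obtain d where d: "\<And>a b. a \<in> F \<Longrightarrow> b \<in> F \<Longrightarrow> 0 < d a b \<and> (\<forall>x\<in>K a. \<forall>y\<in>K b. a \<noteq> b \<longrightarrow> d a b \<le> dist x y)"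
    by metis
  \<comment> \<open>The number 1 keeps the minimum defined when \<open>F\<close> is empty.\<close>
  define \<delta> where "\<delta> = Min (insert 1 ((\<lambda>(a,b). d a b) ` (F \<times> F)))"
  have fin: "finite (insert 1 ((\<lambda>(a,b). d a b) ` (F \<times> F)))" using assms(1) by simp
  show thesis
  proof
    show "0 < \<delta>" unfolding \<delta>_def using fin d by (subst Min_gr_iff) auto
    show "\<delta> \<le> dist x y" if "a \<in> F" "b \<in> F" "a \<noteq> b" "x \<in> K a" "y \<in> K b" for a b x y
    proof -
      have "\<delta> \<le> d a b" unfolding \<delta>_def using that by (intro Min_le fin) auto
      also have "\<dots> \<le> dist x y" using d that by auto
      finally show ?thesis .
    qed
  qed
qed

text \<open>A single scale suffices: the infimum over the covers of mesh at most 1 is one of the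
  terms of the supremum, hence 0 as well.\<close>

lemma hausdorff_measure_0D:
  assumes "hausdorff_measure s A = 0" "0 < \<epsilon>"
  obtains U where "A \<subseteq> (\<Union>i::nat. U i)" "\<And>i. bounded (U i)" "(\<Sum>i. diam_pow s (U i)) < ennreal \<epsilon>"
proof -
  have "(INF U\<in>{U :: nat \<Rightarrow> 'a set. A \<subseteq> (\<Union>i. U i) \<and> (\<forall>i. bounded (U i) \<and> diameter (U i) \<le> 1)}.
        \<Sum>i. diam_pow s (U i)) \<le> hausdorff_measure s A"
    unfolding hausdorff_measure_def by (rule SUP_upper) simp
  also have "\<dots> < ennreal \<epsilon>" using assms by simp
  finally show thesis using that unfolding INF_less_iff by auto
qed

lemma hausdorff_measure_mono:
  assumes "A \<subseteq> B" shows "hausdorff_measure s A \<le> hausdorff_measure s B"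
  unfolding hausdorff_measure_def
  by (intro SUP_mono' INF_superset_mono) (use assms in auto)

lemma hausdorff_dim_geI:
  assumes "\<And>t. 0 \<le> t \<Longrightarrow> t < s \<Longrightarrow> hausdorff_measure t A \<noteq> 0"
  shows "ereal s \<le> hausdorff_dim A"
  unfolding hausdorff_dim_def by (rule INF_greatest) (use assms in force)

text \<open>The mass distribution principle for a system whose Moran sum is at least 1. The powers
  \<open>c a powr t\<close> are scaled down to probabilities; then every set has mass at most
  (diameter / \<delta>)^t + \<theta>^n, and a cover with a small sum cannot account for the total
  mass 1 once n is large.\<close>

theorem hausdorff_measure_ifs_neq_0:
  fixes f :: "'i \<Rightarrow> 'a::metric_space \<Rightarrow> 'a"
  assumes F: "finite F" and \<Lambda>: "compact \<Lambda>" and x0: "x0 \<in> \<Lambda>"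
    and cont: "\<And>a. a \<in> F \<Longrightarrow> continuous_on \<Lambda> (f a)"
    and inv: "\<And>a x. a \<in> F \<Longrightarrow> x \<in> \<Lambda> \<Longrightarrow> f a x \<in> \<Lambda>"
    and c: "\<And>a. a \<in> F \<Longrightarrow> 0 < c a" "\<And>a. a \<in> F \<Longrightarrow> c a < 1"
    and exp: "\<And>a x y. a \<in> F \<Longrightarrow> x \<in> \<Lambda> \<Longrightarrow> y \<in> \<Lambda> \<Longrightarrow> c a * dist x y \<le> dist (f a x) (f a y)"
    and disj: "\<And>a b x y. a \<in> F \<Longrightarrow> b \<in> F \<Longrightarrow> a \<noteq> b \<Longrightarrow> x \<in> \<Lambda> \<Longrightarrow> y \<in> \<Lambda> \<Longrightarrow> f a x \<noteq> f b y"
    and t: "0 \<le> t" and sum: "1 \<le> (\<Sum>a\<in>F. c a powr t)"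
  shows "hausdorff_measure t \<Lambda> \<noteq> 0"
proof
  assume 0: "hausdorff_measure t \<Lambda> = 0"
  show False
  \<comment> \<open>For t = 0 every rate has power 1 and no \<theta> below 1 is available. Here the
    convention 0^0 = 1 decides: each nonempty member of a cover contributes 1.\<close>
  proof (cases "t = 0")
    case True
    obtain U where U: "\<Lambda> \<subseteq> (\<Union>i::nat. U i)" "(\<Sum>i. diam_pow t (U i)) < ennreal 1"
      using hausdorff_measure_0D[OF 0, of 1] zero_less_one by metis
    from U(1) x0 obtain i where "x0 \<in> U i" by blast
    then have "1 = diam_pow t (U i)" using True by (auto simp: diam_pow_def)
    also have "\<dots> = (\<Sum>j\<in>{i}. diam_pow t (U j))" by simp
    also have "\<dots> \<le> (\<Sum>i. diam_pow t (U i))" by (rule sum_le_suminf) auto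
    finally show False using U(2) by simp
  next
    case False
    with t have t: "0 < t" by simp
    obtain \<delta> where \<delta>: "0 < \<delta>" and sep:
      "\<And>a b x y. a \<in> F \<Longrightarrow> b \<in> F \<Longrightarrow> a \<noteq> b \<Longrightarrow> x \<in> f a ` \<Lambda> \<Longrightarrow> y \<in> f b ` \<Lambda> \<Longrightarrow> \<delta> \<le> dist x y"
      by (rule finite_disjoint_compact_separated[OF F, of "\<lambda>a. f a ` \<Lambda>"])
        (use compact_continuous_image[OF cont \<Lambda>] disj in blast)+
    define S where "S = (\<Sum>a\<in>F. c a powr t)"
    define p where "p a = c a powr t / S" for a
    have S: "1 \<le> S" using sum by (simp add: S_def)
    have p: "0 \<le> p a" "p a \<le> c a powr t" for a
      using S by (auto simp: p_def divide_le_eq mult_le_cancel_left1 not_less)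
    have p1: "(\<Sum>a\<in>F. p a) = 1" unfolding p_def using S by (simp add: sum_divide_distrib[symmetric] S_def)
    define \<theta> where "\<theta> = Max (insert 0 ((\<lambda>a. c a powr t) ` F))"
    have "c a powr t < 1" if "a \<in> F" for a
      using powr_less_mono2[of t "c a" 1] c[OF that] t by simp
    then have \<theta>: "0 \<le> \<theta>" "\<theta> < 1"
      unfolding \<theta>_def using F by (auto simp: Max_ge_iff)
    have p\<theta>: "p a \<le> \<theta>" if "a \<in> F" for a
    proof -
      have "c a powr t \<le> \<theta>" unfolding \<theta>_def using F that by (intro Max_ge) auto
      then show ?thesis using p(2)[of a] by simp
    qed
    \<comment> \<open>The enlarged cover below has sum at most 2 \<epsilon>, which then contributes
      2 \<epsilon> / \<delta>^t = 1/2 < 1 to the mass bound.\<close>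
    define \<epsilon> where "\<epsilon> = \<delta> powr t / 4"
    have \<epsilon>: "0 < \<epsilon>" using \<delta> by (simp add: \<epsilon>_def)
    from hausdorff_measure_0D[OF 0 \<epsilon>] obtain U where U: "\<Lambda> \<subseteq> (\<Union>i::nat. U i)" "\<And>i. bounded (U i)"
      "(\<Sum>i. diam_pow t (U i)) < ennreal \<epsilon>" by metis
    let ?d = "\<lambda>i. diameter (U i)"
    have d0: "0 \<le> ?d i" for i using U(2) by (simp add: diameter_ge_0)
    \<comment> \<open>The members of the cover need not be open. Enlarging the i-th one by r adds at
      most 2 r to its diameter, and r is chosen so small that the whole sum grows by at most
      \<epsilon>. Compactness then leaves finitely many members.\<close>
    have "\<exists>r>0. (?d i + 2 * r) powr t < ?d i powr t + \<epsilon> * (1/2) ^ Suc i" for i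
    proof -
      have "((\<lambda>r. (?d i + 2 * r) powr t) \<longlongrightarrow> (?d i + 2 * 0) powr t) (at_right 0)"
        by (rule tendsto_powr2) (use t d0 in \<open>auto intro!: tendsto_eq_intros eventually_at_rightI[of 0 1]\<close>)
      moreover have "(?d i + 2 * 0) powr t < ?d i powr t + \<epsilon> * (1/2) ^ Suc i" using \<epsilon> by simp
      ultimately have "\<forall>\<^sub>F r in at_right 0. (?d i + 2 * r) powr t < ?d i powr t + \<epsilon> * (1/2) ^ Suc i"
        by (rule order_tendstoD)
      then obtain b where b: "b > 0" "\<And>r. 0 < r \<Longrightarrow> r < b \<Longrightarrow> (?d i + 2 * r) powr t < ?d i powr t + \<epsilon> * (1/2) ^ Suc i"
        unfolding eventually_at_right_field by blast
      have "0 < b / 2" "b / 2 < b" using b(1) by auto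
      then show ?thesis using b(2) by blast
    qed
    then obtain r where r: "\<And>i. 0 < r i"
      "\<And>i. (?d i + 2 * r i) powr t < ?d i powr t + \<epsilon> * (1/2) ^ Suc i" by metis
    define V where "V i = (\<Union>x\<in>U i. ball x (r i))" for i
    have "\<Lambda> \<subseteq> (\<Union>i\<in>UNIV. V i)" using U(1) r(1) unfolding V_def by (force intro!: centre_in_ball[THEN iffD2])
    moreover have "open (V i)" for i unfolding V_def by blast
    ultimately obtain I where I: "finite I" "\<Lambda> \<subseteq> (\<Union>i\<in>I. V i)"
      using compactE_image[OF \<Lambda>, of UNIV V] by metis
    have VD: "dist x y \<le> ?d i + 2 * r i" if "x \<in> V i \<inter> \<Lambda>" "y \<in> V i \<inter> \<Lambda>" for x y i
    proof -
      from that obtain x' y' where "x' \<in> U i" "y' \<in> U i" "dist x' x < r i" "dist y' y < r i"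
        by (auto simp: V_def)
      moreover have "dist x' y' \<le> ?d i" using diameter_bounded_bound U(2) calculation by blast
      moreover have "dist x y \<le> dist x' x + dist x' y' + dist y' y"
        by (metis (no_types, opaque_lifting) add.commute add_left_mono dist_commute dist_triangle dist_triangle_le order_trans)
      ultimately show ?thesis by simp
    qed
    have main: "1 \<le> 2 * \<epsilon> / \<delta> powr t + card I * \<theta> ^ N" for N
    proof -
      have "1 = ifs_mass F p f x0 N (\<Union>i\<in>I. V i)"
        using ifs_mass_eq_1[OF p1 x0 inv I(2)] by simp
      also have "\<dots> \<le> (\<Sum>i\<in>I. ifs_mass F p f x0 N (V i))"
        by (rule ifs_mass_Union_le) (use p I in auto)
      also have "\<dots> \<le> (\<Sum>i\<in>I. ((?d i + 2 * r i) / \<delta>) powr t + \<theta> ^ N)"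
      proof (rule sum_mono)
        fix i assume "i \<in> I"
        show "ifs_mass F p f x0 N (V i) \<le> ((?d i + 2 * r i) / \<delta>) powr t + \<theta> ^ N"
        proof (rule ifs_mass_le_diam[OF F x0 inv c(1) exp \<delta> _ p p1])
          show "\<delta> \<le> dist (f a x) (f b y)" if "a \<in> F" "b \<in> F" "a \<noteq> b" "x \<in> \<Lambda>" "y \<in> \<Lambda>" for a b x y
            using sep[of a b "f a x" "f b y"] that by auto
          show "0 \<le> diameter (U i) + 2 * r i" using d0[of i] r(1)[of i] by simp
        qed (use p\<theta> \<theta> t VD in auto)
      qed
      also have "\<dots> = (\<Sum>i\<in>I. (?d i + 2 * r i) powr t) / \<delta> powr t + card I * \<theta> ^ N"
        using d0 r(1) \<delta> by (simp add: sum.distrib sum_divide_distrib powr_divide add_nonneg_nonneg less_imp_le)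
      also have "(\<Sum>i\<in>I. (?d i + 2 * r i) powr t) \<le> 2 * \<epsilon>"
      proof -
        have "(\<Sum>i\<in>I. (?d i + 2 * r i) powr t) \<le> (\<Sum>i\<in>I. ?d i powr t + \<epsilon> * (1/2) ^ Suc i)"
          by (intro sum_mono less_imp_le r)
        also have "\<dots> = (\<Sum>i\<in>I. ?d i powr t) + \<epsilon> * (\<Sum>i\<in>I. (1/2) ^ Suc i)"
          by (simp add: sum.distrib sum_distrib_left)
        also have "(\<Sum>i\<in>I. (1/2::real) ^ Suc i) \<le> (\<Sum>i. (1/2) ^ Suc i)"
          by (rule sum_le_suminf) (use I power_half_series sums_summable in auto)
        also have "(\<Sum>i. (1/2::real) ^ Suc i) = 1" using power_half_series sums_unique by metis
        also have "(\<Sum>i\<in>I. ?d i powr t) \<le> \<epsilon>"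
        proof -
          have "diam_pow t (U i) = ennreal (?d i powr t)" for i using t by (auto simp: diam_pow_def)
          then have "ennreal (\<Sum>i\<in>I. ?d i powr t) = (\<Sum>i\<in>I. diam_pow t (U i))" by simp
          also have "\<dots> \<le> (\<Sum>i. diam_pow t (U i))" by (rule sum_le_suminf) (use I in auto)
          also have "\<dots> \<le> ennreal \<epsilon>" using U(3) by simp
          finally show ?thesis using \<epsilon> by simp
        qed
        finally show ?thesis using \<epsilon> by simp
      qed
      finally show ?thesis using \<delta> by (simp add: divide_right_mono)
    qed
    have "(\<lambda>N. \<theta> ^ N) \<longlonglongrightarrow> 0" by (rule LIMSEQ_realpow_zero[OF \<theta>])
    then have "(\<lambda>N. 2 * \<epsilon> / \<delta> powr t + real (card I) * \<theta> ^ N) \<longlonglongrightarrow> 2 * \<epsilon> / \<delta> powr t + real (card I) * 0"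
      by (intro tendsto_add tendsto_mult tendsto_const)
    then have "1 \<le> 2 * \<epsilon> / \<delta> powr t + real (card I) * 0"
      by (rule LIMSEQ_le_const) (use main in auto)
    then show False using \<delta> by (simp add: \<epsilon>_def)
  qed
qed

section \<open>Schoenberg's space-filling curve\<close>

text \<open>The curve serves to lift measures on the square to the line, where Helly's theorem applies.\<close>

definition digit_step :: "real \<Rightarrow> real" where
  "digit_step t = min 1 (max 0 (1/2 - cos (pi * t)))"

lemma digit_step_bounds: "0 \<le> digit_step t" "digit_step t \<le> 1"
  by (auto simp: digit_step_def)

lemma digit_step_periodic: "digit_step (2 * of_int m + t) = digit_step t"
proof -
  have "cos (pi * (2 * of_int m + t)) = cos (pi * t + of_int m * (2 * pi))" by (simp add: algebra_simps)
  also have "\<dots> = cos (pi * t)"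
    by (metis cos_add cos_int_2pin diff_zero mult.commute mult.right_neutral mult_zero_right sin_int_2pin)
  finally show ?thesis by (simp add: digit_step_def)
qed

lemma digit_step_0:
  assumes "0 \<le> t" "t \<le> 1/3" shows "digit_step t = 0"
proof -
  have "cos (pi / 3) \<le> cos (pi * t)"
    by (rule cos_monotone_0_pi_le) (use assms mult_left_mono[of t "1/3" pi] in auto)
  then show ?thesis by (simp add: digit_step_def cos_60)
qed

lemma digit_step_1:
  assumes "2/3 \<le> t" "t \<le> 1" shows "digit_step t = 1"
proof -
  have "cos (pi * t) \<le> cos (pi * (2/3))"
    by (rule cos_monotone_0_pi_le) (use assms in auto)
  also have "cos (pi * (2/3)) = - 1/2" using cos_120 by (simp add: field_simps)
  finally show ?thesis by (simp add: digit_step_def)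
qed

text \<open>The point of the middle-third Cantor set with ternary digits
  \<open>2 * a k\<close>.\<close>

definition cantor_point :: "(nat \<Rightarrow> real) \<Rightarrow> real" where
  "cantor_point a = (\<Sum>k. 2 * a k / 3 ^ Suc k)"

lemma cantor_point_sums:
  assumes "\<And>k. a k \<in> {0, 1}"
  shows "summable (\<lambda>k. 2 * a k / 3 ^ Suc k)" "0 \<le> cantor_point a" "cantor_point a \<le> 1"
proof -
  have *: "(\<lambda>k. 2 * (1/3) ^ Suc k) sums (1::real)"
    using sums_mult[OF geometric_sums[of "1/3::real"], of "2/3"] by (simp add: field_simps)
  have le: "2 * a k / 3 ^ Suc k \<le> 2 * (1/3) ^ Suc k" "0 \<le> 2 * a k / 3 ^ Suc k" for k
    using assms[of k] by (auto simp: field_simps)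
  show sm: "summable (\<lambda>k. 2 * a k / 3 ^ Suc k)"
    by (rule summable_comparison_test'[OF sums_summable[OF *], of 0])
      (simp only: real_norm_def abs_of_nonneg[OF le(2)] le(1))
  show "0 \<le> cantor_point a" unfolding cantor_point_def by (rule suminf_nonneg[OF sm]) (rule le)
  have "cantor_point a \<le> (\<Sum>k. 2 * (1/3) ^ Suc k)"
    unfolding cantor_point_def by (intro suminf_le sm sums_summable[OF *] le)
  then show "cantor_point a \<le> 1" using sums_unique[OF *] by simp
qed

text \<open>Multiplication by 3^n moves the first n ternary digits in front of the point. All of
  them are even, so they form an even integer, which the period 2 removes. The remaining fraction
  starts with the digit 2 a(n), so it lies in [0, 1/3] or in [2/3, 1].\<close>

lemma digit_step_cantor_point:
  assumes a: "\<And>k. a k \<in> {0, 1}"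
  shows "digit_step (3 ^ n * cantor_point a) = a n"
proof -
  define b where "b k = a (k + Suc n)" for k
  have b: "b k \<in> {0, 1}" for k using a by (simp add: b_def)
  let ?s = "\<lambda>k. 2 * a k / 3 ^ Suc k"
  have "cantor_point a = (\<Sum>k. ?s (k + Suc n)) + (\<Sum>k<Suc n. ?s k)"
    unfolding cantor_point_def by (rule suminf_split_initial_segment) (rule cantor_point_sums[OF a])
  also have "(\<Sum>k. ?s (k + Suc n)) = (\<Sum>k. (2 * b k / 3 ^ Suc k) / 3 ^ Suc n)"
    by (simp add: b_def power_add field_simps)
  also have "\<dots> = cantor_point b / 3 ^ Suc n"
    unfolding cantor_point_def by (rule suminf_divide) (rule cantor_point_sums[OF b])
  finally have eq: "cantor_point a = cantor_point b / 3 ^ Suc n + (\<Sum>k<Suc n. ?s k)" .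
  have "3 ^ n * cantor_point a = cantor_point b / 3 + 3 ^ n * (\<Sum>k<Suc n. ?s k)"
    unfolding eq by (simp add: distrib_left)
  also have "3 ^ n * (\<Sum>k<Suc n. ?s k) = 2 * a n / 3 + 3 ^ n * (\<Sum>k<n. ?s k)"
    by (simp add: field_simps)
  also have "3 ^ n * (\<Sum>k<n. ?s k) = 2 * (\<Sum>k<n. a k * 3 ^ (n - Suc k))"
    unfolding sum_distrib_left by (intro sum.cong) (auto simp: field_simps power_diff)
  also have "(\<Sum>k<n. a k * 3 ^ (n - Suc k)) = of_int (\<Sum>k<n. \<lfloor>a k\<rfloor> * 3 ^ (n - Suc k))"
  proof -
    have *: "real_of_int \<lfloor>a k\<rfloor> = a k" for k using a[of k] by auto
    show ?thesis by (simp only: of_int_sum of_int_mult of_int_power of_int_numeral *)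
  qed
  finally have "3 ^ n * cantor_point a
      = 2 * of_int (\<Sum>k<n. \<lfloor>a k\<rfloor> * 3 ^ (n - Suc k)) + (cantor_point b / 3 + 2 * a n / 3)"
    by (simp only: ac_simps)
  then have "digit_step (3 ^ n * cantor_point a) = digit_step (cantor_point b / 3 + 2 * a n / 3)"
    by (simp only: digit_step_periodic)
  also have "\<dots> = a n"
    using a[of n] cantor_point_sums(2,3)[of b, OF b] by (auto intro!: digit_step_0 digit_step_1)
  finally show ?thesis .
qed

definition binary_digit :: "real \<Rightarrow> nat \<Rightarrow> real" where
  "binary_digit x n = of_int (\<lfloor>2 ^ Suc n * x\<rfloor> mod 2)"

lemma binary_digit_01: "binary_digit x n \<in> {0, 1}"
  unfolding binary_digit_def by (cases "even \<lfloor>2 ^ Suc n * x\<rfloor>") (auto simp: even_iff_mod_2_eq_zero odd_iff_mod_2_eq_one)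

text \<open>The partial sums telescope to floor(2^n x) / 2^n, which is within 2^(-n) of x. The range
  of x makes the integer part 0, so that the digits behind the point determine x.\<close>

lemma binary_digit_sums:
  assumes "0 \<le> x" "x < 1"
  shows "(\<lambda>n. binary_digit x n / 2 ^ Suc n) sums x"
proof -
  have partial: "(\<Sum>k<n. binary_digit x k / 2 ^ Suc k) = of_int \<lfloor>2 ^ n * x\<rfloor> / 2 ^ n" for n
  proof (induction n)
    case (Suc n)
    define y where "y = 2 ^ n * x"
    have "2 * \<lfloor>y\<rfloor> \<le> \<lfloor>2 * y\<rfloor>" "\<lfloor>2 * y\<rfloor> \<le> 2 * \<lfloor>y\<rfloor> + 1" by linarith+
    then consider "\<lfloor>2 * y\<rfloor> = 2 * \<lfloor>y\<rfloor>" | "\<lfloor>2 * y\<rfloor> = 2 * \<lfloor>y\<rfloor> + 1" by linarith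
    then have "\<lfloor>2 * y\<rfloor> = 2 * \<lfloor>y\<rfloor> + \<lfloor>2 * y\<rfloor> mod 2" by cases simp_all
    then have "(of_int \<lfloor>2 * y\<rfloor> :: real) = 2 * of_int \<lfloor>y\<rfloor> + of_int (\<lfloor>2 * y\<rfloor> mod 2)"
      by (metis of_int_add of_int_mult of_int_numeral)
    then have "of_int \<lfloor>y\<rfloor> / 2 ^ n + of_int (\<lfloor>2 * y\<rfloor> mod 2) / 2 ^ Suc n = (of_int \<lfloor>2 * y\<rfloor> :: real) / 2 ^ Suc n"
      by (simp add: add_divide_distrib)
    moreover have "2 * y = 2 ^ Suc n * x" by (simp add: y_def)
    ultimately show ?case using Suc by (simp only: sum.lessThan_Suc binary_digit_def y_def)
  next
    case 0
    have "\<lfloor>x\<rfloor> = 0" using assms by (intro floor_unique) auto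
    then show ?case by simp
  qed
  have "(\<lambda>n. x - of_int \<lfloor>2 ^ n * x\<rfloor> / 2 ^ n) \<longlonglongrightarrow> 0"
  proof (rule Lim_null_comparison)
    show "\<forall>\<^sub>F n in sequentially. norm (x - of_int \<lfloor>2 ^ n * x\<rfloor> / 2 ^ n) \<le> (1/2) ^ n"
    proof (intro always_eventually allI)
      fix n
      define d where "d = 2 ^ n * x - of_int \<lfloor>2 ^ n * x\<rfloor>"
      have d: "0 \<le> d" "d \<le> 1" unfolding d_def by linarith+
      have "x - of_int \<lfloor>2 ^ n * x\<rfloor> / 2 ^ n = d / 2 ^ n" by (simp add: d_def diff_divide_distrib)
      also have "norm (d / 2 ^ n) \<le> (1/2) ^ n"
        using d by (simp add: power_one_over divide_right_mono)
      finally show "norm (x - of_int \<lfloor>2 ^ n * x\<rfloor> / 2 ^ n) \<le> (1/2) ^ n" .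
    qed
  qed (simp add: LIMSEQ_power_zero)
  then have "(\<lambda>n. x - (x - of_int \<lfloor>2 ^ n * x\<rfloor> / 2 ^ n)) \<longlonglongrightarrow> x - 0" by (intro tendsto_intros)
  then show ?thesis unfolding sums_def partial by simp
qed

text \<open>Coordinates 0 and 1 read the digits in even and in odd places, so they can be prescribed
  independently; this is why the curve fills the square.\<close>

definition schoenberg_coord :: "nat \<Rightarrow> real \<Rightarrow> real" where
  "schoenberg_coord i t = (\<Sum>n. digit_step (3 ^ (2 * n + i) * t) / 2 ^ Suc n)"

lemma continuous_on_schoenberg_coord: "continuous_on UNIV (schoenberg_coord i)"
proof -
  have "uniform_limit UNIV (\<lambda>N t. \<Sum>n<N. digit_step (3 ^ (2 * n + i) * t) / 2 ^ Suc n)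
     (schoenberg_coord i) sequentially"
    unfolding schoenberg_coord_def
  proof (rule Weierstrass_m_test)
    show "norm (digit_step (3 ^ (2 * n + i) * t) / 2 ^ Suc n) \<le> (1/2) ^ Suc n" for n t
      using digit_step_bounds[of "3 ^ (2 * n + i) * t"] by (simp add: power_one_over field_simps)
    show "summable (\<lambda>n. (1/2::real) ^ Suc n)" using power_half_series sums_summable by blast
  qed
  then show ?thesis
    by (rule uniform_limit_theorem[rotated])
      (auto intro!: always_eventually continuous_intros simp: digit_step_def)
qed

definition schoenberg_curve :: "real \<Rightarrow> complex" where
  "schoenberg_curve t = Complex (schoenberg_coord 0 t) (schoenberg_coord 1 t)"

lemma continuous_on_schoenberg_curve: "continuous_on UNIV schoenberg_curve"
  unfolding schoenberg_curve_def Complex_eq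
  by (intro continuous_intros continuous_on_schoenberg_coord)

text \<open>A right inverse of the curve on the half-open unit square, which interleaves the binary
  digits of both coordinates. It cannot be continuous, but it is Borel, and this is enough for
  pushing measures forward.\<close>

definition schoenberg_section :: "complex \<Rightarrow> real" where
  "schoenberg_section z =
     cantor_point (\<lambda>n. binary_digit (if even n then Re z else Im z) (n div 2))"

lemma borel_measurable_schoenberg_section [measurable]: "schoenberg_section \<in> borel_measurable borel"
  unfolding schoenberg_section_def cantor_point_def binary_digit_def by measurable

lemma schoenberg_curve_section:
  assumes "0 \<le> Re z" "Re z < 1" "0 \<le> Im z" "Im z < 1"
  shows "schoenberg_curve (schoenberg_section z) = z"
proof -
  define a where "a n = binary_digit (if even n then Re z else Im z) (n div 2)" for n
  have "digit_step (3 ^ n * schoenberg_section z) = a n" for n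
    unfolding schoenberg_section_def a_def
    by (rule digit_step_cantor_point) (rule binary_digit_01)
  then have "schoenberg_coord i (schoenberg_section z) = (\<Sum>n. a (2 * n + i) / 2 ^ Suc n)" for i
    by (simp add: schoenberg_coord_def)
  moreover have "(\<Sum>n. a (2 * n + 0) / 2 ^ Suc n) = Re z"
    using sums_unique[OF binary_digit_sums[of "Re z"]] assms by (simp add: a_def)
  moreover have "(\<Sum>n. a (2 * n + 1) / 2 ^ Suc n) = Im z"
    using sums_unique[OF binary_digit_sums[of "Im z"]] assms by (simp add: a_def)
  ultimately show ?thesis by (simp add: schoenberg_curve_def complex_eq_iff)
qed

section \<open>Vague compactness\<close>

definition plane_to_square :: "complex \<Rightarrow> complex" where
  "plane_to_square z = Complex (1/2 + arctan (Re z) / pi) (1/2 + arctan (Im z) / pi)"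

definition square_to_plane :: "complex \<Rightarrow> complex" where
  "square_to_plane z = Complex (tan (pi * (Re z - 1/2))) (tan (pi * (Im z - 1/2)))"

definition open_square :: "complex set" where
  "open_square = {z. 0 < Re z \<and> Re z < 1 \<and> 0 < Im z \<and> Im z < 1}"

lemma plane_to_square_in: "plane_to_square z \<in> open_square"
proof -
  have "0 < 1/2 + arctan x / pi" "1/2 + arctan x / pi < 1" for x
    using arctan_bounded[of x] by (auto simp: field_simps)
  then show ?thesis by (simp add: open_square_def plane_to_square_def)
qed

lemma open_open_square: "open open_square"
  unfolding open_square_def by (intro open_Collect_conj open_Collect_less continuous_intros)

lemma square_to_plane_inverse: "square_to_plane (plane_to_square z) = z"
  by (simp add: square_to_plane_def plane_to_square_def complex_eq_iff tan_arctan)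

lemma scaled_tan_domain:
  fixes x :: real
  assumes "0 < x" "x < 1"
  shows "- (pi / 2) < pi * (x - 1/2)" "pi * (x - 1/2) < pi / 2"
  using mult_strict_left_mono[of "x - 1/2" "1/2" pi] mult_strict_left_mono[of "-1/2" "x - 1/2" pi] assms
  by simp_all

lemma plane_to_square_inverse:
  assumes "z \<in> open_square" shows "plane_to_square (square_to_plane z) = z"
proof -
  have "1/2 + arctan (tan (pi * (x - 1/2))) / pi = x" if "0 < x" "x < 1" for x
    using arctan_tan[OF scaled_tan_domain[OF that]] by simp
  then show ?thesis using assms
    by (simp add: open_square_def square_to_plane_def plane_to_square_def complex_eq_iff)
qed

lemma continuous_on_plane_to_square: "continuous_on UNIV plane_to_square"
  unfolding plane_to_square_def Complex_eq by (intro continuous_intros) auto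

lemma continuous_on_square_to_plane: "continuous_on open_square square_to_plane"
proof -
  have "cos (pi * (x - 1/2)) \<noteq> 0" if "0 < x" "x < 1" for x
    using cos_gt_zero_pi[OF scaled_tan_domain[OF that]] by simp
  then show ?thesis unfolding square_to_plane_def Complex_eq tan_def
    by (intro continuous_intros) (auto simp: open_square_def)
qed

lemma borel_measurable_plane_square [measurable]:
  "plane_to_square \<in> borel_measurable borel" "square_to_plane \<in> borel_measurable borel"
  "schoenberg_curve \<in> borel_measurable borel" "open_square \<in> sets borel"
proof -
  show "plane_to_square \<in> borel_measurable borel"
    using continuous_on_plane_to_square by (rule borel_measurable_continuous_onI)
  show "schoenberg_curve \<in> borel_measurable borel"
    using continuous_on_schoenberg_curve by (rule borel_measurable_continuous_onI)
  show "square_to_plane \<in> borel_measurable borel"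
    unfolding square_to_plane_def Complex_eq tan_def by measurable
  show "open_square \<in> sets borel" using open_open_square by simp
qed

text \<open>Compact support keeps the function away from the boundary of the square. The open square
  and the complement of the compact set \<open>S\<close> form an open cover of the plane, and
  \<open>F\<close> is continuous on each of the two sets.\<close>

lemma continuous_on_square_extension:
  fixes f :: "complex \<Rightarrow> real"
  assumes f: "continuous_on UNIV f" and supp: "\<And>z. f z \<noteq> 0 \<Longrightarrow> z \<in> cball 0 R"
  defines "F \<equiv> \<lambda>z. if z \<in> open_square then f (square_to_plane z) else 0"
  shows "continuous_on UNIV F" "\<exists>B. \<forall>z. \<bar>F z\<bar> \<le> B"
proof -
  define S where "S = plane_to_square ` cball 0 R"
  have S: "compact S" unfolding S_def
    by (intro compact_continuous_image continuous_on_subset[OF continuous_on_plane_to_square]) auto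
  have F0: "F z = 0" if "z \<notin> S" for z
  proof (rule ccontr)
    assume "F z \<noteq> 0"
    then have "z \<in> open_square" "square_to_plane z \<in> cball 0 R"
      using supp by (auto simp: F_def split: if_splits)
    then show False using plane_to_square_inverse that unfolding S_def by (metis image_eqI)
  qed
  have "continuous_on open_square F \<longleftrightarrow> continuous_on open_square (\<lambda>z. f (square_to_plane z))"
    by (rule continuous_on_cong) (auto simp: F_def)
  moreover have "continuous_on open_square (\<lambda>z. f (square_to_plane z))"
    by (rule continuous_on_compose2[OF f continuous_on_square_to_plane]) auto
  moreover have "continuous_on (- S) F \<longleftrightarrow> continuous_on (- S) (\<lambda>z. 0 :: real)"
    by (rule continuous_on_cong) (auto simp: F0)
  ultimately have "continuous_on (open_square \<union> - S) F"
    by (intro continuous_on_open_Un open_open_square) (use compact_imp_closed[OF S] in auto)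
  moreover have "open_square \<union> - S = UNIV" using plane_to_square_in by (auto simp: S_def)
  ultimately show F: "continuous_on UNIV F" by simp
  have "compact (F ` S)" using S F by (meson compact_continuous_image continuous_on_subset subset_UNIV)
  then obtain B where B: "\<And>y. y \<in> F ` S \<Longrightarrow> norm y \<le> B" using compact_imp_bounded bounded_iff by metis
  have "\<bar>F z\<bar> \<le> max B 0" for z
    using B[of "F z"] F0[of z] by (cases "z \<in> S") auto
  then show "\<exists>B. \<forall>z. \<bar>F z\<bar> \<le> B" by blast
qed

text \<open>One positive continuous density makes all measures of the sequence finite at the same
  time: a sum of bumps supported in the balls of radius n, the n-th damped by 2^(-n-1) and by the
  common bound for the mass of that ball.\<close>

lemma exists_weight:
  fixes \<mu> :: "nat \<Rightarrow> complex measure"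
  assumes sets: "\<And>k. sets (\<mu> k) = sets borel"
    and bdd: "\<And>R::nat. \<exists>C. \<forall>k. emeasure (\<mu> k) (cball 0 (real R)) \<le> ennreal C"
  obtains \<rho> :: "complex \<Rightarrow> real" where "continuous_on UNIV \<rho>" "\<And>z. 0 < \<rho> z"
    "\<And>k. (\<integral>\<^sup>+z. ennreal (\<rho> z) \<partial>\<mu> k) \<le> 1"
proof -
  from bdd have "\<forall>R::nat. \<exists>C. \<forall>k. emeasure (\<mu> k) (cball 0 (real R)) \<le> ennreal C" by blast
  from choice[OF this] obtain C' where C': "\<And>R k. emeasure (\<mu> k) (cball 0 (real R)) \<le> ennreal (C' R)" by blast
  define C where "C R = max 1 (C' R)" for R
  have C: "1 \<le> C R" "emeasure (\<mu> k) (cball 0 (real R)) \<le> ennreal (C R)" for R k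
    using order_trans[OF C' ennreal_leI[of "C' R" "C R"]] by (auto simp: C_def)
  define b where "b n z = (1/2) ^ Suc n / C n * min 1 (max 0 (real n - norm z))" for n and z :: complex
  have b0: "0 \<le> b n z" for n z using C(1)[of n] by (simp add: b_def)
  have b1: "b n z \<le> (1/2) ^ Suc n / C n" for n z
  proof -
    have "0 \<le> (1/2::real) ^ Suc n / C n" using C(1)[of n] by simp
    then show ?thesis unfolding b_def by (rule mult_left_le[rotated]) simp
  qed
  have b2: "b n z \<le> (1/2) ^ Suc n" for n z
  proof -
    have "(1/2) ^ Suc n / C n \<le> (1/2) ^ Suc n / 1" using C(1)[of n] by (intro divide_left_mono) auto
    then show ?thesis using b1[of n z] by simp
  qed
  have half: "summable (\<lambda>n. (1/2::real) ^ Suc n)" using power_half_series sums_summable by blast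
  have bs: "summable (\<lambda>n. b n z)" for z
  proof (rule summable_comparison_test'[OF half, of 0])
    show "norm (b n z) \<le> (1/2) ^ Suc n" for n using b0[of n z] b2[of n z] unfolding real_norm_def by linarith
  qed
  have cb: "continuous_on UNIV (b n)" for n unfolding b_def by (intro continuous_intros)
  have [measurable]: "b n \<in> borel_measurable borel" for n using cb by (rule borel_measurable_continuous_onI)
  show thesis
  proof
    have "uniform_limit UNIV (\<lambda>N z. \<Sum>n<N. b n z) (\<lambda>z. \<Sum>n. b n z) sequentially"
    proof (rule Weierstrass_m_test[OF _ half])
      show "norm (b n z) \<le> (1/2) ^ Suc n" for n z using b0[of n z] b2[of n z] unfolding real_norm_def by linarith
    qed
    then show "continuous_on UNIV (\<lambda>z. \<Sum>n. b n z)"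
      by (rule uniform_limit_theorem[rotated])
        (auto intro!: always_eventually continuous_on_sum cb)
    show "0 < (\<Sum>n. b n z)" for z
    proof -
      obtain n where "norm z < real n" using reals_Archimedean2 by blast
      then have "0 < b n z" using C(1)[of n] by (auto simp: b_def)
      then show ?thesis using suminf_pos2[OF bs b0] by blast
    qed
    show "(\<integral>\<^sup>+z. ennreal (\<Sum>n. b n z) \<partial>\<mu> k) \<le> 1" for k
    proof -
      have [measurable_cong]: "sets (\<mu> k) = sets borel" by (rule sets)
      have "(\<integral>\<^sup>+z. ennreal (\<Sum>n. b n z) \<partial>\<mu> k) = (\<integral>\<^sup>+z. (\<Sum>n. ennreal (b n z)) \<partial>\<mu> k)"
        by (intro nn_integral_cong suminf_ennreal2[symmetric] b0 bs)
      also have "\<dots> = (\<Sum>n. \<integral>\<^sup>+z. ennreal (b n z) \<partial>\<mu> k)" by (rule nn_integral_suminf) measurable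
      also have "\<dots> \<le> (\<Sum>n. ennreal ((1/2) ^ Suc n))"
      proof (intro suminf_le)
        fix n
        have "(\<integral>\<^sup>+z. ennreal (b n z) \<partial>\<mu> k)
            \<le> (\<integral>\<^sup>+z. ennreal ((1/2) ^ Suc n / C n) * indicator (cball 0 (real n)) z \<partial>\<mu> k)"
        proof (intro nn_integral_mono)
          fix z
          show "ennreal (b n z) \<le> ennreal ((1/2) ^ Suc n / C n) * indicator (cball 0 (real n)) z"
          proof (cases "z \<in> cball 0 (real n)")
            case True
            then show ?thesis using ennreal_leI[OF b1[of n z]] by simp
          next
            case False
            then have "b n z = 0" by (simp add: b_def)
            then show ?thesis by simp
          qed
        qed
        also have "\<dots> = ennreal ((1/2) ^ Suc n / C n) * emeasure (\<mu> k) (cball 0 (real n))"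
          by (rule nn_integral_cmult_indicator) (simp add: sets)
        also have "\<dots> \<le> ennreal ((1/2) ^ Suc n / C n) * ennreal (C n)"
          by (intro mult_left_mono C) auto
        also have "\<dots> = ennreal ((1/2) ^ Suc n)"
          using C(1)[of n] by (subst ennreal_mult[symmetric]) (auto simp: divide_nonneg_nonneg)
        finally show "(\<integral>\<^sup>+z. ennreal (b n z) \<partial>\<mu> k) \<le> ennreal ((1/2) ^ Suc n)" .
      qed auto
      also have "\<dots> = ennreal (\<Sum>n. (1/2) ^ Suc n)" by (rule suminf_ennreal2[OF _ half]) simp
      also have "(\<Sum>n. (1/2::real) ^ Suc n) = 1" using power_half_series sums_unique by metis
      finally show ?thesis by simp
    qed
  qed
qed

text \<open>Weighting by \<open>\<rho>\<close> and dividing by the total mass gives probability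
  measures. Their images under the section live on [0, 1], so they are tight and Helly's theorem
  applies. The lower bound on one ball makes the total masses positive; the subsequence is chosen so
  that these masses converge too.\<close>

theorem vague_sequentially_compact:
  fixes \<mu> :: "nat \<Rightarrow> complex measure"
  assumes sets: "\<And>k. sets (\<mu> k) = sets borel"
    and bdd: "\<And>R::nat. \<exists>C. \<forall>k. emeasure (\<mu> k) (cball 0 (real R)) \<le> ennreal C"
    and low: "0 < c" "\<And>k. ennreal c \<le> emeasure (\<mu> k) (cball 0 R0)"
  obtains r M where "strict_mono (r :: nat \<Rightarrow> nat)" "sets M = sets borel"
    "\<And>R. emeasure M (cball 0 R) < \<infinity>"
    "\<And>R (f :: complex \<Rightarrow> real). continuous_on UNIV f \<Longrightarrow> (\<And>z. f z \<noteq> 0 \<Longrightarrow> z \<in> cball 0 R) \<Longrightarrow>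
       (\<lambda>k. \<integral>z. f z \<partial>\<mu> (r k)) \<longlonglongrightarrow> (\<integral>z. f z \<partial>M)"
proof -
  obtain \<rho> :: "complex \<Rightarrow> real" where \<rho>: "continuous_on UNIV \<rho>" "\<And>z. 0 < \<rho> z"
    "\<And>k. (\<integral>\<^sup>+z. ennreal (\<rho> z) \<partial>\<mu> k) \<le> 1"
    using exists_weight[of \<mu>, OF sets bdd] by blast
  note [measurable_cong] = sets
  have [measurable]: "\<rho> \<in> borel_measurable borel" using \<rho>(1) by (rule borel_measurable_continuous_onI)
  have lower: "\<exists>a>0. \<forall>z\<in>cball 0 R. a \<le> \<rho> z" for R
  proof (cases "cball (0::complex) R = {}")
    case False
    from continuous_attains_inf[OF compact_cball False continuous_on_subset[OF \<rho>(1) subset_UNIV]]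
    obtain z where "\<forall>w\<in>cball 0 R. \<rho> z \<le> \<rho> w" by blast
    then show ?thesis by (intro exI[of _ "\<rho> z"] conjI \<rho>(2))
  qed (auto intro: exI[of _ 1])
  define w where "w k = enn2real (\<integral>\<^sup>+z. ennreal (\<rho> z) \<partial>\<mu> k)" for k
  have wen: "ennreal (w k) = (\<integral>\<^sup>+z. ennreal (\<rho> z) \<partial>\<mu> k)" for k
    unfolding w_def using \<rho>(3)[of k] by (intro ennreal_enn2real) (auto simp: top_unique less_top[symmetric])
  obtain a where a: "0 < a" "\<And>z. z \<in> cball 0 R0 \<Longrightarrow> a \<le> \<rho> z" using lower by blast
  have w1: "w k \<le> 1" for k using \<rho>(3)[of k] wen[of k] by (metis ennreal_le_1)
  have w0: "a * c \<le> w k" for k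
  proof -
    have "ennreal (a * c) \<le> ennreal a * emeasure (\<mu> k) (cball 0 R0)"
      using low a(1) by (simp add: ennreal_mult mult_left_mono)
    also have "\<dots> = (\<integral>\<^sup>+z. ennreal a * indicator (cball 0 R0) z \<partial>\<mu> k)"
      by (rule nn_integral_cmult_indicator[symmetric]) (simp add: sets)
    also have "\<dots> \<le> (\<integral>\<^sup>+z. ennreal (\<rho> z) \<partial>\<mu> k)"
      by (intro nn_integral_mono) (use a \<rho>(2) in \<open>auto simp: indicator_def intro!: ennreal_leI\<close>)
    finally have "ennreal (a * c) \<le> ennreal (w k)" by (simp add: wen)
    then show ?thesis by (simp add: w_def)
  qed
  have wpos: "0 < w k" for k using w0[of k] a(1) low(1) by (meson less_le_trans mult_pos_pos)
  define sec where "sec z = schoenberg_section (plane_to_square z)" for z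
  have [measurable]: "sec \<in> borel_measurable borel" unfolding sec_def by measurable
  have curve_sec: "schoenberg_curve (sec z) = plane_to_square z" for z
    unfolding sec_def using plane_to_square_in[of z]
    by (intro schoenberg_curve_section) (auto simp: open_square_def)
  have sec01: "0 \<le> sec z" "sec z \<le> 1" for z
    unfolding sec_def schoenberg_section_def by (intro cantor_point_sums binary_digit_01)+
  define P where "P k = distr (density (\<mu> k) (\<lambda>z. ennreal (\<rho> z / w k))) borel sec" for k
  have dens: "(\<integral>\<^sup>+z. ennreal (\<rho> z / w k) \<partial>\<mu> k) = 1" for k
  proof -
    have "(\<integral>\<^sup>+z. ennreal (\<rho> z / w k) \<partial>\<mu> k) = (\<integral>\<^sup>+z. ennreal (1 / w k) * ennreal (\<rho> z) \<partial>\<mu> k)"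
      using wpos[of k] less_imp_le[OF \<rho>(2)] by (intro nn_integral_cong) (simp add: ennreal_mult[symmetric])
    also have "\<dots> = ennreal (1 / w k) * ennreal (w k)" by (subst nn_integral_cmult) (auto simp: wen)
    also have "\<dots> = 1" using wpos[of k] by (simp add: ennreal_mult[symmetric])
    finally show ?thesis .
  qed
  have rd: "real_distribution (P k)" for k
  proof -
    have "prob_space (density (\<mu> k) (\<lambda>z. ennreal (\<rho> z / w k)))"
      by (rule prob_spaceI) (use dens in \<open>simp add: emeasure_density cong: nn_integral_cong\<close>)
    then interpret prob_space "P k" unfolding P_def by (rule prob_space.prob_space_distr) simp
    show ?thesis by unfold_locales (simp_all add: P_def)
  qed
  have "tight P"
    unfolding tight_def
  proof (intro conjI allI impI rd)
    fix \<epsilon> :: real assume "\<epsilon> > 0"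
    have "measure (P k) {-1<..2} = 1" for k
    proof -
      interpret real_distribution "P k" by (rule rd)
      let ?D = "density (\<mu> k) (\<lambda>z. ennreal (\<rho> z / w k))"
      have "- 1 < sec z" "sec z \<le> 2" for z using sec01[of z] by linarith+
      then have "sec -` {-1<..2} = UNIV" by auto
      moreover have "measure (P k) A = measure ?D (sec -` A \<inter> space ?D)" if "A \<in> sets borel" for A
        unfolding P_def using that by (intro measure_distr) simp_all
      from this[of "{-1<..2}"] this[of UNIV]
      have "measure (P k) {-1<..2} = measure ?D (sec -` {-1<..2} \<inter> space ?D)"
        "measure (P k) UNIV = measure ?D (space ?D)" by simp_all
      ultimately show ?thesis using prob_space by simp
    qed
    then show "\<exists>a b::real. a < b \<and> (\<forall>n. 1 - \<epsilon> < measure (P n) {a<..b})"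
      using \<open>\<epsilon> > 0\<close> by (intro exI[of _ "-1"] exI[of _ 2]) auto
  qed
  have "seq_compact {a * c .. 1}" by (simp add: compact_imp_seq_compact)
  then obtain wl r1 where r1: "wl \<in> {a * c .. 1}" "strict_mono r1" "(w \<circ> r1) \<longlonglongrightarrow> wl"
    using w0 w1 by (elim seq_compactE[of _ w]) auto
  obtain r2 Q where r2: "strict_mono r2" "real_distribution Q" "weak_conv_m (P \<circ> r1 \<circ> r2) Q"
    using tight_imp_convergent_subsubsequence[OF \<open>tight P\<close> r1(2)] by blast
  define r where "r = r1 \<circ> r2"
  have wr: "(\<lambda>k. w (r k)) \<longlonglongrightarrow> wl"
    using LIMSEQ_subseq_LIMSEQ[OF r1(3) r2(1)] by (simp add: r_def o_def)
  have wl0: "0 \<le> wl" using r1(1) a(1) low(1) by (auto intro: order_trans[of 0 "a * c"])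
  interpret Q: real_distribution Q by (rule r2)
  have [measurable_cong]: "sets Q = sets borel" by simp
  define \<pi> where "\<pi> t = square_to_plane (schoenberg_curve t)" for t
  have [measurable]: "\<pi> \<in> borel_measurable borel" unfolding \<pi>_def by measurable
  \<comment> \<open>Mass that escapes to infinity in the plane ends up on the boundary of the
    square. \<open>B\<close> discards it; compactly supported test functions vanish there and do not
    notice the loss.\<close>
  define B where "B = schoenberg_curve -` open_square"
  have [measurable]: "B \<in> sets borel"
    unfolding B_def using measurable_sets[OF borel_measurable_plane_square(3,4)] by simp
  define N where "N = distr (density Q (indicator B)) borel \<pi>"
  \<comment> \<open>This density undoes the weight \<open>\<rho>\<close> and the division by the
    total mass, whose limit is \<open>wl\<close>.\<close>
  define M where "M = density N (\<lambda>z. ennreal (wl / \<rho> z))"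
  have [measurable_cong]: "sets N = sets borel" "sets M = sets borel" by (simp_all add: N_def M_def)
  have N1: "emeasure N A \<le> 1" for A
  proof -
    have "emeasure N A \<le> emeasure N (space N)" by (rule emeasure_space)
    also have "\<dots> = (\<integral>\<^sup>+t. indicator B t \<partial>Q)"
      unfolding N_def by (simp add: emeasure_distr emeasure_density cong: nn_integral_cong)
    also have "\<dots> = emeasure Q B" by simp
    also have "\<dots> \<le> 1" by (rule Q.emeasure_le_1)
    finally show ?thesis .
  qed
  show thesis
  proof
    show "strict_mono r" unfolding r_def using r1(2) r2(1) by (rule strict_mono_o)
    show "sets M = sets borel" by (simp add: M_def N_def)
    show "emeasure M (cball 0 R) < \<infinity>" for R
    proof -
      obtain a' where a': "0 < a'" "\<And>z. z \<in> cball 0 R \<Longrightarrow> a' \<le> \<rho> z" using lower by blast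
      have "emeasure M (cball 0 R) = (\<integral>\<^sup>+z. ennreal (wl / \<rho> z) * indicator (cball 0 R) z \<partial>N)"
        unfolding M_def by (rule emeasure_density) auto
      also have "\<dots> \<le> (\<integral>\<^sup>+z. ennreal (wl / a') \<partial>N)"
        using a' wl0 by (intro nn_integral_mono) (auto simp: indicator_def intro!: ennreal_leI divide_left_mono mult_pos_pos \<rho>(2))
      also have "\<dots> = ennreal (wl / a') * emeasure N (space N)" by simp
      also have "\<dots> \<le> ennreal (wl / a') * 1" by (intro mult_left_mono N1) auto
      finally show ?thesis by (simp add: le_less_trans)
    qed
    show "(\<lambda>k. \<integral>z. f z \<partial>\<mu> (r k)) \<longlonglongrightarrow> (\<integral>z. f z \<partial>M)"
      if f: "continuous_on UNIV f" "\<And>z. f z \<noteq> 0 \<Longrightarrow> z \<in> cball 0 R" for R and f :: "complex \<Rightarrow> real"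
    proof -
      have [measurable]: "f \<in> borel_measurable borel" using f(1) by (rule borel_measurable_continuous_onI)
      define g where "g z = f z / \<rho> z" for z
      have g: "continuous_on UNIV g" "\<And>z. g z \<noteq> 0 \<Longrightarrow> z \<in> cball 0 R"
        unfolding g_def using f \<rho> by (auto intro!: continuous_intros simp: less_imp_neq[symmetric])
      have [measurable]: "g \<in> borel_measurable borel" using g(1) by (rule borel_measurable_continuous_onI)
      define F where "F z = (if z \<in> open_square then g (square_to_plane z) else 0)" for z
      have F: "continuous_on UNIV F" "\<exists>B. \<forall>z. \<bar>F z\<bar> \<le> B"
        unfolding F_def using continuous_on_square_extension[OF g] by auto
      \<comment> \<open>Read along the curve, the quotient of f by \<open>\<rho>\<close> is a
        bounded continuous function on the line, so weak convergence applies to it.\<close>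
      define G where "G t = F (schoenberg_curve t)" for t
      have Gc: "continuous_on UNIV G" unfolding G_def
        by (rule continuous_on_compose2[OF F(1) continuous_on_schoenberg_curve]) auto
      have [measurable]: "G \<in> borel_measurable borel" using Gc by (rule borel_measurable_continuous_onI)
      from F(2) obtain BB where BB: "\<And>t. norm (G t) \<le> BB" by (auto simp: G_def)
      have lim: "(\<lambda>k. integral\<^sup>L ((P \<circ> r1 \<circ> r2) k) G) \<longlonglongrightarrow> integral\<^sup>L Q G"
        by (rule weak_conv_imp_integral_bdd_continuous_conv[OF _ r2(2,3), of G BB])
          (use rd Gc BB in \<open>auto simp: continuous_on_eq_continuous_at\<close>)
      have Pint: "w k * integral\<^sup>L (P k) G = (\<integral>z. f z \<partial>\<mu> k)" for k
      proof -
        have "integral\<^sup>L (P k) G = (\<integral>z. G (sec z) \<partial>(density (\<mu> k) (\<lambda>z. ennreal (\<rho> z / w k))))"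
          unfolding P_def by (rule integral_distr) auto
        also have "\<dots> = (\<integral>z. (\<rho> z / w k) *\<^sub>R G (sec z) \<partial>\<mu> k)"
          using wpos[of k] \<rho>(2) by (intro integral_density) (auto simp: less_imp_le)
        also have "(\<lambda>z. (\<rho> z / w k) *\<^sub>R G (sec z)) = (\<lambda>z. f z / w k)"
          using \<rho>(2) plane_to_square_in
          by (auto simp: G_def curve_sec F_def square_to_plane_inverse g_def less_imp_neq[symmetric])
        finally show ?thesis using wpos[of k] by simp
      qed
      have Mint: "(\<integral>z. f z \<partial>M) = wl * integral\<^sup>L Q G"
      proof -
        have "(\<integral>z. f z \<partial>M) = (\<integral>z. (wl / \<rho> z) *\<^sub>R f z \<partial>N)"
          unfolding M_def using wl0 \<rho>(2) by (intro integral_density) (auto simp: less_imp_le)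
        also have "\<dots> = (\<integral>t. (wl / \<rho> (\<pi> t)) *\<^sub>R f (\<pi> t) \<partial>(density Q (indicator B)))"
          unfolding N_def by (rule integral_distr) auto
        also have "\<dots> = (\<integral>t. (wl / \<rho> (\<pi> t)) *\<^sub>R f (\<pi> t) \<partial>(density Q (\<lambda>t. ennreal (indicator B t))))"
          by (simp add: ennreal_indicator)
        also have "\<dots> = (\<integral>t. indicator B t *\<^sub>R ((wl / \<rho> (\<pi> t)) *\<^sub>R f (\<pi> t)) \<partial>Q)"
          by (rule integral_density) auto
        also have "\<dots> = (\<integral>t. wl * G t \<partial>Q)"
          by (intro Bochner_Integration.integral_cong)
            (auto simp: indicator_def B_def G_def F_def g_def \<pi>_def)
        finally show ?thesis by simp
      qed
      have "(\<lambda>k. w (r k) * integral\<^sup>L ((P \<circ> r1 \<circ> r2) k) G) \<longlonglongrightarrow> wl * integral\<^sup>L Q G"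
        by (intro tendsto_mult wr lim)
      moreover have "w (r k) * integral\<^sup>L ((P \<circ> r1 \<circ> r2) k) G = (\<integral>z. f z \<partial>\<mu> (r k))" for k
        using Pint[of "r k"] by (simp add: r_def)
      ultimately show ?thesis by (simp add: Mint)
    qed
  qed
qed

section \<open>Locally finite Borel measures\<close>

lemma borel_eq_sigma_compact:
  "sets (borel :: 'a::euclidean_space measure) = sigma_sets UNIV (Collect compact)"
proof -
  have "closed F \<Longrightarrow> F \<in> sigma_sets UNIV (Collect compact)" for F :: "'a set"
  proof -
    assume F: "closed F"
    have "F = (\<Union>n::nat. F \<inter> cball 0 (real n))" using real_arch_simple by auto
    moreover have "F \<inter> cball 0 (real n) \<in> sigma_sets UNIV (Collect compact)" for n
      using F by (intro sigma_sets.Basic) (auto intro: closed_Int_compact)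
    ultimately show "F \<in> sigma_sets UNIV (Collect compact)" by (metis sigma_sets.Union)
  qed
  then have "sigma_sets UNIV (Collect closed) \<subseteq> sigma_sets UNIV (Collect (compact :: 'a set \<Rightarrow> bool))"
    by (intro sigma_sets_mono) auto
  moreover have "sigma_sets UNIV (Collect compact) \<subseteq> sets (borel :: 'a measure)"
    by (metis borel_compact mem_Collect_eq sets.sigma_sets_subset space_borel subsetI)
  ultimately show ?thesis by (auto simp: borel_eq_closed)
qed

text \<open>Continuous functions that decrease to the indicator of a compact set determine its
  measure by dominated convergence. Compact sets are stable under intersection and generate the
  Borel sets.\<close>

lemma borel_measure_eqI_integral:
  fixes M N :: "'a::euclidean_space measure"
  assumes sets: "sets M = sets borel" "sets N = sets borel"
    and fin: "\<And>R. emeasure M (cball 0 R) < \<infinity>" "\<And>R. emeasure N (cball 0 R) < \<infinity>"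
    and eq: "\<And>f R. continuous_on UNIV f \<Longrightarrow> (\<And>z. 0 \<le> f z) \<Longrightarrow> (\<And>z. f z \<noteq> 0 \<Longrightarrow> z \<in> cball 0 R) \<Longrightarrow>
      (\<integral>z. f z \<partial>M) = (\<integral>z. (f z :: real) \<partial>N)"
  shows "M = N"
proof -
  let ?g = "\<lambda>K n z. max 0 (1 - real n * infdist z K)"
  have lim: "(\<lambda>n. \<integral>z. ?g K n z \<partial>L) \<longlonglongrightarrow> measure L K"
    if L: "sets L = sets borel" "\<And>R. emeasure L (cball 0 R) < \<infinity>"
    and K: "compact K" "K \<noteq> {}" and B: "\<And>z n. 1 - real n * infdist z K > 0 \<Longrightarrow> n \<ge> 1 \<Longrightarrow> z \<in> cball 0 B"
    for L and K :: "'a set" and B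
  proof -
    have Kb: "K \<in> sets L" using K L by (simp add: borel_compact)
    have [measurable_cong]: "sets L = sets borel" by (rule L)
    have m: "(\<lambda>z. ?g K n z) \<in> borel_measurable borel" for n
      by (intro borel_measurable_continuous_onI continuous_intros)
    \<comment> \<open>The index is shifted because the function for n = 0 is constantly 1 and is not
      dominated by the indicator of a ball.\<close>
    have "(\<lambda>n. \<integral>z. ?g K (Suc n) z \<partial>L) \<longlonglongrightarrow> (\<integral>z. indicator K z \<partial>L)"
    proof (rule integral_dominated_convergence[where w = "indicator (cball 0 B)"])
      show "integrable L (indicator (cball 0 B) :: 'a \<Rightarrow> real)" using L by (simp add: integrable_indicator_iff)
      show "(indicator K :: 'a \<Rightarrow> real) \<in> borel_measurable L" using Kb by simp
      show "(\<lambda>z. ?g K (Suc n) z) \<in> borel_measurable L" for n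
        using m[of "Suc n"] measurable_cong_sets[OF L(1) refl] by blast
      show "AE z in L. norm (?g K (Suc n) z) \<le> indicator (cball 0 B) z" for n
      proof (intro AE_I2)
        fix z
        have "0 \<le> real (Suc n) * infdist z K" by (simp add: infdist_nonneg)
        then show "norm (?g K (Suc n) z) \<le> indicator (cball 0 B) z"
          using B[of "Suc n" z]
          by (cases "real (Suc n) * infdist z K < 1") (auto simp: indicator_def simp del: of_nat_Suc)
      qed
      show "AE z in L. (\<lambda>n. ?g K (Suc n) z) \<longlonglongrightarrow> indicator K z"
      proof (intro AE_I2)
        fix z
        show "(\<lambda>n. ?g K (Suc n) z) \<longlonglongrightarrow> indicator K z"
        proof (cases "z \<in> K")
          case False
          have i: "0 < infdist z K"
            using in_closed_iff_infdist_zero[of K z] K False compact_imp_closed infdist_nonneg[of z K]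
            by (metis less_eq_real_def)
          have "\<forall>\<^sub>F n in sequentially. ?g K (Suc n) z = 0"
          proof -
            obtain n0 where n0: "1 / infdist z K \<le> real n0" using real_arch_simple by blast
            have "?g K (Suc n) z = 0" if "n0 \<le> n" for n
            proof -
              have "1 / infdist z K \<le> real (Suc n)" using n0 that by linarith
              then show ?thesis using i by (simp add: divide_le_eq)
            qed
            then show ?thesis by (auto simp: eventually_sequentially)
          qed
          then show ?thesis using False by (simp add: tendsto_eventually)
        qed simp
      qed
    qed
    then have "(\<lambda>n. \<integral>z. ?g K (Suc n) z \<partial>L) \<longlonglongrightarrow> measure L K"
      using Kb by (simp add: sets.sets_into_space Int_absorb2)
    then show ?thesis by (rule LIMSEQ_imp_Suc)
  qed
  have meas: "emeasure M K = emeasure N K" if K: "compact K" for K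
  proof (cases "K = {}")
    case False
    obtain B where B: "\<And>x. x \<in> K \<Longrightarrow> norm x \<le> B" using compact_imp_bounded[OF K] bounded_iff by metis
    have supp: "z \<in> cball 0 (B + 1)" if "1 - real n * infdist z K > 0" "n \<ge> 1" for z n
    proof -
      obtain x where x: "x \<in> K" "infdist z K = dist z x"
        using infdist_attains_inf[OF compact_imp_closed[OF K] False] by blast
      have "1 * dist z x \<le> real n * dist z x" using that(2) by (intro mult_right_mono) auto
      then have "dist z x < 1" using that(1) x(2) by simp
      then show ?thesis using B[OF x(1)] norm_triangle_ineq[of x "z - x"] by (simp add: dist_norm)
    qed
    have "(\<integral>z. ?g K (Suc n) z \<partial>M) = (\<integral>z. ?g K (Suc n) z \<partial>N)" for n
    proof (rule eq)
      show "continuous_on UNIV (\<lambda>z. ?g K (Suc n) z)" by (intro continuous_intros)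
      show "0 \<le> ?g K (Suc n) z" for z by simp
      show "z \<in> cball 0 (B + 1)" if "?g K (Suc n) z \<noteq> 0" for z
        by (rule supp[of "Suc n"]) (use that in \<open>simp_all add: max_def split: if_splits\<close>)
    qed
    then have eqn: "(\<lambda>n. \<integral>z. ?g K (Suc n) z \<partial>M) = (\<lambda>n. \<integral>z. ?g K (Suc n) z \<partial>N)"
      by (rule ext)
    have limM: "(\<lambda>n. \<integral>z. ?g K n z \<partial>M) \<longlonglongrightarrow> measure M K"
      by (rule lim[OF sets(1) fin(1) K False]) (rule supp)
    have limN: "(\<lambda>n. \<integral>z. ?g K n z \<partial>N) \<longlonglongrightarrow> measure N K"
      by (rule lim[OF sets(2) fin(2) K False]) (rule supp)
    have "measure M K = measure N K"
      by (rule LIMSEQ_unique[OF LIMSEQ_Suc[OF limM, unfolded eqn] LIMSEQ_Suc[OF limN]])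
    moreover have "K \<subseteq> cball 0 B" using B by auto
    then have "emeasure M K \<le> emeasure M (cball 0 B)" "emeasure N K \<le> emeasure N (cball 0 B)"
      by (intro emeasure_mono; simp add: sets)+
    then have "emeasure M K < \<infinity>" "emeasure N K < \<infinity>"
      using fin[of B] by (meson le_less_trans)+
    ultimately show ?thesis by (simp add: emeasure_eq_ennreal_measure less_top[symmetric])
  qed simp
  show ?thesis
  proof (rule measure_eqI_generator_eq[where E = "Collect compact" and A = "\<lambda>n::nat. cball 0 (real n)" and \<Omega> = UNIV])
    show "Int_stable (Collect (compact :: 'a set \<Rightarrow> bool))" by (auto simp: Int_stable_def)
    show "(\<Union>n. cball 0 (real n)) = (UNIV :: 'a set)" using real_arch_simple by auto
    show "emeasure M (cball 0 (real n)) \<noteq> \<infinity>" for n using fin(1)[of "real n"] by simp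
  qed (use meas sets borel_eq_sigma_compact in auto)
qed

text \<open>The restriction is a density and not a \<open>restrict_space\<close>, so that it stays a
  measure on all Borel sets, as regularity theorems for finite Borel measures demand.\<close>

lemma finite_measure_restrict:
  fixes M :: "'a::euclidean_space measure"
  assumes "sets M = sets borel" "B \<in> sets borel" "emeasure M B < \<infinity>"
  shows "emeasure (density M (indicator B)) (space (density M (indicator B))) \<noteq> \<infinity>"
    and "\<And>A. A \<in> sets borel \<Longrightarrow> emeasure (density M (indicator B)) A = emeasure M (B \<inter> A)"
proof -
  show *: "emeasure (density M (indicator B)) A = emeasure M (B \<inter> A)" if "A \<in> sets borel" for A
    using assms that by (subst emeasure_density) (auto simp: indicator_inter_arith[symmetric])
  have "space M = UNIV" using assms(1) by (metis sets_eq_imp_space_eq space_borel)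
  then show "emeasure (density M (indicator B)) (space (density M (indicator B))) \<noteq> \<infinity>"
    using *[of UNIV] assms(3) by simp
qed

lemma locally_finite_inner_regular:
  fixes M :: "'a::euclidean_space measure"
  assumes sets: "sets M = sets borel" and fin: "\<And>R. emeasure M (cball 0 R) < \<infinity>" and A: "A \<in> sets borel"
  shows "emeasure M A = (SUP K\<in>{K. compact K \<and> K \<subseteq> A}. emeasure M K)" (is "_ = ?S")
proof (rule antisym)
  show "?S \<le> emeasure M A" 
  proof (rule SUP_least)
    fix K assume "K \<in> {K. compact K \<and> K \<subseteq> A}"
    then show "emeasure M K \<le> emeasure M A" using A sets by (intro emeasure_mono) auto
  qed
  have "emeasure M (\<Union>n::nat. A \<inter> cball 0 (real n)) = (SUP n::nat. emeasure M (A \<inter> cball 0 (real n)))"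
  proof (rule SUP_emeasure_incseq[symmetric])
    show "range (\<lambda>n. A \<inter> cball 0 (real n)) \<subseteq> sets M" unfolding sets using A by (intro image_subsetI sets.Int) simp_all
    show "incseq (\<lambda>n. A \<inter> cball 0 (real n))" by (intro incseq_SucI Int_mono subset_cball) simp_all
  qed
  moreover have "(\<Union>n::nat. A \<inter> cball 0 (real n)) = A" using real_arch_simple by auto
  moreover have "emeasure M (A \<inter> cball 0 (real n)) \<le> ?S" for n
  proof -
    let ?B = "cball (0::'a) (real n)"
    let ?L = "density M (indicator ?B)"
    note r = finite_measure_restrict[OF sets _ fin[of "real n"]]
    have AB: "A \<inter> ?B \<in> sets borel" using A by simp
    have "emeasure M (A \<inter> ?B) = emeasure ?L (A \<inter> ?B)"
      using r(2)[OF _ AB] by (simp add: Int_ac)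
    also have "\<dots> = (SUP K \<in> {K. K \<subseteq> A \<inter> ?B \<and> compact K}. emeasure ?L K)"
      by (rule inner_regular) (use r(1) in \<open>simp_all add: sets AB\<close>)
    also have "\<dots> \<le> ?S"
    proof (intro SUP_least)
      fix K assume K: "K \<in> {K. K \<subseteq> A \<inter> ?B \<and> compact K}"
      then have "emeasure ?L K = emeasure M (?B \<inter> K)" using r(2) by (simp add: borel_compact)
      also have "?B \<inter> K = K" using K by auto
      also have "emeasure M K \<le> ?S" using K by (intro SUP_upper) auto
      finally show "emeasure ?L K \<le> ?S" .
    qed
    finally show ?thesis .
  qed
  ultimately show "emeasure M A \<le> ?S" by (simp add: SUP_least)
qed

text \<open>In the open ball of radius n the set is enclosed in an open set with excess at most e /
  2^(n+1); the excesses add up to e. Open balls are used because cutting a neighbourhood down to the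
  ball has to leave it open.\<close>

lemma locally_finite_outer_regular:
  fixes M :: "'a::euclidean_space measure"
  assumes sets: "sets M = sets borel" and fin: "\<And>R. emeasure M (cball 0 R) < \<infinity>" and A: "A \<in> sets borel"
  shows "emeasure M A = (INF U\<in>{U. open U \<and> A \<subseteq> U}. emeasure M U)" (is "_ = ?I")
proof (rule antisym)
  show "emeasure M A \<le> ?I" 
  proof (rule INF_greatest)
    fix U assume "U \<in> {U. open U \<and> A \<subseteq> U}"
    then show "emeasure M A \<le> emeasure M U" using sets by (intro emeasure_mono) auto
  qed
  show "?I \<le> emeasure M A"
  proof (rule ennreal_le_epsilon)
    fix e :: real assume e: "0 < e"
    have "\<exists>U. open U \<and> A \<inter> ball 0 (real n) \<subseteq> U \<and> emeasure M (U - A) \<le> ennreal (e * (1/2) ^ Suc n)" for n :: nat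
    proof -
      let ?B = "ball (0::'a) (real n)"
      let ?L = "density M (indicator ?B)"
      have "emeasure M ?B \<le> emeasure M (cball 0 (real n))"
        by (intro emeasure_mono ball_subset_cball) (simp add: sets)
      then have fB: "emeasure M ?B < \<infinity>" using fin[of "real n"] by (rule le_less_trans)
      note r = finite_measure_restrict[OF sets _ fB]
      have AB: "A \<inter> ?B \<in> sets borel" using A by simp
      have LA: "emeasure ?L (A \<inter> ?B) = emeasure M (A \<inter> ?B)" using r(2)[OF _ AB] by (simp add: Int_ac)
      have "emeasure M (A \<inter> ?B) \<le> emeasure M ?B"
        by (intro emeasure_mono Int_lower2) (simp add: sets)
      then have fA: "emeasure M (A \<inter> ?B) < \<infinity>" using fB by (rule le_less_trans)
      have "(INF U \<in> {U. A \<inter> ?B \<subseteq> U \<and> open U}. emeasure ?L U) = emeasure ?L (A \<inter> ?B)"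
        by (rule outer_regular[symmetric]) (use r(1) in \<open>simp_all add: sets AB\<close>)
      also have "\<dots> < emeasure ?L (A \<inter> ?B) + ennreal (e * (1/2) ^ Suc n)"
        using e fA LA ennreal_add_left_cancel_less[of "emeasure ?L (A \<inter> ?B)" 0] by simp
      finally obtain U where U: "A \<inter> ?B \<subseteq> U" "open U"
        "emeasure ?L U < emeasure ?L (A \<inter> ?B) + ennreal (e * (1/2) ^ Suc n)"
        by (auto simp: INF_less_iff)
      have Ub: "U \<in> sets borel" using U(2) by simp
      have "emeasure M (U \<inter> ?B) \<le> emeasure M (A \<inter> ?B) + ennreal (e * (1/2) ^ Suc n)"
        using U(3) r(2)[OF _ Ub] LA by (simp add: Int_ac)
      moreover have "emeasure M (U \<inter> ?B - A \<inter> ?B) = emeasure M (U \<inter> ?B) - emeasure M (A \<inter> ?B)"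
        by (rule emeasure_Diff) (use fA sets Ub AB U(1) in auto)
      ultimately have "emeasure M (U \<inter> ?B - A \<inter> ?B) \<le> ennreal (e * (1/2) ^ Suc n)"
        using fA by (auto simp: ennreal_minus_le_iff add.commute)
      moreover have "U \<inter> ?B - A \<inter> ?B = U \<inter> ?B - A" by auto
      ultimately show ?thesis using U by (intro exI[of _ "U \<inter> ?B"]) auto
    qed
    then obtain U where U: "\<And>n::nat. open (U n)" "\<And>n. A \<inter> ball 0 (real n) \<subseteq> U n"
      "\<And>n. emeasure M (U n - A) \<le> ennreal (e * (1/2) ^ Suc n)" by metis
    have "A = (\<Union>n::nat. A \<inter> ball 0 (real n))" using reals_Archimedean2 by auto
    then have AU: "A \<subseteq> (\<Union>n. U n)" using U(2) by (metis UN_mono subset_UNIV)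
    have Um: "U n - A \<in> sets M" for n using U(1)[of n] A sets by simp
    have half: "(\<lambda>n. e * (1/2) ^ Suc n) sums (e * 1)" by (intro sums_mult power_half_series)
    have "?I \<le> emeasure M (\<Union>n. U n)" using AU U(1) by (intro INF_lower) auto
    also have "\<dots> = emeasure M (A \<union> (\<Union>n. U n - A))" using AU by (intro arg_cong[where f = "emeasure M"]) auto
    also have "\<dots> \<le> emeasure M A + emeasure M (\<Union>n. U n - A)"
      by (rule emeasure_subadditive) (use A sets Um in \<open>simp, intro sets.countable_UN, blast\<close>)
    also have "emeasure M (\<Union>n. U n - A) \<le> (\<Sum>n. emeasure M (U n - A))"
      by (rule emeasure_subadditive_countably) (use Um in auto)
    also have "(\<Sum>n. emeasure M (U n - A)) \<le> (\<Sum>n. ennreal (e * (1/2) ^ Suc n))"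
      by (intro suminf_le U) auto
    also have "\<dots> = ennreal e"
      using half e by (subst suminf_ennreal2) (auto simp: sums_iff)
    finally show "?I \<le> emeasure M A + ennreal e" by (simp add: add_left_mono)
  qed
qed

lemma regular_borel_measure_on_restrict_space:
  assumes sets: "sets M = sets borel" and fin: "\<And>R. emeasure M (cball 0 R) < \<infinity>" and X: "X \<in> sets borel"
  shows "regular_borel_measure_on X (restrict_space M X)"
proof -
  have spM: "space M = UNIV" using sets by (metis sets_eq_imp_space_eq space_borel)
  have XM: "X \<in> sets M" using X sets by simp
  have em: "emeasure (restrict_space M X) A = emeasure M A" if "A \<subseteq> X" for A
    using that XM spM by (intro emeasure_restrict_space) (auto simp: sets)
  show ?thesis
  unfolding regular_borel_measure_on_def
  proof (intro conjI ballI allI impI)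
  show "sets (restrict_space M X) = sets (restrict_space borel X)"
    using sets by (rule sets_restrict_space_cong)
  fix K assume K: "compact K \<and> K \<subseteq> X"
  then have "bounded K" by (simp add: compact_imp_bounded)
  then obtain B where "\<forall>x\<in>K. norm x \<le> B" unfolding bounded_iff by blast
  then have "K \<subseteq> cball 0 B" by auto
  then have "emeasure M K \<le> emeasure M (cball 0 B)" by (intro emeasure_mono) (simp_all add: sets)
  then show "emeasure (restrict_space M X) K < \<infinity>"
    using K fin[of B] by (simp add: em le_less_trans)
next
  fix A assume "A \<in> sets (restrict_space M X)"
  then have A: "A \<subseteq> X" "A \<in> sets borel"
    using X sets by (auto simp: sets_restrict_space)
  show "emeasure (restrict_space M X) A =
      (INF U\<in>{U. openin (top_of_set X) U \<and> A \<subseteq> U}. emeasure (restrict_space M X) U)" (is "_ = ?I")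
  proof (rule antisym)
    show "emeasure (restrict_space M X) A \<le> ?I"
    proof (rule INF_greatest)
      fix U assume U: "U \<in> {U. openin (top_of_set X) U \<and> A \<subseteq> U}"
      then obtain V where "open V" "U = X \<inter> V" by (auto simp: openin_open)
      then show "emeasure (restrict_space M X) A \<le> emeasure (restrict_space M X) U"
        using U X sets by (intro emeasure_mono) (auto simp: sets_restrict_space)
    qed
    have "?I \<le> emeasure M V" if "open V" "A \<subseteq> V" for V
    proof -
      have "?I \<le> emeasure (restrict_space M X) (X \<inter> V)"
        using that A by (intro INF_lower) (auto intro: openin_open_Int)
      also have "\<dots> \<le> emeasure M V" using that by (subst em) (auto simp: sets intro!: emeasure_mono[OF Int_lower2])
      finally show ?thesis .
    qed
    then have "?I \<le> (INF V\<in>{V. open V \<and> A \<subseteq> V}. emeasure M V)" by (intro INF_greatest) auto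
    then show "?I \<le> emeasure (restrict_space M X) A"
      using locally_finite_outer_regular[OF sets fin A(2)] em[OF A(1)] by simp
  qed
  have "(SUP K\<in>{K. compact K \<and> K \<subseteq> A}. emeasure (restrict_space M X) K)
      = (SUP K\<in>{K. compact K \<and> K \<subseteq> A}. emeasure M K)"
    using A(1) by (intro SUP_cong) (auto intro!: em)
  then show "emeasure (restrict_space M X) A = (SUP K\<in>{K. compact K \<and> K \<subseteq> A}. emeasure (restrict_space M X) K)"
    using locally_finite_inner_regular[OF sets fin A(2)] em[OF A(1)] by simp
qed
qed

section \<open>The Julia set\<close>

text \<open>At 1 the function l e^x - x is negative because l < 1/e, and it tends to infinity. A
  fixed point of E is its own multiplier, since E' = E; so q > 1 says that q is repelling.\<close>

lemma exists_repelling_fixed_point: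
  fixes l :: real
  assumes "0 < l" "l < exp (- 1)"
  obtains q where "1 < q" "l * exp q = q"
proof -
  have "filterlim (\<lambda>x. l * exp x - x) at_top at_top" using assms(1) by real_asymp
  then have "eventually (\<lambda>x. 0 \<le> l * exp x - x) at_top" unfolding filterlim_at_top by blast
  then obtain b where b: "1 \<le> b" "0 \<le> l * exp b - b"
    using eventually_conj[OF eventually_ge_at_top[of 1]] by (metis (lifting) eventually_happens' trivial_limit_at_top_linorder)
  have one: "l * exp 1 - 1 < 0" using assms(2) by (simp add: exp_minus field_simps)
  have "\<exists>x\<ge>1. x \<le> b \<and> l * exp x - x = 0"
    by (rule IVT) (use one b in \<open>auto intro!: continuous_intros\<close>)
  then obtain q where "1 \<le> q" "l * exp q - q = 0" by blast
  moreover from this one have "q \<noteq> 1" by auto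
  ultimately show thesis using that[of q] by simp
qed

locale exp_dynamics =
  fixes l q :: real
  assumes l_pos: "0 < l" and q_gt_1: "1 < q" and fixed_point: "l * exp q = q"
begin

abbreviation "E \<equiv> exp_map l"

definition halfplane :: "complex set" where "halfplane = {z. q \<le> Re z}"

lemma halfplaneD: "z \<in> halfplane \<Longrightarrow> q \<le> Re z" "z \<in> halfplane \<Longrightarrow> q \<le> cmod z"
  using complex_Re_le_cmod[of z] by (auto simp: halfplane_def)

lemma q_halfplane: "of_real q \<in> halfplane" by (simp add: halfplane_def)

lemma convex_halfplane: "convex halfplane" unfolding halfplane_def
  using convex_halfspace_Re_ge by blast

lemma closed_halfplane: "closed halfplane" unfolding halfplane_def
  using closed_halfspace_Re_ge by blast

lemma norm_E: "cmod (E z) = l * exp (Re z)"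
  using l_pos by (simp add: exp_map_def norm_mult)

lemma norm_E_less: "Re z < q \<Longrightarrow> cmod (E z) < q"
  using l_pos fixed_point by (metis norm_E exp_less_mono mult_strict_left_mono)

text \<open>E maps the half-plane left of q into the disc of radius q, which lies in the same
  half-plane. So an orbit that leaves \<open>halfplane\<close> never returns, and it stays
  bounded.\<close>

lemma iterate_less:
  assumes "Re ((E ^^ n) z) < q" "n < m" shows "cmod ((E ^^ m) z) < q"
  using assms(2)
proof (induction m)
  case (Suc m)
  have "Re ((E ^^ m) z) < q"
  proof (cases "m = n")
    case False
    with Suc show ?thesis using complex_Re_le_cmod[of "(E ^^ m) z"] by simp
  qed (use assms in simp)
  then show ?case using norm_E_less by simp
qed simp

lemma has_field_derivative_iterate:
  "((E ^^ n) has_field_derivative (\<Prod>i<n. (E ^^ Suc i) z)) (at z)"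
proof (induction n)
  case (Suc n)
  have "(E has_field_derivative E w) (at w)" for w
    unfolding exp_map_def by (auto intro!: derivative_eq_intros)
  from DERIV_chain[OF this Suc] show ?case by (simp add: mult.commute o_def)
qed (simp add: id_def)

lemma holomorphic_on_iterate: "(E ^^ n) holomorphic_on S"
  unfolding holomorphic_on_def field_differentiable_def
  using has_field_derivative_iterate has_field_derivative_at_within by blast

lemma continuous_on_iterate: "continuous_on S (E ^^ n)"
  using holomorphic_on_iterate by (rule holomorphic_on_imp_continuous_on)

section \<open>Points whose orbit stays in the half-plane, and their identification with the Julia
  set\<close>

definition J0 :: "complex set" where
  "J0 = {z. \<forall>n. (E ^^ n) z \<in> halfplane}"

lemma J0_halfplane: "z \<in> J0 \<Longrightarrow> z \<in> halfplane"
  unfolding J0_def by (metis (mono_tags) funpow_0 mem_Collect_eq)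

lemma J0_E: "z \<in> J0 \<Longrightarrow> E z \<in> J0"
  unfolding J0_def by (simp add: funpow_swap1[symmetric]) (metis funpow.simps(2) o_apply)

lemma J0_iterate: "z \<in> J0 \<Longrightarrow> (E ^^ n) z \<in> J0"
  by (induction n) (auto intro: J0_E)

lemma J0_backward: "z \<in> halfplane \<Longrightarrow> E z \<in> J0 \<Longrightarrow> z \<in> J0"
  unfolding J0_def
proof (intro CollectI allI)
  fix n assume "z \<in> halfplane" "E z \<in> {z. \<forall>n. (E ^^ n) z \<in> halfplane}"
  then show "(E ^^ n) z \<in> halfplane" by (cases n) (auto simp: funpow_swap1)
qed

lemma closed_J0: "closed J0"
proof -
  have "J0 = (\<Inter>n. (E ^^ n) -` halfplane)" by (auto simp: J0_def)
  moreover have "closed ((E ^^ n) -` halfplane)" for n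
    using continuous_on_iterate[of UNIV n] closed_halfplane
    by (intro continuous_closed_vimage) (auto simp: continuous_on_eq_continuous_at)
  ultimately show ?thesis by auto
qed

lemma real_in_J0: "q \<le> x \<Longrightarrow> of_real x \<in> J0"
proof -
  assume x: "q \<le> x"
  have "\<exists>y. (E ^^ n) (of_real x) = of_real y \<and> q \<le> y" for n
  proof (induction n)
    case (Suc n)
    then obtain y where y: "(E ^^ n) (of_real x) = of_real y" "q \<le> y" by blast
    have "l * exp q \<le> l * exp y" using y l_pos by simp
    then have "q \<le> l * exp y" by (simp add: fixed_point)
    moreover have "(E ^^ Suc n) (of_real x) = of_real (l * exp y)"
      using y by (simp add: exp_map_def exp_of_real)
    ultimately show ?case by blast
  qed (use x in auto)
  then have "q \<le> Re ((E ^^ n) (of_real x))" for n by (metis Re_complex_of_real)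
  then show ?thesis by (simp add: J0_def halfplane_def)
qed

lemma norm_deriv_iterate_ge:
  assumes "z \<in> J0" shows "q ^ n \<le> cmod (deriv (E ^^ n) z)"
proof -
  have "q ^ n = (\<Prod>i<n. q)" by simp
  also have "\<dots> \<le> (\<Prod>i<n. cmod ((E ^^ Suc i) z))"
  proof (rule prod_mono)
    fix i
    have "(E ^^ Suc i) z \<in> halfplane" using J0_iterate[OF assms] J0_halfplane by blast
    then show "0 \<le> q \<and> q \<le> cmod ((E ^^ Suc i) z)" using q_gt_1 halfplaneD by simp
  qed
  also have "\<dots> = cmod (deriv (E ^^ n) z)"
    using DERIV_imp_deriv[OF has_field_derivative_iterate] by (simp add: prod_norm del: funpow.simps)
  finally show ?thesis .
qed

text \<open>The radius 4 exceeds pi, so the ball contains a point on the vertical line through its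
  centre where the cosine of the imaginary part is at most 0. The image of that point has real part
  at most 0.\<close>

lemma J0_no_ball: "\<not> ball b 4 \<subseteq> J0"
proof
  assume sub: "ball b 4 \<subseteq> J0"
  define y where "y = (if cos (Im b) \<le> 0 then Im b else Im b + pi)"
  have y: "cos y \<le> 0" "\<bar>y - Im b\<bar> < 4" using pi_less_4 pi_gt_zero by (auto simp: y_def)
  define w where "w = Complex (Re b) y"
  have "w - b = Complex 0 (y - Im b)" by (simp add: w_def complex_eq_iff)
  then have "cmod (w - b) < 4" using y(2) by (simp add: cmod_def)
  then have "dist b w < 4" by (simp add: dist_norm norm_minus_commute)
  then have "E w \<in> J0" using sub J0_E by auto
  then have "q \<le> Re (E w)" using J0_halfplane halfplaneD by blast
  moreover have "Re (E w) = l * (exp (Re b) * cos y)" by (simp add: exp_map_def Re_exp w_def)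
  moreover have "l * (exp (Re b) * cos y) \<le> 0" using l_pos y(1) by (simp add: mult_nonneg_nonpos)
  ultimately show False using q_gt_1 by linarith
qed

text \<open>Expansion rules out both kinds of normality. A finite limit would bound the derivatives
  at z by Cauchy's inequality, although they are at least q^n. Divergence to infinity would put a
  whole disc into \<open>J0\<close>, because orbits that leave the half-plane stay bounded; by
  Bloch's theorem some image of this disc contains a ball of radius 4.\<close>

lemma J0_subset_julia: "J0 \<subseteq> julia_set E"
proof
  fix z assume z: "z \<in> J0"
  show "z \<in> julia_set E"
    unfolding julia_set_def
  proof
    assume "z \<in> fatou_set E"
    then obtain U where U: "open U" "z \<in> U" "normal_family_on U (range (\<lambda>n. E ^^ n))"
      unfolding fatou_set_def by blast
    obtain e where e: "0 < e" "cball z e \<subseteq> U" using U(1,2) open_contains_cball by blast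
    obtain r where r: "strict_mono (r :: nat \<Rightarrow> nat)"
      "(\<exists>g. \<forall>K. compact K \<and> K \<subseteq> U \<longrightarrow> uniform_limit K (\<lambda>n. E ^^ r n) g sequentially) \<or>
        (\<forall>K. compact K \<and> K \<subseteq> U \<longrightarrow> (\<forall>B::real. \<forall>\<^sub>F n in sequentially. \<forall>z\<in>K. B < cmod ((E ^^ r n) z)))"
      using U(3)[unfolded normal_family_on_def, rule_format, of "\<lambda>n. E ^^ n"] by auto
    have rn: "n \<le> r n" for n using r(1) by (rule seq_suble)
    have big: "\<exists>n\<ge>N. C < q ^ r n" for C and N
    proof -
      obtain m where "C < q ^ m" using real_arch_pow[OF q_gt_1] by blast
      also have "q ^ m \<le> q ^ r (max N m)" using q_gt_1 rn[of "max N m"] by (intro power_increasing) auto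
      finally show ?thesis by (intro exI[of _ "max N m"]) simp
    qed
    from r(2) show False
    proof
      assume "\<exists>g. \<forall>K. compact K \<and> K \<subseteq> U \<longrightarrow> uniform_limit K (\<lambda>n. E ^^ r n) g sequentially"
      then obtain g where "uniform_limit (cball z e) (\<lambda>n. E ^^ r n) g sequentially"
        using e(2) compact_cball by meson
      then have "\<forall>\<^sub>F n in sequentially. \<forall>w\<in>cball z e. dist ((E ^^ r n) w) (g w) < 1"
        by (rule uniform_limitD) simp
      then obtain N where N: "\<And>n w. N \<le> n \<Longrightarrow> w \<in> cball z e \<Longrightarrow> dist ((E ^^ r n) w) (g w) < 1"
        unfolding eventually_sequentially by blast
      have "compact ((E ^^ r N) ` cball z e)" by (intro compact_continuous_image continuous_on_iterate compact_cball)
      then have "bounded ((E ^^ r N) ` cball z e)" by (rule compact_imp_bounded)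
      then obtain B where B: "\<And>w. w \<in> cball z e \<Longrightarrow> cmod ((E ^^ r N) w) \<le> B"
        unfolding bounded_iff by blast
      have bd: "q ^ r n \<le> (B + 2) / e" if "N \<le> n" for n
      proof -
        have "norm ((deriv ^^ 1) (E ^^ r n) z) \<le> fact 1 * (B + 2) / e ^ 1"
        proof (rule Cauchy_inequality[OF holomorphic_on_iterate continuous_on_iterate e(1)])
          fix w assume "cmod (z - w) = e"
          then have w: "w \<in> cball z e" by (simp add: dist_norm)
          have "dist ((E ^^ r n) w) ((E ^^ r N) w) < 2"
            using N[OF that w] N[OF order_refl w] dist_triangle2[of "(E ^^ r n) w" "(E ^^ r N) w" "g w"] by linarith
          then show "cmod ((E ^^ r n) w) \<le> B + 2"
            using B[OF w] norm_triangle_sub[of "(E ^^ r n) w" "(E ^^ r N) w"] by (simp add: dist_norm)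
        qed
        then show ?thesis using norm_deriv_iterate_ge[OF z, of "r n"] by simp
      qed
      have "\<exists>n\<ge>N. (B + 2) / e < q ^ r n" by (rule big)
      then show False using bd by (meson not_le)
    next
      assume "\<forall>K. compact K \<and> K \<subseteq> U \<longrightarrow> (\<forall>B::real. \<forall>\<^sub>F n in sequentially. \<forall>z\<in>K. B < cmod ((E ^^ r n) z))"
      then have "\<forall>\<^sub>F n in sequentially. \<forall>z\<in>cball z e. q < cmod ((E ^^ r n) z)" using e(2) by simp
      then obtain N where N: "\<And>n w. N \<le> n \<Longrightarrow> w \<in> cball z e \<Longrightarrow> q < cmod ((E ^^ r n) w)"
        unfolding eventually_sequentially by blast
      have sub: "cball z e \<subseteq> J0"
      proof
        fix w assume w: "w \<in> cball z e"
        show "w \<in> J0"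
        proof (rule ccontr)
          assume "w \<notin> J0"
          then obtain m where "Re ((E ^^ m) w) < q" by (auto simp: J0_def halfplane_def not_le)
          from iterate_less[OF this, of "r (max N (Suc m))"] rn[of "max N (Suc m)"]
          have "cmod ((E ^^ r (max N (Suc m))) w) < q" by simp
          then show False using N[OF _ w, of "max N (Suc m)"] by simp
        qed
      qed
      \<comment> \<open>Bloch's theorem yields a ball of radius e |f'(z)| / 12, and this is at least
        4 when the derivative exceeds 48 / e.\<close>
      obtain n where n: "48 / e < q ^ n" using real_arch_pow[OF q_gt_1] by blast
      have "4 \<le> e * q ^ n / 12" using n e(1) by (simp add: field_simps)
      also have "\<dots> \<le> e * cmod (deriv (E ^^ n) z) / 12"
        using norm_deriv_iterate_ge[OF z, of n] e(1) by (simp add: divide_right_mono)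
      finally obtain b where "ball b 4 \<subseteq> (E ^^ n) ` ball z e"
        using Bloch[OF holomorphic_on_iterate e(1)] by blast
      moreover have "(E ^^ n) ` ball z e \<subseteq> J0" using sub J0_iterate ball_subset_cball by blast
      ultimately show False using J0_no_ball by blast
    qed
  qed
qed

text \<open>A whole neighbourhood leaves the half-plane together with z. From then on all iterates
  are bounded by q there, and the finitely many earlier ones are bounded on compact sets, so
  Montel's theorem gives normality.\<close>

lemma julia_subset_J0: "julia_set E \<subseteq> J0"
proof
  fix z assume z: "z \<in> julia_set E"
  show "z \<in> J0"
  proof (rule ccontr)
    assume "z \<notin> J0"
    then obtain n where n: "Re ((E ^^ n) z) < q" by (auto simp: J0_def halfplane_def not_le)
    have "open ((E ^^ n) -` {z. Re z < q})"
      using continuous_on_iterate[of UNIV n] open_halfspace_Re_lt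
      by (intro continuous_open_vimage) (auto simp: continuous_on_eq_continuous_at)
    then obtain e where e: "0 < e" "ball z e \<subseteq> (E ^^ n) -` {z. Re z < q}"
      using n open_contains_ball by (metis mem_Collect_eq vimageI2)
    have "normal_family_on (ball z e) (range (\<lambda>n. E ^^ n))"
      unfolding normal_family_on_def
    proof (intro allI impI)
      fix s :: "nat \<Rightarrow> complex \<Rightarrow> complex" assume s: "range s \<subseteq> range (\<lambda>n. E ^^ n)"
      obtain g r where gr: "strict_mono (r :: nat \<Rightarrow> nat)"
        "\<And>K. compact K \<Longrightarrow> K \<subseteq> ball z e \<Longrightarrow> uniform_limit K (s \<circ> r) g sequentially"
      proof (rule Montel[OF open_ball, of "range (\<lambda>n. E ^^ n)" z e s])
        show "h holomorphic_on ball z e" if "h \<in> range (\<lambda>n. E ^^ n)" for h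
          using that holomorphic_on_iterate by auto
        show "\<exists>B. \<forall>h\<in>range (\<lambda>n. E ^^ n). \<forall>z\<in>K. cmod (h z) \<le> B" if K: "compact K" "K \<subseteq> ball z e" for K
        proof -
          have "\<exists>B. \<forall>w\<in>K. cmod ((E ^^ m) w) \<le> B" for m
          proof -
            have "bounded ((E ^^ m) ` K)"
              by (intro compact_imp_bounded compact_continuous_image continuous_on_iterate K(1))
            then show ?thesis unfolding bounded_iff by blast
          qed
          then obtain B where B: "\<And>m w. w \<in> K \<Longrightarrow> cmod ((E ^^ m) w) \<le> B m" by metis
          have "cmod ((E ^^ m) w) \<le> Max (B ` {..n}) + q" if w: "w \<in> K" for m w
          proof (cases "m \<le> n")
            case True
            then have "cmod ((E ^^ m) w) \<le> Max (B ` {..n})" using B[OF w, of m]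
              by (meson Max_ge atMost_iff finite_atMost finite_imageI imageI order_trans)
            then show ?thesis using q_gt_1 by simp
          next
            case False
            have "0 \<le> cmod ((E ^^ 0) w)" by (rule norm_ge_zero)
            also have "\<dots> \<le> B 0" by (rule B[OF w])
            also have "\<dots> \<le> Max (B ` {..n})" by (intro Max_ge) auto
            finally have "0 \<le> Max (B ` {..n})" .
            moreover have "Re ((E ^^ n) w) < q" using e(2) K(2) w by auto
            with iterate_less False have "cmod ((E ^^ m) w) < q" by (metis not_le)
            ultimately show ?thesis by simp
          qed
          then show ?thesis by blast
        qed
      qed (use s in auto)
      then show "\<exists>r. strict_mono r \<and>
           ((\<exists>g. \<forall>K. compact K \<and> K \<subseteq> ball z e \<longrightarrow> uniform_limit K (\<lambda>n. s (r n)) g sequentially) \<or>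
            (\<forall>K. compact K \<and> K \<subseteq> ball z e \<longrightarrow>
              (\<forall>B::real. \<forall>\<^sub>F n in sequentially. \<forall>z\<in>K. B < cmod (s (r n) z))))"
        by (intro exI[of _ r] conjI disjI1 exI[of _ g]) (auto simp: o_def)
    qed
    then have "z \<in> fatou_set E"
      unfolding fatou_set_def using e(1) by (intro CollectI exI[of _ "ball z e"]) auto
    then show False using z by (simp add: julia_set_def)
  qed
qed

theorem julia_set_eq: "julia_set E = J0"
  using J0_subset_julia julia_subset_J0 by blast

section \<open>Inverse branches\<close>


definition branch :: "int \<Rightarrow> complex \<Rightarrow> complex" where
  "branch j z = Ln (z / of_real l) + of_real (2 * pi * of_int j) * \<i>"

text \<open>A strip of height pi, the range of imaginary parts that the j-th branch takes on the
  right half-plane. Points in the gaps between the strips are mapped by E to real parts at most 0,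
  so none of them belongs to \<open>J0\<close>.\<close>

definition strip :: "int \<Rightarrow> complex set" where
  "strip j = {z. \<bar>Im z - 2 * pi * of_int j\<bar> < pi / 2}"

lemma open_strip: "open (strip j)"
  unfolding strip_def by (intro open_Collect_less continuous_intros)

lemma exp_two_pi_int: "exp (2 * complex_of_real pi * of_int j * \<i>) = 1"
  using exp_eq_1[of "2 * complex_of_real pi * of_int j * \<i>"] by auto

lemma E_branch: "z \<noteq> 0 \<Longrightarrow> E (branch j z) = z"
  using l_pos by (simp add: exp_map_def branch_def exp_add exp_two_pi_int)

lemma E_branch_halfplane: "z \<in> halfplane \<Longrightarrow> E (branch j z) = z"
  using E_branch halfplaneD(1)[of z] q_gt_1 by (cases "z = 0") auto

lemma branch_in_strip: "0 < Re z \<Longrightarrow> branch j z \<in> strip j"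
  using Re_Ln_pos_lt_imp[of "z / of_real l"] l_pos
  by (simp add: strip_def branch_def)

lemma disjoint_strip: "z \<in> strip i \<Longrightarrow> z \<in> strip j \<Longrightarrow> i = j"
proof -
  assume "z \<in> strip i" "z \<in> strip j"
  then have "\<bar>Im z - 2 * pi * of_int i\<bar> < pi / 2" "\<bar>Im z - 2 * pi * of_int j\<bar> < pi / 2"
    by (simp_all only: strip_def mem_Collect_eq)
  then have "\<bar>2 * pi * of_int i - 2 * pi * of_int j\<bar> < pi" by linarith
  moreover have "2 * pi * of_int i - 2 * pi * of_int j = pi * (2 * (of_int i - of_int j))"
    by (simp add: algebra_simps)
  ultimately have "pi * \<bar>2 * (of_int i - of_int j)\<bar> < pi * 1"
    using pi_gt_zero by (simp only: abs_mult abs_of_pos mult_1_right)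
  then have "\<bar>2 * (of_int i - of_int j) :: real\<bar> < 1" using pi_gt_zero by (simp only: mult_less_cancel_left_pos)
  then have "real_of_int \<bar>2 * (i - j)\<bar> < 1" by simp
  then have "\<bar>2 * (i - j)\<bar> < 1" by (simp only: of_int_less_1_iff)
  then show "i = j" by simp
qed

text \<open>The real part of a branch at z is ln(|z| / l), and the fixed point equation says that
  ln(q / l) = q.\<close>

lemma branch_in_halfplane: "z \<in> halfplane \<Longrightarrow> branch j z \<in> halfplane"
proof -
  assume z: "z \<in> halfplane"
  then have nz: "z / of_real l \<noteq> 0" using l_pos q_gt_1 halfplaneD(2)[of z] by auto
  have "exp q \<le> cmod z / l" using halfplaneD(2)[OF z] l_pos fixed_point by (simp add: field_simps)
  then have "q \<le> ln (cmod (z / of_real l))"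
    using l_pos by (subst ln_ge_iff) (auto simp: norm_divide intro: less_le_trans[of 0 "exp q"])
  then show ?thesis using nz by (simp add: halfplane_def branch_def)
qed

lemma branch_E:
  assumes "z \<in> strip j" shows "branch j (E z) = z"
proof -
  have "Ln (E z / of_real l) = z - of_real (2 * pi * of_int j) * \<i>"
  proof (rule Ln_unique)
    show "exp (z - of_real (2 * pi * of_int j) * \<i>) = E z / of_real l"
      using l_pos by (simp add: exp_diff exp_two_pi_int exp_map_def)
    have "\<bar>Im z - 2 * pi * of_int j\<bar> < pi / 2" using assms by (simp add: strip_def)
    then show "- pi < Im (z - of_real (2 * pi * of_int j) * \<i>)"
      "Im (z - of_real (2 * pi * of_int j) * \<i>) \<le> pi"
      using pi_gt_zero by (simp_all, linarith+)
  qed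
  then show ?thesis by (simp add: branch_def)
qed

lemma in_some_strip:
  assumes "0 < Re (E z)" obtains j where "z \<in> strip j"
proof -
  define j where "j = round (Im z / (2 * pi))"
  define t where "t = Im z - 2 * pi * of_int j"
  have "\<bar>Im z / (2 * pi) - of_int j\<bar> \<le> 1/2"
    using of_int_round_abs_le[of "Im z / (2 * pi)"] by (simp add: j_def abs_minus_commute)
  moreover have "t = 2 * pi * (Im z / (2 * pi) - of_int j)" by (simp add: t_def field_simps)
  ultimately have t: "\<bar>t\<bar> \<le> pi"
    using mult_left_mono[of "\<bar>Im z / (2 * pi) - of_int j\<bar>" "1/2" "2 * pi"] by (simp add: abs_mult)
  have "cos (Im z) = cos t"
    unfolding t_def by (simp add: cos_diff mult.assoc mult.commute[of pi] mult.left_commute[of pi])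
      (metis cos_int_2pin sin_int_2pin mult.commute mult.left_commute mult_zero_right mult.right_neutral add.right_neutral)
  moreover have "0 < l * (exp (Re z) * cos (Im z))" using assms by (simp add: exp_map_def Re_exp)
  ultimately have "0 < cos t" using l_pos by (simp add: zero_less_mult_iff)
  have "\<bar>t\<bar> < pi / 2"
  proof (rule ccontr)
    assume "\<not> \<bar>t\<bar> < pi / 2"
    then have "cos \<bar>t\<bar> \<le> cos (pi / 2)" using t by (intro cos_monotone_0_pi_le) auto
    then show False using \<open>0 < cos t\<close> by simp
  qed
  then show thesis using that[of j] by (simp add: strip_def t_def)
qed

lemma branch_contracting:
  assumes "z \<in> halfplane" "w \<in> halfplane"
  shows "dist (branch j z) (branch j w) \<le> dist z w / q"
proof -
  have "norm (branch j z - branch j w) \<le> 1 / q * norm (z - w)"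
  proof (rule field_differentiable_bound[OF convex_halfplane _ _ assms])
    fix u assume u: "u \<in> halfplane"
    then have "0 < Re u" using halfplaneD[of u] q_gt_1 by auto
    then have "u / of_real l \<notin> \<real>\<^sub>\<le>\<^sub>0" using l_pos by (auto simp: complex_nonpos_Reals_iff zero_less_divide_iff divide_le_0_iff)
    then show "(branch j has_field_derivative 1 / u) (at u within halfplane)"
      unfolding branch_def using l_pos \<open>0 < Re u\<close>
      by (auto intro!: derivative_eq_intros)
    show "cmod (1 / u) \<le> 1 / q" using halfplaneD[OF u] q_gt_1 by (simp add: norm_divide frac_le)
  qed
  then show ?thesis by (simp add: dist_norm)
qed

text \<open>Since E' = E and |E| depends only on the real part, the derivative on the convex
  half-plane to the left of the rightmost of the two points is bounded by |E| at that point.\<close>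

lemma E_lipschitz:
  "dist (E z) (E w) \<le> max (cmod (E z)) (cmod (E w)) * dist z w"
proof -
  define m where "m = max (Re z) (Re w)"
  have "norm (E z - E w) \<le> l * exp m * norm (z - w)"
  proof (rule field_differentiable_bound[where S = "{u. Re u \<le> m}"])
    show "convex {u. Re u \<le> m}" by (rule convex_halfspace_Re_le)
    show "(E has_field_derivative E u) (at u within {u. Re u \<le> m})" for u
      unfolding exp_map_def by (auto intro!: derivative_eq_intros)
    show "cmod (E u) \<le> l * exp m" if "u \<in> {u. Re u \<le> m}" for u
      using that l_pos by (simp add: norm_E)
  qed (auto simp: m_def)
  moreover have "l * exp m = max (cmod (E z)) (cmod (E w))"
    using l_pos by (auto simp: m_def norm_E max_def)
  ultimately show ?thesis by (simp add: dist_norm)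
qed

lemma branch_lower:
  assumes "z \<in> halfplane" "w \<in> halfplane"
  shows "dist z w \<le> max (cmod z) (cmod w) * dist (branch j z) (branch j w)"
  using E_lipschitz[of "branch j z" "branch j w"] assms by (simp add: E_branch_halfplane)

lemma branch_q: "branch 0 (of_real q) = of_real q"
proof -
  have "E (of_real q) = of_real q" by (simp add: exp_map_def exp_of_real fixed_point flip: of_real_mult)
  moreover have "complex_of_real q \<in> strip 0" by (simp add: strip_def)
  ultimately show ?thesis using branch_E by metis
qed

section \<open>Words of inverse branches: contraction and distortion\<close>

primrec word_map :: "int list \<Rightarrow> complex \<Rightarrow> complex" where
  "word_map [] z = z"
| "word_map (j # v) z = branch j (word_map v z)"

text \<open>With \<open>w = word_map v z\<close> and \<open>n = length v\<close>, the weight is the product of \<open>cmod ((E ^^ i) w)\<close>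
  over \<open>i < n\<close>: the Birkhoff product of the potential along the orbit segment from \<open>w\<close> to \<open>z\<close>.\<close>

primrec weight :: "int list \<Rightarrow> complex \<Rightarrow> real" where
  "weight [] z = 1"
| "weight (j # v) z = cmod (branch j (word_map v z)) * weight v z"

lemma word_map_halfplane: "z \<in> halfplane \<Longrightarrow> word_map v z \<in> halfplane"
  by (induction v) (auto intro: branch_in_halfplane)

lemma word_map_J0: "z \<in> J0 \<Longrightarrow> word_map v z \<in> J0"
proof (induction v)
  case (Cons j v)
  then have "word_map v z \<in> J0" by simp
  then show ?case using J0_halfplane J0_backward branch_in_halfplane E_branch_halfplane by simp
qed simp

lemma iterate_word_map: "z \<in> halfplane \<Longrightarrow> (E ^^ length v) (word_map v z) = z"
  by (induction v) (simp_all add: funpow_swap1 E_branch_halfplane word_map_halfplane)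

text \<open>The strip that contains the common value reveals the first letter, and E removes it.
  Equal lengths are essential: every word of zeros fixes q.\<close>

lemma word_map_inj:
  assumes "length v = length w" "z \<in> halfplane" "z' \<in> halfplane" "word_map v z = word_map w z'"
  shows "v = w"
  using assms(1,4)
proof (induction v w rule: list_induct2)
  case (Cons i v j w)
  have pos: "0 < Re (word_map u y)" if "y \<in> halfplane" for u y
    using halfplaneD(1)[OF word_map_halfplane[OF that]] q_gt_1 by (meson less_le_trans less_trans zero_less_one)
  have "i = j"
    using branch_in_strip[OF pos[OF assms(2)], of i v] branch_in_strip[OF pos[OF assms(3)], of j w] Cons.prems disjoint_strip
    by auto
  moreover have "word_map v z = word_map w z'"
    using Cons.prems E_branch_halfplane word_map_halfplane assms(2,3) by (metis word_map.simps(2))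
  ultimately show ?case using Cons.IH by simp
qed simp

lemma word_map_append: "word_map (u @ v) z = word_map u (word_map v z)"
  by (induction u) auto

lemma weight_append: "weight (u @ v) z = weight u (word_map v z) * weight v z"
  by (induction u) (auto simp: word_map_append)

lemma weight_ge: "z \<in> halfplane \<Longrightarrow> q ^ length v \<le> weight v z"
proof (induction v)
  case (Cons j v)
  have "q \<le> cmod (branch j (word_map v z))"
    using halfplaneD(2) branch_in_halfplane word_map_halfplane Cons.prems by blast
  then show ?case using Cons q_gt_1 by (auto intro!: mult_mono)
qed simp

lemma weight_pos: "z \<in> halfplane \<Longrightarrow> 0 < weight v z"
  using weight_ge[of z v] q_gt_1 by (meson less_le_trans zero_less_power less_trans zero_less_one)

lemma word_map_contracting:
  assumes "z \<in> halfplane" "w \<in> halfplane"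
  shows "dist (word_map v z) (word_map v w) \<le> dist z w / q ^ length v"
proof (induction v)
  case (Cons j v)
  have "dist (word_map (j # v) z) (word_map (j # v) w) \<le> dist (word_map v z) (word_map v w) / q"
    using branch_contracting word_map_halfplane assms by simp
  also have "\<dots> \<le> dist z w / q ^ length v / q"
    using Cons q_gt_1 by (intro divide_right_mono) auto
  finally show ?case by (simp add: mult.commute)
qed simp

lemma dist_word_map_le:
  assumes "z \<in> halfplane" "w \<in> halfplane"
  shows "dist (word_map v z) (word_map v w) \<le> dist z w"
proof -
  have "dist (word_map v z) (word_map v w) \<le> dist z w / q ^ length v"
    by (rule word_map_contracting[OF assms])
  also have "\<dots> \<le> dist z w / 1" using q_gt_1 by (intro divide_left_mono) auto
  finally show ?thesis by simp
qed

lemma norm_le_exp_dist: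
  assumes "w \<in> halfplane" shows "cmod z \<le> cmod w * exp (dist z w)"
proof -
  have w: "1 \<le> cmod w" using halfplaneD(2)[OF assms] q_gt_1 by simp
  have "cmod z \<le> cmod w + dist z w" by (simp add: dist_norm norm_triangle_sub)
  also have "\<dots> \<le> cmod w + cmod w * dist z w" using w by (simp add: mult_le_cancel_right1)
  also have "\<dots> = cmod w * (1 + dist z w)" by (simp add: algebra_simps)
  also have "\<dots> \<le> cmod w * exp (dist z w)" by (intro mult_left_mono exp_ge_add_one_self) simp
  finally show ?thesis .
qed

text \<open>The orbit segments of z and w are at distance at most \<open>dist z w / q ^ k\<close>
  after k letters, and the logarithms of the norms differ by no more. The induction carries the
  partial sum (1 - q^(-n)) / (q - 1) of the geometric series.\<close>

lemma weight_distortion: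
  assumes "z \<in> halfplane" "w \<in> halfplane"
  shows "weight v z \<le> exp (dist z w / (q - 1)) * weight v w"
proof -
  have "weight v z \<le> exp (dist z w * (1 - 1 / q ^ length v) / (q - 1)) * weight v w"
  proof (induction v)
    case (Cons j v)
    let ?z = "word_map (j # v) z" and ?w = "word_map (j # v) w"
    have "cmod ?z \<le> cmod ?w * exp (dist ?z ?w)"
      by (rule norm_le_exp_dist) (use word_map_halfplane assms in blast)
    also have "\<dots> \<le> cmod ?w * exp (dist z w / q ^ length (j # v))"
      by (intro mult_left_mono iffD2[OF exp_le_cancel_iff] word_map_contracting assms) simp
    finally have "cmod ?z * weight v z
        \<le> (cmod ?w * exp (dist z w / q ^ length (j # v))) *
          (exp (dist z w * (1 - 1 / q ^ length v) / (q - 1)) * weight v w)"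
      using Cons weight_pos[OF assms(1)] by (intro mult_mono) (auto simp: less_imp_le)
    also have "\<dots> = (exp (dist z w / q ^ length (j # v)) * exp (dist z w * (1 - 1 / q ^ length v) / (q - 1))) *
        weight (j # v) w"
      by simp
    also have "exp (dist z w / q ^ length (j # v)) * exp (dist z w * (1 - 1 / q ^ length v) / (q - 1))
        = exp (dist z w * (1 - 1 / q ^ length (j # v)) / (q - 1))"
      unfolding exp_add[symmetric] using q_gt_1 by (intro arg_cong[where f = exp]) (simp add: field_simps)
    finally show ?case by simp
  qed simp
  also have "\<dots> \<le> exp (dist z w / (q - 1)) * weight v w"
  proof (intro mult_right_mono iffD2[OF exp_le_cancel_iff] divide_right_mono)
    show "dist z w * (1 - 1 / q ^ length v) \<le> dist z w" using q_gt_1 by (intro mult_left_le) auto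
  qed (use q_gt_1 weight_pos[OF assms(2)] less_imp_le in auto)
  finally show ?thesis .
qed

text \<open>An upper bound for the expansion of the n-th iterate of E along orbits close to that of
  a preimage of q. Each letter contributes the norm along the orbit of the reference point and an
  error exp(\<rho> / q^k). The errors multiply to a constant that is independent of the
  word.\<close>

lemma word_map_lower:
  assumes "x \<in> halfplane" "y \<in> halfplane" "dist x q \<le> \<rho>" "dist y q \<le> \<rho>"
  shows "dist x y \<le> dist (word_map v x) (word_map v y) * (exp (\<rho> * q / (q - 1)) * weight v q)"
proof -
  let ?s = "\<lambda>n. \<rho> * q * (1 - 1 / q ^ n) / (q - 1)"
  have \<rho>: "0 \<le> \<rho>" using assms(3) zero_le_dist order_trans by blast
  \<comment> \<open>The derivative of the iterate is the product of norms shifted by one place: it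
    contains the endpoint q instead of the starting point \<open>word_map v q\<close>. The two extra
    factors convert this derivative into the weight; at the end \<open>cmod (word_map v q)\<close>
    is bounded below by q, which cancels.\<close>
  have main: "dist x y * cmod (word_map v q)
      \<le> dist (word_map v x) (word_map v y) * exp (?s (length v)) * (q * weight v q)"
  proof (induction v)
    case Nil
    then show ?case using q_gt_1 by simp
  next
    case (Cons j v)
    let ?d = "dist (word_map (j # v) x) (word_map (j # v) y)"
    let ?b = "cmod (word_map v q)"
    have b: "0 < ?b" using halfplaneD(2)[OF word_map_halfplane[OF q_halfplane, of v]] q_gt_1 by linarith
    have le: "cmod (word_map v u) \<le> ?b * exp (\<rho> / q ^ length v)" if "u \<in> halfplane" "dist u q \<le> \<rho>" for u
    proof -
      have "cmod (word_map v u) \<le> ?b * exp (dist (word_map v u) (word_map v q))"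
        by (rule norm_le_exp_dist) (rule word_map_halfplane[OF q_halfplane])
      also have "dist (word_map v u) (word_map v q) \<le> dist u q / q ^ length v"
        by (rule word_map_contracting[OF that(1) q_halfplane])
      also have "\<dots> \<le> \<rho> / q ^ length v" using that(2) q_gt_1 by (intro divide_right_mono) auto
      finally show ?thesis by (simp add: mult_left_mono)
    qed
    have "dist (word_map v x) (word_map v y) \<le> max (cmod (word_map v x)) (cmod (word_map v y)) * ?d"
      using branch_lower word_map_halfplane assms by simp
    also have "\<dots> \<le> (?b * exp (\<rho> / q ^ length v)) * ?d"
      using le assms by (intro mult_right_mono) auto
    finally have *: "dist (word_map v x) (word_map v y) \<le> (?b * exp (\<rho> / q ^ length v)) * ?d" .
    have "dist x y * ?b \<le> ((?b * exp (\<rho> / q ^ length v)) * ?d) * exp (?s (length v)) * (q * weight v q)"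
    proof -
      have "0 \<le> exp (?s (length v)) * (q * weight v q)"
        using weight_pos[OF q_halfplane, of v] q_gt_1 by simp
      from mult_right_mono[OF * this] Cons.IH show ?thesis by (simp only: mult.assoc)
    qed
    also have "\<dots> = (?d * (exp (\<rho> / q ^ length v) * exp (?s (length v))) * (q * weight v q)) * ?b"
      by simp
    also have "exp (\<rho> / q ^ length v) * exp (?s (length v)) = exp (?s (length (j # v)))"
      unfolding exp_add[symmetric] using q_gt_1 by (intro arg_cong[where f = exp]) (simp add: field_simps)
    finally have "dist x y \<le> ?d * exp (?s (length (j # v))) * (q * weight v q)"
      using b by (simp only: mult_le_cancel_right_pos)
    then have "dist x y * cmod (word_map (j # v) q)
       \<le> (?d * exp (?s (length (j # v))) * (q * weight v q)) * cmod (word_map (j # v) q)"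
      by (rule mult_right_mono) simp
    also have "\<dots> = ?d * exp (?s (length (j # v))) * (q * weight (j # v) q)" by simp
    finally show ?case .
  qed
  have s: "?s (length v) \<le> \<rho> * q / (q - 1)"
  proof (intro divide_right_mono)
    show "\<rho> * q * (1 - 1 / q ^ length v) \<le> \<rho> * q" using q_gt_1 \<rho> by (intro mult_left_le) auto
  qed (use q_gt_1 in auto)
  have "dist x y * q \<le> dist x y * cmod (word_map v q)"
    using halfplaneD(2)[OF word_map_halfplane[OF q_halfplane, of v]] by (intro mult_left_mono) auto
  also note main
  also have "dist (word_map v x) (word_map v y) * exp (?s (length v)) * (q * weight v q)
     \<le> dist (word_map v x) (word_map v y) * exp (\<rho> * q / (q - 1)) * (q * weight v q)"
    using s q_gt_1 weight_pos[OF q_halfplane, of v] by (intro mult_right_mono mult_left_mono) auto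
  also have "\<dots> = (dist (word_map v x) (word_map v y) * (exp (\<rho> * q / (q - 1)) * weight v q)) * q"
    by simp
  finally show ?thesis using q_gt_1 by (simp only: mult_le_cancel_right_pos)
qed

end

section \<open>Convergence of the word series\<close>

lemma nn_integral_count_space_le:
  fixes f :: "'a::countable \<Rightarrow> ennreal"
  assumes "\<And>F. finite F \<Longrightarrow> sum f F \<le> B"
  shows "(\<integral>\<^sup>+x. f x \<partial>count_space UNIV) \<le> B"
proof -
  define A where "A n = {x::'a. to_nat x < n}" for n
  have fin: "finite (A n)" for n
    unfolding A_def by (rule finite_vimageI[of "{..<n}" "to_nat", unfolded vimage_def lessThan_iff]) auto
  have "(SUP n. f x * indicator (A n) x) = f x" for x
  proof (rule antisym)
    show "(SUP n. f x * indicator (A n) x) \<le> f x" by (intro SUP_least) (auto simp: indicator_def)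
    have "f x = f x * indicator (A (Suc (to_nat x))) x" by (simp add: A_def)
    also have "\<dots> \<le> (SUP n. f x * indicator (A n) x)" by (rule SUP_upper) simp
    finally show "f x \<le> (SUP n. f x * indicator (A n) x)" .
  qed
  then have "(\<integral>\<^sup>+x. f x \<partial>count_space UNIV) = (\<integral>\<^sup>+x. (SUP n. f x * indicator (A n) x) \<partial>count_space UNIV)" by simp
  also have "\<dots> = (SUP n. \<integral>\<^sup>+x. f x * indicator (A n) x \<partial>count_space UNIV)"
    by (rule nn_integral_monotone_convergence_SUP)
      (auto simp: incseq_def le_fun_def A_def indicator_def)
  also have "\<dots> \<le> B"
  proof (rule SUP_least)
    fix n
    have "(\<integral>\<^sup>+x. f x * indicator (A n) x \<partial>count_space UNIV) = (\<Sum>x\<in>A n. f x * indicator (A n) x)"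
      by (rule nn_integral_count_space') (use fin in auto)
    also have "\<dots> = sum f (A n)" by (intro sum.cong) auto
    also have "\<dots> \<le> B" by (rule assms[OF fin])
    finally show "(\<integral>\<^sup>+x. f x * indicator (A n) x \<partial>count_space UNIV) \<le> B" .
  qed
  finally show ?thesis .
qed

lemma nn_integral_by_length:
  fixes f :: "'a list \<Rightarrow> ennreal"
  shows "(\<integral>\<^sup>+v. f v \<partial>count_space UNIV)
    = (\<Sum>n. \<integral>\<^sup>+v. f v * indicator {v. length v = n} v \<partial>count_space UNIV)"
proof -
  have "(\<Sum>n. f v * indicator {v. length v = n} v) = f v" for v
    by (subst suminf_finite[of "{length v}"]) auto
  then have "(\<integral>\<^sup>+v. f v \<partial>count_space UNIV)
      = (\<integral>\<^sup>+v. (\<Sum>n. f v * indicator {v. length v = n} v) \<partial>count_space UNIV)" by simp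
  also have "\<dots> = (\<Sum>n. \<integral>\<^sup>+v. f v * indicator {v. length v = n} v \<partial>count_space UNIV)"
    by (rule nn_integral_suminf) simp
  finally show ?thesis .
qed

lemma hausdorff_dim_nonneg: "0 \<le> hausdorff_dim A"
  unfolding hausdorff_dim_def by (rule INF_greatest) auto

lemma hausdorff_dim_le_nonneg: "hausdorff_dim A \<le> ereal \<beta> \<Longrightarrow> 0 \<le> \<beta>"
  using order_trans[OF hausdorff_dim_nonneg] by fastforce

context exp_dynamics
begin

lemma iterate_q: "(E ^^ n) (of_real q) = of_real q"
proof (induction n)
  case (Suc n)
  have "E (of_real q) = of_real q" by (simp add: exp_map_def exp_of_real fixed_point flip: of_real_mult)
  then show ?case using Suc by simp
qed simp

text \<open>The bound is the same for all lengths n. If it failed, the rates 1 / (K weight), with K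
  the constant of \<open>word_map_lower\<close> for the ball of radius \<rho>, would satisfy Moran's
  inequality at exponent s. The points of the invariant set are radial because their orbits return
  to this ball at every multiple of n.\<close>

lemma finite_word_sum_le:
  assumes dim: "hausdorff_dim (radial_julia_set E) < ereal s" and n: "1 \<le> n" and R: "0 \<le> R"
    and F: "finite F" "\<And>v. v \<in> F \<Longrightarrow> length v = n" "\<And>v. v \<in> F \<Longrightarrow> dist (word_map v q) q \<le> R"
  defines "\<rho> \<equiv> R * q / (q - 1)"
  shows "(\<Sum>v\<in>F. weight v q powr (- s)) \<le> exp (\<rho> * q / (q - 1)) powr s"
proof (rule ccontr)
  assume gt: "\<not> ?thesis"
  define K where "K = exp (\<rho> * q / (q - 1))"
  \<comment> \<open>The radius solves \<rho> / q + R = \<rho>: a nonempty word shrinks the ball of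
    radius \<rho> around q at least by the factor q and moves its centre by at most R, so the ball
    is mapped into itself.\<close>
  have \<rho>: "0 \<le> \<rho>" "\<rho> / q + R = \<rho>" using R q_gt_1 unfolding \<rho>_def by (auto simp: field_simps)
  have K: "1 \<le> K" unfolding K_def using \<rho> q_gt_1 by simp
  define c where "c v = 1 / (K * weight v q)" for v
  have W: "1 < weight v q" if "v \<in> F" for v
  proof -
    have "1 < q ^ n" using q_gt_1 n by (simp add: one_less_power)
    then show ?thesis using weight_ge[OF q_halfplane, of v] F(2)[OF that] by simp
  qed
  have c: "0 < c v" "c v < 1" if "v \<in> F" for v
  proof -
    have "1 * 1 < K * weight v q" using K W[OF that] by (intro mult_le_less_imp_less) auto
    then show "0 < c v" "c v < 1" by (auto simp: c_def)
  qed
  have cs: "1 \<le> (\<Sum>v\<in>F. c v powr s)"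
  proof -
    have "c v powr s = weight v q powr (- s) / K powr s" if "v \<in> F" for v
      using K W[OF that] unfolding c_def
      by (simp add: powr_divide powr_mult powr_minus field_simps)
    then have "(\<Sum>v\<in>F. c v powr s) = (\<Sum>v\<in>F. weight v q powr (- s)) / K powr s"
      by (simp add: sum_divide_distrib)
    then show ?thesis using gt K by (simp add: K_def le_divide_eq)
  qed
  \<comment> \<open>This set may be larger than the attractor of the system, but it is visibly
    closed and bounded, invariant under the words in \<open>F\<close>, and made of radial
    points.\<close>
  define \<Lambda> where "\<Lambda> = {z \<in> J0. \<forall>k. dist ((E ^^ (n * k)) z) q \<le> \<rho>}"
  have \<Lambda>D: "z \<in> J0" "z \<in> halfplane" "dist z q \<le> \<rho>" if "z \<in> \<Lambda>" for z
    using that J0_halfplane unfolding \<Lambda>_def by (auto dest: spec[of _ 0])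
  have \<Lambda>compact: "compact \<Lambda>"
  proof -
    have "\<Lambda> = J0 \<inter> (\<Inter>k. (E ^^ (n * k)) -` cball q \<rho>)" by (auto simp: \<Lambda>_def dist_commute)
    moreover have "closed ((E ^^ (n * k)) -` cball q \<rho>)" for k
      using continuous_on_iterate[of UNIV "n * k"]
      by (intro continuous_closed_vimage) (auto simp: continuous_on_eq_continuous_at)
    ultimately have "closed \<Lambda>" using closed_J0 by (auto intro!: closed_INT)
    moreover have "\<Lambda> \<subseteq> cball q \<rho>" using \<Lambda>D(3) by (auto simp: dist_commute)
    ultimately show ?thesis by (meson bounded_cball bounded_subset compact_eq_bounded_closed)
  qed
  have q\<Lambda>: "complex_of_real q \<in> \<Lambda>" using real_in_J0[of q] \<rho>(1) by (simp add: \<Lambda>_def iterate_q)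
  have cont: "continuous_on \<Lambda> (word_map v)" for v
    by (rule lipschitz_on_continuous_on[of 1], rule lipschitz_onI) (use dist_word_map_le \<Lambda>D in auto)
  have inv: "word_map v z \<in> \<Lambda>" if "v \<in> F" "z \<in> \<Lambda>" for v z
  proof -
    have "dist ((E ^^ (n * k)) (word_map v z)) q \<le> \<rho>" for k
    proof (cases k)
      case 0
      have "q ^ 1 \<le> q ^ n" using q_gt_1 n by (intro power_increasing) auto
      have "dist (word_map v z) q \<le> dist (word_map v z) (word_map v q) + dist (word_map v q) q"
        by (rule dist_triangle)
      also have "dist (word_map v z) (word_map v q) \<le> dist z q / q ^ length v"
        by (rule word_map_contracting) (use \<Lambda>D that q_halfplane in auto)
      also have "\<dots> \<le> \<rho> / q"
        using \<Lambda>D(3)[OF that(2)] \<rho>(1) q_gt_1 \<open>q ^ 1 \<le> q ^ n\<close> F(2)[OF that(1)] by (intro frac_le) auto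
      finally show ?thesis using F(3)[OF that(1)] \<rho>(2) 0 by simp
    next
      case (Suc k')
      have "(E ^^ (n * k)) (word_map v z) = (E ^^ (n * k')) ((E ^^ n) (word_map v z))"
        unfolding Suc by (simp add: funpow_add add.commute[of n])
      also have "(E ^^ n) (word_map v z) = z"
        using iterate_word_map[OF \<Lambda>D(2)[OF that(2)], of v] F(2)[OF that(1)] by simp
      finally show ?thesis using that(2) by (simp add: \<Lambda>_def)
    qed
    then show ?thesis using word_map_J0[OF \<Lambda>D(1)[OF that(2)]] by (simp add: \<Lambda>_def)
  qed
  have low: "c v * dist x y \<le> dist (word_map v x) (word_map v y)" if "v \<in> F" "x \<in> \<Lambda>" "y \<in> \<Lambda>" for v x y
    using word_map_lower[of x y \<rho> v] \<Lambda>D that K W[OF that(1)]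
    by (simp add: c_def K_def[symmetric] divide_le_eq)
  have disj: "word_map v x \<noteq> word_map w y" if "v \<in> F" "w \<in> F" "v \<noteq> w" "x \<in> \<Lambda>" "y \<in> \<Lambda>" for v w x y
    using word_map_inj[of v w x y] F(2) \<Lambda>D that by auto
  have sum: "1 \<le> (\<Sum>v\<in>F. c v powr t)" if "t < s" for t
  proof -
    have "(\<Sum>v\<in>F. c v powr s) \<le> (\<Sum>v\<in>F. c v powr t)"
      using c that by (intro sum_mono powr_mono') (auto intro: less_imp_le)
    then show ?thesis using cs by simp
  qed
  have H: "hausdorff_measure t \<Lambda> \<noteq> 0" if "0 \<le> t" "t < s" for t
    by (rule hausdorff_measure_ifs_neq_0[OF F(1) \<Lambda>compact q\<Lambda> cont inv c low disj that(1) sum[OF that(2)]])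
  have "\<Lambda> \<subseteq> radial_julia_set E"
  proof
    fix z assume z: "z \<in> \<Lambda>"
    have b: "ereal (cmod ((E ^^ (n * k)) z)) \<le> ereal (\<rho> + q)" for k
    proof -
      have "dist ((E ^^ (n * k)) z) q \<le> \<rho>" using z by (simp add: \<Lambda>_def)
      then show ?thesis using norm_triangle_sub[of "(E ^^ (n * k)) z" "of_real q"] q_gt_1
        by (simp add: dist_norm)
    qed
    have "strict_mono (\<lambda>k. n * k)" using n by (intro strict_monoI) simp
    then have "liminf (\<lambda>k. ereal (cmod ((E ^^ k) z))) \<le> liminf ((\<lambda>k. ereal (cmod ((E ^^ k) z))) \<circ> (\<lambda>k. n * k))"
      by (rule liminf_subseq_mono)
    also have "\<dots> \<le> limsup ((\<lambda>k. ereal (cmod ((E ^^ k) z))) \<circ> (\<lambda>k. n * k))"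
      by (rule Liminf_le_Limsup) simp
    also have "\<dots> \<le> ereal (\<rho> + q)" by (rule Limsup_bounded) (use b in simp)
    also have "\<dots> < \<infinity>" by simp
    finally show "z \<in> radial_julia_set E"
      using \<Lambda>D(1)[OF z] by (simp add: radial_julia_set_def julia_set_eq)
  qed
  then have "ereal s \<le> hausdorff_dim (radial_julia_set E)"
    using hausdorff_measure_mono[of \<Lambda> "radial_julia_set E"] H
    by (intro hausdorff_dim_geI) (metis le_zero_eq)
  with dim show False by simp
qed

definition word_series :: "real \<Rightarrow> real \<Rightarrow> ennreal" where
  "word_series \<beta> R = (\<integral>\<^sup>+v. ennreal (weight v q powr (- \<beta>)) *
     indicator {v. dist (word_map v q) q \<le> R} v \<partial>count_space UNIV)"

text \<open>For s strictly between the dimension and \<beta>, the words of one length have bounded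
  sum at exponent s. Their weights are at least q^n, so raising the exponent to \<beta> gains the
  factor \<open>\<theta> ^ n\<close> with \<theta> < 1.\<close>

theorem word_series_finite:
  assumes "hausdorff_dim (radial_julia_set E) < ereal \<beta>"
  shows "word_series \<beta> R < \<infinity>"
proof -
  obtain s where s: "hausdorff_dim (radial_julia_set E) < ereal s" "s < \<beta>"
    using ereal_dense2[OF assms] by auto
  have "0 < s" using hausdorff_dim_nonneg[of "radial_julia_set E"] s(1)
    by (metis ereal_less(2) le_less_trans)
  define R' where "R' = max R 0"
  \<comment> \<open>The maximum with 1 serves length 0, where only the empty word of weight 1 can
    occur.\<close>
  define K where "K = max 1 (exp (R' * q / (q - 1) * q / (q - 1)) powr s)"
  define \<theta> where "\<theta> = q powr (s - \<beta>)"
  have \<theta>: "0 < \<theta>" "\<theta> < 1" unfolding \<theta>_def using q_gt_1 s(2) by (auto simp: powr_less_one)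
  define f where "f v = ennreal (weight v q powr (- \<beta>)) *
     indicator {v. dist (word_map v q) q \<le> R} v" for v
  let ?I = "\<lambda>n. \<integral>\<^sup>+v. f v * indicator {v. length v = n} v \<partial>count_space UNIV"
  have bound: "?I n \<le> ennreal (K * \<theta> ^ n)" for n
  proof (rule nn_integral_count_space_le)
    fix F :: "int list set" assume F: "finite F"
    define F' where "F' = {v\<in>F. length v = n \<and> dist (word_map v q) q \<le> R}"
    have F': "finite F'" using F by (simp add: F'_def)
    have "(\<Sum>v\<in>F. f v * indicator {v. length v = n} v) = (\<Sum>v\<in>F'. ennreal (weight v q powr (- \<beta>)))"
      unfolding F'_def f_def using F by (intro sum.mono_neutral_cong_right) (auto simp: indicator_def split: if_splits)
    also have "\<dots> = ennreal (\<Sum>v\<in>F'. weight v q powr (- \<beta>))" by (rule sum_ennreal) simp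
    also have "\<dots> \<le> ennreal (K * \<theta> ^ n)"
    proof (rule ennreal_leI)
      have "(\<Sum>v\<in>F'. weight v q powr (- \<beta>)) \<le> (\<Sum>v\<in>F'. weight v q powr (- s) * \<theta> ^ n)"
      proof (rule sum_mono)
        fix v assume "v \<in> F'"
        then have "q ^ n \<le> weight v q" using weight_ge[OF q_halfplane, of v] by (simp add: F'_def)
        then have "weight v q powr (s - \<beta>) \<le> (q ^ n) powr (s - \<beta>)"
          using s(2) q_gt_1 by (intro powr_mono2') auto
        also have "\<dots> = \<theta> ^ n" unfolding \<theta>_def using q_gt_1
          by (simp add: powr_realpow[symmetric] powr_powr mult.commute)
        finally have "weight v q powr (s - \<beta>) \<le> \<theta> ^ n" .
        then have "weight v q powr (- s) * weight v q powr (s - \<beta>) \<le> weight v q powr (- s) * \<theta> ^ n"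
          by (rule mult_left_mono) simp
        then show "weight v q powr (- \<beta>) \<le> weight v q powr (- s) * \<theta> ^ n"
          by (simp add: powr_add[symmetric])
      qed
      also have "\<dots> = (\<Sum>v\<in>F'. weight v q powr (- s)) * \<theta> ^ n" by (simp add: sum_distrib_right)
      also have "\<dots> \<le> K * \<theta> ^ n"
      proof (rule mult_right_mono)
        show "(\<Sum>v\<in>F'. weight v q powr (- s)) \<le> K"
        proof (cases "n = 0")
          case True
          then have "F' \<subseteq> {[]}" by (auto simp: F'_def)
          then have "(\<Sum>v\<in>F'. weight v q powr (- s)) \<le> (\<Sum>v\<in>{[]}. weight v q powr (- s))"
            by (intro sum_mono2) auto
          then show ?thesis by (simp add: K_def)
        next
          case False
          then have "(\<Sum>v\<in>F'. weight v q powr (- s)) \<le> exp (R' * q / (q - 1) * q / (q - 1)) powr s"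
            by (intro finite_word_sum_le[OF s(1), of n R']) (use F' in \<open>auto simp: F'_def R'_def\<close>)
          then show ?thesis by (simp add: K_def)
        qed
      qed (use \<theta> in simp)
      finally show "(\<Sum>v\<in>F'. weight v q powr (- \<beta>)) \<le> K * \<theta> ^ n" .
    qed
    finally show "(\<Sum>v\<in>F. f v * indicator {v. length v = n} v) \<le> ennreal (K * \<theta> ^ n)" .
  qed
  have "word_series \<beta> R = (\<Sum>n. ?I n)"
    unfolding word_series_def f_def by (rule nn_integral_by_length)
  also have "\<dots> \<le> (\<Sum>n. ennreal (K * \<theta> ^ n))" by (intro suminf_le bound) auto
  also have "\<dots> = ennreal (\<Sum>n. K * \<theta> ^ n)"
    by (rule suminf_ennreal2) (use \<theta> K_def in \<open>auto intro!: summable_mult summable_geometric\<close>)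
  also have "\<dots> < \<infinity>" by simp
  finally show ?thesis .
qed

end

section \<open>Conformal measures as limits of orbit measures\<close>

lemma nn_integral_count_space_inj_le:
  assumes "inj g"
  shows "(\<integral>\<^sup>+x. f (g x) \<partial>count_space UNIV) \<le> (\<integral>\<^sup>+y. f y \<partial>count_space UNIV)"
proof -
  have "(\<integral>\<^sup>+x. f (g x) \<partial>count_space UNIV) = (\<integral>\<^sup>+y. f y \<partial>count_space (range g))"
    by (rule nn_integral_bij_count_space) (use assms in \<open>simp add: inj_imp_bij_betw_inv bij_betw_def\<close>)
  also have "\<dots> = (\<integral>\<^sup>+y. f y * indicator (range g) y \<partial>count_space UNIV)"
    by (subst nn_integral_count_space_indicator) (auto simp: mult.commute)
  also have "\<dots> \<le> (\<integral>\<^sup>+y. f y \<partial>count_space UNIV)"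
    by (intro nn_integral_mono) (auto simp: indicator_def)
  finally show ?thesis .
qed

context exp_dynamics
begin

text \<open>Point masses on the backward orbit of \<open>x\<close>; conformality fails only at \<open>x\<close> itself, where the
  empty word has no preceding letter.\<close>

definition orbit_measure :: "real \<Rightarrow> complex \<Rightarrow> complex measure" where
  "orbit_measure \<beta> x =
     distr (density (count_space UNIV) (\<lambda>v. ennreal (weight v x powr (- \<beta>)))) borel (\<lambda>v. word_map v x)"

lemma sets_orbit_measure [simp, measurable_cong]: "sets (orbit_measure \<beta> x) = sets borel"
  by (simp add: orbit_measure_def)

lemma nn_integral_orbit_measure:
  assumes "u \<in> borel_measurable borel"
  shows "(\<integral>\<^sup>+z. u z \<partial>orbit_measure \<beta> x)
    = (\<integral>\<^sup>+v. ennreal (weight v x powr (- \<beta>)) * u (word_map v x) \<partial>count_space UNIV)"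
  unfolding orbit_measure_def using assms
  by (subst nn_integral_distr, simp, simp, subst nn_integral_density) simp_all

lemma emeasure_orbit_measure:
  assumes "A \<in> sets borel"
  shows "emeasure (orbit_measure \<beta> x) A
    = (\<integral>\<^sup>+v. ennreal (weight v x powr (- \<beta>)) * indicator {v. word_map v x \<in> A} v \<partial>count_space UNIV)"
proof -
  have "emeasure (orbit_measure \<beta> x) A = (\<integral>\<^sup>+z. indicator A z \<partial>orbit_measure \<beta> x)" using assms by simp
  also have "\<dots> = (\<integral>\<^sup>+v. ennreal (weight v x powr (- \<beta>)) * indicator A (word_map v x) \<partial>count_space UNIV)"
    using assms by (intro nn_integral_orbit_measure) simp
  finally show ?thesis by (simp add: indicator_def)
qed

lemma AE_orbit_measure_J0:
  assumes "x \<in> J0" shows "AE z in orbit_measure \<beta> x. z \<in> J0"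
proof -
  have "- J0 \<in> sets borel" using closed_J0 by simp
  then have "emeasure (orbit_measure \<beta> x) (- J0) = 0"
    using word_map_J0[OF assms] by (simp add: emeasure_orbit_measure)
  then show ?thesis using \<open>- J0 \<in> sets borel\<close> by (intro AE_I[of _ _ "- J0"]) auto
qed

text \<open>Distortion replaces x by q at the cost of a factor and of a larger ball, both depending
  on the distance of x from q. The resulting bound is not uniform in x; it only shows
  finiteness.\<close>

lemma orbit_measure_finite:
  assumes dim: "hausdorff_dim (radial_julia_set E) < ereal \<beta>" and x: "x \<in> halfplane"
  shows "emeasure (orbit_measure \<beta> x) (cball q R) < \<infinity>"
proof -
  have \<beta>: "0 \<le> \<beta>" by (rule hausdorff_dim_le_nonneg[OF less_imp_le[OF dim]])
  define D where "D = dist (of_real q) x / (q - 1)"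
  have "emeasure (orbit_measure \<beta> x) (cball q R)
     \<le> (\<integral>\<^sup>+v. ennreal (exp (D * \<beta>)) * (ennreal (weight v q powr (- \<beta>)) *
     indicator {v. dist (word_map v q) q \<le> R + dist x q} v) \<partial>count_space UNIV)"
    unfolding emeasure_orbit_measure[OF borel_closed[OF closed_cball]]
  proof (intro nn_integral_mono)
    fix v
    have W: "weight v x powr (- \<beta>) \<le> exp (D * \<beta>) * weight v q powr (- \<beta>)"
    proof -
      have "weight v q \<le> exp D * weight v x"
        unfolding D_def by (rule weight_distortion[OF q_halfplane x])
      then have "(exp D * weight v x) powr (- \<beta>) \<le> weight v q powr (- \<beta>)"
        using \<beta> weight_pos[OF q_halfplane] by (intro powr_mono2') auto
      then have "exp (D * \<beta>) * ((exp D * weight v x) powr (- \<beta>)) \<le> exp (D * \<beta>) * weight v q powr (- \<beta>)"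
        by (rule mult_left_mono) simp
      moreover have "(exp D * weight v x) powr (- \<beta>) = exp (- (D * \<beta>)) * weight v x powr (- \<beta>)"
        using weight_pos[OF x, of v] by (simp add: powr_mult) (simp add: powr_def)
      ultimately show ?thesis by (simp add: mult.assoc[symmetric] exp_minus)
    qed
    have "dist (word_map v q) q \<le> dist (word_map v x) q + dist x q"
      using dist_triangle[of "word_map v q" q "word_map v x"] dist_word_map_le[OF x q_halfplane, of v]
      by (simp add: dist_commute)
    then show "ennreal (weight v x powr (- \<beta>)) * indicator {v. word_map v x \<in> cball q R} v
      \<le> ennreal (exp (D * \<beta>)) * (ennreal (weight v q powr (- \<beta>)) *
     indicator {v. dist (word_map v q) q \<le> R + dist x q} v)"
      using ennreal_leI[OF W] by (auto simp: indicator_def dist_commute ennreal_mult)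
  qed
  also have "\<dots> = ennreal (exp (D * \<beta>)) * word_series \<beta> (R + dist x q)"
    unfolding word_series_def by (rule nn_integral_cmult) simp
  also have "\<dots> < \<infinity>" using word_series_finite[OF dim] by (simp add: ennreal_mult_less_top)
  finally show ?thesis .
qed

text \<open>Iterating the branch that fixes \<open>q\<close> carries any ball around \<open>q\<close> into the unit ball; this bounds
  the measure of every ball by that of the unit ball, uniformly in \<open>x\<close>.\<close>

lemma word_map_replicate_q: "word_map (replicate n 0) (of_real q) = of_real q"
  by (induction n) (auto simp: branch_q)

lemma weight_replicate_le:
  assumes "y \<in> halfplane" "dist y q \<le> R"
  shows "weight (replicate n 0) y \<le> (q + R) ^ n"
proof (induction n)
  case (Suc n)
  have "dist (word_map (replicate (Suc n) 0) y) q \<le> R"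
    using dist_word_map_le[OF assms(1) q_halfplane, of "replicate (Suc n) 0"] assms(2)
    unfolding word_map_replicate_q by linarith
  then have "cmod (word_map (replicate (Suc n) 0) y) \<le> q + R"
    using norm_triangle_sub[of "word_map (replicate (Suc n) 0) y" "of_real q"] q_gt_1 by (simp add: dist_norm)
  moreover have "0 \<le> R" using assms(2) zero_le_dist order_trans by blast
  ultimately have "cmod (word_map (replicate (Suc n) 0) y) * weight (replicate n 0) y \<le> (q + R) * (q + R) ^ n"
    using Suc weight_pos[OF assms(1)] q_gt_1 by (intro mult_mono) (auto simp: less_imp_le)
  then show ?case by simp
qed simp

lemma orbit_measure_cball_le:
  assumes x: "x \<in> halfplane" and \<beta>: "0 \<le> \<beta>" and n: "R \<le> q ^ n" and R: "0 \<le> R"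
  shows "emeasure (orbit_measure \<beta> x) (cball q R)
     \<le> ennreal (((q + R) ^ n) powr \<beta>) * emeasure (orbit_measure \<beta> x) (cball q 1)"
proof -
  define u :: "int list" where "u = replicate n 0"
  define C where "C = (q + R) ^ n"
  have C: "0 < C" using q_gt_1 R by (simp add: C_def)
  define g where "g v = ennreal (weight v x powr (- \<beta>)) * indicator {v. word_map v x \<in> cball q 1} v" for v
  \<comment> \<open>Prepending \<open>u\<close> maps the words that end in the large ball
    injectively to words that end in the unit ball, and it multiplies their weights by at most
    \<open>C\<close>.\<close>
  have "emeasure (orbit_measure \<beta> x) (cball q R) \<le> (\<integral>\<^sup>+v. ennreal (C powr \<beta>) * g (u @ v) \<partial>count_space UNIV)"
    unfolding emeasure_orbit_measure[OF borel_closed[OF closed_cball]]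
  proof (intro nn_integral_mono)
    fix v
    show "ennreal (weight v x powr (- \<beta>)) * indicator {v. word_map v x \<in> cball q R} v \<le> ennreal (C powr \<beta>) * g (u @ v)"
    proof (cases "word_map v x \<in> cball q R")
      case True
      let ?y = "word_map v x"
      have y: "?y \<in> halfplane" "dist ?y q \<le> R" using True word_map_halfplane[OF x] by (auto simp: dist_commute)
      have "dist (word_map u ?y) (word_map u q) \<le> dist ?y q / q ^ n"
        using word_map_contracting[OF y(1) q_halfplane, of u] by (simp add: u_def)
      also have "\<dots> \<le> q ^ n / q ^ n" using y(2) n q_gt_1 by (intro divide_right_mono) auto
      finally have "word_map (u @ v) x \<in> cball q 1"
        using q_gt_1 by (simp add: u_def word_map_replicate_q word_map_append dist_commute)
      moreover have "weight v x powr (- \<beta>) \<le> C powr \<beta> * weight (u @ v) x powr (- \<beta>)"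
      proof -
        have "weight (u @ v) x \<le> C * weight v x"
          using weight_replicate_le[OF y] weight_pos[OF x, of v]
          unfolding weight_append u_def C_def by (intro mult_right_mono) auto
        then have "(C * weight v x) powr (- \<beta>) \<le> weight (u @ v) x powr (- \<beta>)"
          using \<beta> weight_pos[OF x] by (intro powr_mono2') auto
        then have "C powr \<beta> * (C * weight v x) powr (- \<beta>) \<le> C powr \<beta> * weight (u @ v) x powr (- \<beta>)"
          by (rule mult_left_mono) simp
        moreover have "C powr \<beta> * (C * weight v x) powr (- \<beta>) = weight v x powr (- \<beta>)"
          using C weight_pos[OF x, of v] by (simp add: powr_mult powr_minus field_simps)
        ultimately show ?thesis by simp
      qed
      ultimately show ?thesis using True by (auto simp: g_def ennreal_mult[symmetric] intro!: ennreal_leI)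
    qed simp
  qed
  also have "\<dots> = ennreal (C powr \<beta>) * (\<integral>\<^sup>+v. g (u @ v) \<partial>count_space UNIV)" by (rule nn_integral_cmult) simp
  also have "\<dots> \<le> ennreal (C powr \<beta>) * (\<integral>\<^sup>+v. g v \<partial>count_space UNIV)"
    by (intro mult_left_mono nn_integral_count_space_inj_le) (auto intro: injI)
  also have "(\<integral>\<^sup>+v. g v \<partial>count_space UNIV) = emeasure (orbit_measure \<beta> x) (cball q 1)"
    unfolding g_def by (rule emeasure_orbit_measure[symmetric]) simp
  finally show ?thesis by (simp add: C_def)
qed

text \<open>The empty word puts mass 1 at x. If the unit ball were null, so would be the ball around
  q that reaches x.\<close>

lemma orbit_measure_pos:
  assumes x: "x \<in> halfplane" and \<beta>: "0 \<le> \<beta>"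
  shows "0 < emeasure (orbit_measure \<beta> x) (cball q 1)"
proof (rule ccontr)
  assume "\<not> 0 < emeasure (orbit_measure \<beta> x) (cball q 1)"
  then have 0: "emeasure (orbit_measure \<beta> x) (cball q 1) = 0" by (simp add: not_gr_zero)
  obtain n where n: "dist x q \<le> q ^ n" using real_arch_pow[OF q_gt_1] less_imp_le by blast
  have "(\<integral>\<^sup>+v. ennreal (weight v x powr (- \<beta>)) * indicator {v. word_map v x \<in> cball q (dist x q)} v \<partial>count_space UNIV) = 0"
    using orbit_measure_cball_le[OF x \<beta> n zero_le_dist] 0
    by (simp add: emeasure_orbit_measure)
  then have "\<forall>v. ennreal (weight v x powr (- \<beta>)) * indicator {v. word_map v x \<in> cball q (dist x q)} v = 0"
    by (subst (asm) nn_integral_0_iff_AE) (auto simp: AE_count_space)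
  from spec[OF this, of "[]"] show False by (simp add: dist_commute)
qed

text \<open>Prepending j matches all words with the words that begin with j, whose points lie in
  strip j, and the new factor of the weight cancels against the norm. The only other word whose
  point can lie in that strip is the empty one; its term vanishes because u is 0 at
  \<open>E x\<close>.\<close>

lemma orbit_measure_conformal:
  assumes u: "u \<in> borel_measurable borel" and x: "x \<in> halfplane" and ux: "u (E x) = 0"
  shows "(\<integral>\<^sup>+z. indicator (strip j) z * (u (E z) * ennreal (cmod z powr \<beta>)) \<partial>orbit_measure \<beta> x)
     = (\<integral>\<^sup>+z. u z \<partial>orbit_measure \<beta> x)"
proof -
  have "continuous_on UNIV E" using continuous_on_iterate[of UNIV 1] by simp
  then have [measurable]: "E \<in> borel_measurable borel" by (rule borel_measurable_continuous_onI)
  have [measurable]: "strip j \<in> sets borel" using open_strip by simp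
  have [measurable]: "u \<in> borel_measurable borel" by (rule u)
  define h where "h v = ennreal (weight v x powr (- \<beta>)) *
     (indicator (strip j) (word_map v x) * (u (E (word_map v x)) * ennreal (cmod (word_map v x) powr \<beta>)))" for v
  have pos: "0 < Re (word_map v x)" for v
    using halfplaneD(1)[OF word_map_halfplane[OF x, of v]] q_gt_1 by linarith
  have "(\<integral>\<^sup>+z. indicator (strip j) z * (u (E z) * ennreal (cmod z powr \<beta>)) \<partial>orbit_measure \<beta> x)
      = (\<integral>\<^sup>+v. h v \<partial>count_space UNIV)"
    unfolding h_def by (rule nn_integral_orbit_measure) measurable
  also have "\<dots> = (\<integral>\<^sup>+v. h v \<partial>count_space (range ((#) j)))"
  proof (rule nn_integral_count_space_eq)
    fix v assume v: "v \<in> UNIV - range ((#) j)"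
    show "h v = 0"
    proof (cases v)
      case Nil
      then show ?thesis by (simp add: h_def ux)
    next
      case (Cons i w)
      then have "i \<noteq> j" using v by auto
      moreover have "word_map v x \<in> strip i" using Cons branch_in_strip[OF pos[of w], of i] by simp
      ultimately have "word_map v x \<notin> strip j" using disjoint_strip by blast
      then show ?thesis by (simp add: h_def)
    qed
  qed auto
  also have "\<dots> = (\<integral>\<^sup>+v. h (j # v) \<partial>count_space UNIV)"
    by (rule nn_integral_bij_count_space[symmetric]) (simp add: bij_betw_def)
  also have "\<dots> = (\<integral>\<^sup>+v. ennreal (weight v x powr (- \<beta>)) * u (word_map v x) \<partial>count_space UNIV)"
  proof (intro nn_integral_cong)
    fix v
    let ?b = "branch j (word_map v x)"
    have b: "0 < cmod ?b"
      using halfplaneD(2)[OF branch_in_halfplane[OF word_map_halfplane[OF x, of v], of j]] q_gt_1 by linarith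
    have "weight (j # v) x powr (- \<beta>) * cmod ?b powr \<beta> = weight v x powr (- \<beta>)"
      using b weight_pos[OF x, of v] by (simp add: powr_mult powr_minus)
    then have "ennreal (weight (j # v) x powr (- \<beta>)) * ennreal (cmod ?b powr \<beta>) = ennreal (weight v x powr (- \<beta>))"
      by (simp add: ennreal_mult[symmetric])
    moreover have "h (j # v) = (ennreal (weight (j # v) x powr (- \<beta>)) * ennreal (cmod ?b powr \<beta>)) * u (word_map v x)"
      using branch_in_strip[OF pos[of v], of j] E_branch_halfplane[OF word_map_halfplane[OF x, of v], of j]
      by (simp add: h_def mult_ac)
    ultimately show "h (j # v) = ennreal (weight v x powr (- \<beta>)) * u (word_map v x)" by simp
  qed
  also have "\<dots> = (\<integral>\<^sup>+z. u z \<partial>orbit_measure \<beta> x)" by (rule nn_integral_orbit_measure[OF u, symmetric])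
  finally show ?thesis .
qed


text \<open>On the real axis to the right of q, the map E moves points to the right. So as x tends
  to infinity, the image of the exceptional point leaves every ball.\<close>

lemma q_le_E_real: "q \<le> x \<Longrightarrow> \<exists>y. E (of_real x) = of_real y \<and> x \<le> y"
proof -
  assume x: "q \<le> x"
  have "x - q \<le> q * (x - q)" using x q_gt_1 by (simp add: mult_le_cancel_right1)
  then have "x \<le> q * (1 + (x - q))" by (simp add: algebra_simps)
  also have "\<dots> \<le> q * exp (x - q)" using q_gt_1 by (intro mult_left_mono exp_ge_add_one_self) auto
  also have "\<dots> = l * exp q * exp (x - q)" by (simp add: fixed_point)
  also have "\<dots> = l * exp x" by (simp add: exp_add[symmetric])
  finally show ?thesis by (intro exI[of _ "l * exp x"]) (simp add: exp_map_def exp_of_real)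
qed

lemma continuous_on_E: "continuous_on S E"
  using continuous_on_iterate[of S 1] by simp

lemma borel_measurable_E [measurable]: "E \<in> borel_measurable borel"
  using continuous_on_E by (rule borel_measurable_continuous_onI)

lemma borel_strip [measurable]: "strip j \<in> sets borel" using open_strip by simp

lemma borel_J0 [measurable]: "J0 \<in> sets borel" using closed_J0 by simp

section \<open>Continuous test functions pulled back along a single branch\<close>

lemma continuous_on_branch: "continuous_on {z. 0 < Re z} (branch j)"
  unfolding branch_def
  by (intro continuous_intros) (use l_pos in \<open>auto simp: complex_nonpos_Reals_iff zero_less_divide_iff divide_le_0_iff\<close>)

text \<open>On the boundary of a strip E has real part 0, and a function composed with E would in
  general jump there when set to 0 outside the strip. The cutoff makes it vanish already near the
  boundary and is invisible on \<open>J0\<close>, where real parts exceed 1.\<close>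

definition cutoff :: "complex \<Rightarrow> real" where
  "cutoff w = min 1 (max 0 (2 * Re w - 1))"

lemma cutoff_props:
  "continuous_on UNIV cutoff" "0 \<le> cutoff w" "w \<in> J0 \<Longrightarrow> cutoff w = 1" "cutoff w \<noteq> 0 \<Longrightarrow> 1/2 < Re w"
proof -
  show "continuous_on UNIV cutoff" unfolding cutoff_def by (intro continuous_intros)
  show "0 \<le> cutoff w" "cutoff w \<noteq> 0 \<Longrightarrow> 1/2 < Re w" by (auto simp: cutoff_def max_def split: if_splits)
  assume "w \<in> J0"
  then have "1 \<le> Re w" using J0_halfplane halfplaneD(1) q_gt_1 by fastforce
  then show "cutoff w = 1" by (simp add: cutoff_def)
qed

definition branch_image :: "int \<Rightarrow> real \<Rightarrow> complex set" where
  "branch_image j R = branch j ` (cball 0 R \<inter> {z. 1/2 \<le> Re z})"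

lemma compact_branch_image: "compact (branch_image j R)"
  unfolding branch_image_def
proof (rule compact_continuous_image)
  show "continuous_on (cball 0 R \<inter> {z. 1/2 \<le> Re z}) (branch j)"
    by (rule continuous_on_subset[OF continuous_on_branch]) auto
  show "compact (cball (0::complex) R \<inter> {z. 1/2 \<le> Re z})"
    by (intro compact_Int_closed compact_cball) (rule closed_halfspace_Re_ge)
qed

lemma branch_image_subset_strip: "branch_image j R \<subseteq> strip j"
  unfolding branch_image_def by (auto intro!: branch_in_strip)

lemma in_branch_image: "z \<in> strip j \<Longrightarrow> 1/2 \<le> Re (E z) \<Longrightarrow> E z \<in> cball 0 R \<Longrightarrow> z \<in> branch_image j R"
  unfolding branch_image_def by (rule image_eqI[of _ _ "E z"]) (auto simp: branch_E)

definition pullback :: "int \<Rightarrow> (complex \<Rightarrow> real) \<Rightarrow> complex \<Rightarrow> real" where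
  "pullback j f z = (if z \<in> strip j then f (E z) * cutoff (E z) else 0)"

lemma pullback_support:
  assumes "\<And>z. f z \<noteq> 0 \<Longrightarrow> z \<in> cball 0 R" "pullback j f z \<noteq> 0"
  shows "z \<in> branch_image j R"
  using assms(2) cutoff_props(4)[of "E z"] assms(1)[of "E z"]
  by (intro in_branch_image) (auto simp: pullback_def split: if_splits)

lemma continuous_on_pullback:
  assumes f: "continuous_on UNIV f" and supp: "\<And>z. f z \<noteq> 0 \<Longrightarrow> z \<in> cball 0 R"
  shows "continuous_on UNIV (pullback j f)"
proof -
  let ?K = "branch_image j R"
  have "continuous_on (strip j) (pullback j f) \<longleftrightarrow> continuous_on (strip j) (\<lambda>z. f (E z) * cutoff (E z))"
    by (rule continuous_on_cong) (auto simp: pullback_def)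
  moreover have "continuous_on (strip j) (\<lambda>z. f (E z) * cutoff (E z))"
    by (intro continuous_on_mult continuous_on_compose2[OF f continuous_on_E]
        continuous_on_compose2[OF cutoff_props(1) continuous_on_E]) auto
  moreover have "continuous_on (- ?K) (pullback j f) \<longleftrightarrow> continuous_on (- ?K) (\<lambda>z. 0 :: real)"
    by (rule continuous_on_cong) (use pullback_support[OF supp] in auto)
  ultimately have "continuous_on (strip j \<union> - ?K) (pullback j f)"
    by (intro continuous_on_open_Un open_strip) (use compact_imp_closed[OF compact_branch_image] in auto)
  moreover have "strip j \<union> - ?K = UNIV" using branch_image_subset_strip by blast
  ultimately show ?thesis by simp
qed

text \<open>On \<open>J0\<close> the weight \<open>max 1 (cmod z)\<close> is \<open>cmod z\<close>; the maximum makes it continuous and at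
  least 1 everywhere.\<close>

lemma max_1_cmod_J0: "z \<in> J0 \<Longrightarrow> max 1 (cmod z) = cmod z"
  using halfplaneD(2)[OF J0_halfplane, of z] q_gt_1 by simp

lemma orbit_measure_pullback:
  assumes f: "continuous_on UNIV f" "\<And>z. 0 \<le> f z" and x: "x \<in> J0" and fx: "f (E x) = 0"
  shows "(\<integral>z. pullback j f z * max 1 (cmod z) powr \<beta> \<partial>scale_measure c (orbit_measure \<beta> x))
    = (\<integral>z. f z \<partial>scale_measure c (orbit_measure \<beta> x))"
proof -
  have [measurable]: "f \<in> borel_measurable borel" using f(1) by (rule borel_measurable_continuous_onI)
  have [measurable]: "cutoff \<in> borel_measurable borel" using cutoff_props(1) by (rule borel_measurable_continuous_onI)
  have [measurable]: "pullback j f \<in> borel_measurable borel" unfolding pullback_def by measurable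
  have nn: "0 \<le> pullback j f z" for z using f(2) cutoff_props(2) by (simp add: pullback_def)
  have "(\<integral>\<^sup>+z. ennreal (pullback j f z * max 1 (cmod z) powr \<beta>) \<partial>orbit_measure \<beta> x)
      = (\<integral>\<^sup>+z. indicator (strip j) z * (ennreal (f (E z)) * ennreal (cmod z powr \<beta>)) \<partial>orbit_measure \<beta> x)"
  proof (rule nn_integral_cong_AE, rule AE_mp[OF AE_orbit_measure_J0[OF x]], intro AE_I2 impI)
    fix z assume z: "z \<in> J0"
    then show "ennreal (pullback j f z * max 1 (cmod z) powr \<beta>)
      = indicator (strip j) z * (ennreal (f (E z)) * ennreal (cmod z powr \<beta>))"
      using cutoff_props(3)[OF J0_E[OF z]] f(2) max_1_cmod_J0[OF z]
      by (simp add: pullback_def indicator_def ennreal_mult)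
  qed
  also have "\<dots> = (\<integral>\<^sup>+z. ennreal (f z) \<partial>orbit_measure \<beta> x)"
    by (rule orbit_measure_conformal) (use J0_halfplane[OF x] fx in auto)
  finally show ?thesis
    using nn f(2) by (simp add: integral_eq_nn_integral nn_integral_scale_measure)
qed

end

lemma integral_compact_support_integrable:
  fixes f :: "complex \<Rightarrow> real"
  assumes "sets M = sets borel" "\<And>R. emeasure M (cball 0 R) < \<infinity>"
    and f: "continuous_on UNIV f" "\<And>z. f z \<noteq> 0 \<Longrightarrow> z \<in> cball 0 R"
  shows "integrable M f"
proof -
  have "bounded (f ` cball 0 R)"
    by (intro compact_imp_bounded compact_continuous_image continuous_on_subset[OF f(1)]) auto
  then obtain B where B: "\<And>z. z \<in> cball 0 R \<Longrightarrow> norm (f z) \<le> B" unfolding bounded_iff by blast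
  have [measurable_cong]: "sets M = sets borel" by (rule assms)
  have [measurable]: "f \<in> borel_measurable borel" using f(1) by (rule borel_measurable_continuous_onI)
  show ?thesis
  proof (rule Bochner_Integration.integrable_bound)
    show "integrable M (\<lambda>z. B * indicator (cball 0 R) z)"
      using assms(1,2) by (intro integrable_mult_right) (simp add: integrable_indicator_iff)
    show "AE z in M. norm (f z) \<le> norm (B * indicator (cball 0 R) z)"
    proof (intro AE_I2)
      fix z
      show "norm (f z) \<le> norm (B * indicator (cball 0 R) z)"
        using B[of z] f(2)[of z] by (cases "z \<in> cball 0 R") auto
    qed
  qed simp
qed

context exp_dynamics
begin

section \<open>The vague limit of the normalised orbit measures\<close>

lemma exists_limit_measure:
  assumes dim: "hausdorff_dim (radial_julia_set E) \<le> ereal \<beta>"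
  obtains M where "sets M = sets borel" "\<And>R. emeasure M (cball 0 R) < \<infinity>"
    "emeasure M (- J0) = 0" "emeasure M J0 \<noteq> 0"
    "\<And>j f R. continuous_on UNIV f \<Longrightarrow> (\<And>z. 0 \<le> f z) \<Longrightarrow> (\<And>z. f z \<noteq> 0 \<Longrightarrow> z \<in> cball 0 R) \<Longrightarrow>
       (\<integral>z. pullback j f z * max 1 (cmod z) powr \<beta> \<partial>M) = (\<integral>z. f z \<partial>M)"
proof -
  \<comment> \<open>Exponents strictly above \<beta> make the word series converge even if \<beta>
    equals the dimension.\<close>
  define b where "b k = \<beta> + 1 / real (Suc k)" for k
  define x where "x k = complex_of_real (q + real k)" for k
  have \<beta>: "0 \<le> \<beta>" by (rule hausdorff_dim_le_nonneg[OF dim])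
  have b: "0 \<le> b k" "\<beta> \<le> b k" "b k \<le> \<beta> + 1" for k using \<beta> by (auto simp: b_def)
  have dimb: "hausdorff_dim (radial_julia_set E) < ereal (b k)" for k
    by (rule le_less_trans[OF dim]) (simp add: b_def)
  have xJ: "x k \<in> J0" for k unfolding x_def by (rule real_in_J0) simp
  have xH: "x k \<in> halfplane" for k using xJ J0_halfplane by blast
  have Ex: "real k < cmod (E (x k))" for k
  proof -
    obtain y where "E (x k) = of_real y" "q + real k \<le> y"
      using q_le_E_real[of "q + real k"] unfolding x_def by auto
    then show ?thesis using q_gt_1 by simp
  qed
  define om where "om k = orbit_measure (b k) (x k)" for k
  define T where "T k = emeasure (om k) (cball q 1)" for k
  have T: "0 < T k" "T k < \<infinity>" for k
    unfolding T_def om_def using orbit_measure_pos[OF xH b(1)] orbit_measure_finite[OF dimb xH] by auto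
  \<comment> \<open>The unit ball around q gets mass 1. This fixes the scale for all other balls and
    prevents the limit from being 0.\<close>
  define \<mu> where "\<mu> k = scale_measure (1 / T k) (om k)" for k
  have sets: "sets (\<mu> k) = sets borel" for k by (simp add: \<mu>_def om_def)
  note [measurable_cong] = sets
  have \<mu>1: "emeasure (\<mu> k) (cball q 1) = 1" for k
    using T[of k] by (simp add: \<mu>_def T_def[symmetric] ennreal_divide_times divide_eq_1_ennreal less_top[symmetric])
  have bound: "\<exists>C. \<forall>k. emeasure (\<mu> k) (cball 0 R) \<le> ennreal C" for R :: real
  proof -
    define R' where "R' = \<bar>R\<bar> + q"
    have R': "0 \<le> R'" "cball 0 R \<subseteq> cball (complex_of_real q) R'"
    proof -
      show "0 \<le> R'" using q_gt_1 by (simp add: R'_def)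
      show "cball 0 R \<subseteq> cball (complex_of_real q) R'"
      proof
        fix z :: complex assume "z \<in> cball 0 R"
        then show "z \<in> cball (of_real q) R'"
          using norm_triangle_ineq4[of "of_real q" z] q_gt_1 by (simp add: R'_def dist_norm)
      qed
    qed
    obtain n where n: "R' \<le> q ^ n" using real_arch_pow[OF q_gt_1] less_imp_le by blast
    define A where "A = (q + R') ^ n"
    have A: "1 \<le> A" unfolding A_def using q_gt_1 R' by (intro one_le_power) simp
    have "emeasure (\<mu> k) (cball 0 R) \<le> ennreal (A powr (\<beta> + 1))" for k
    proof -
      have "emeasure (om k) (cball q R') \<le> ennreal (A powr b k) * T k"
        unfolding om_def A_def T_def by (rule orbit_measure_cball_le[OF xH b(1) n R'(1)])
      then have "emeasure (\<mu> k) (cball q R') \<le> 1 / T k * (ennreal (A powr b k) * T k)"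
        unfolding \<mu>_def by (simp add: mult_left_mono)
      also have "\<dots> = ennreal (A powr b k)"
        using T[of k] by (simp add: mult.commute[of _ "T k"] mult.assoc[symmetric] ennreal_times_divide ennreal_divide_times divide_eq_1_ennreal ennreal_mult_divide_eq less_top[symmetric])
      \<comment> \<open>The exponents stay below \<beta> + 1 and \<open>A\<close> is at least 1, so
        the bound is uniform in k.\<close>
      also have "\<dots> \<le> ennreal (A powr (\<beta> + 1))" using A b(3) by (intro ennreal_leI powr_mono) auto
      finally show ?thesis
        using emeasure_mono[OF R'(2), of "\<mu> k"] by (simp add: sets)
    qed
    then show ?thesis by blast
  qed
  have low: "ennreal 1 \<le> emeasure (\<mu> k) (cball 0 (q + 1))" for k
  proof -
    have "cball (of_real q) 1 \<subseteq> cball (0::complex) (q + 1)"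
    proof
      fix z :: complex assume "z \<in> cball (of_real q) 1"
      then show "z \<in> cball 0 (q + 1)"
        using norm_triangle_sub[of z "of_real q"] q_gt_1 by (simp add: dist_norm norm_minus_commute)
    qed
    from emeasure_mono[OF this, of "\<mu> k"] show ?thesis by (simp add: \<mu>1 sets)
  qed
  obtain r M where r: "strict_mono (r :: nat \<Rightarrow> nat)" and M: "sets M = sets borel"
    "\<And>R. emeasure M (cball 0 R) < \<infinity>"
    and lim: "\<And>R (f :: complex \<Rightarrow> real). continuous_on UNIV f \<Longrightarrow> (\<And>z. f z \<noteq> 0 \<Longrightarrow> z \<in> cball 0 R) \<Longrightarrow>
       (\<lambda>k. \<integral>z. f z \<partial>\<mu> (r k)) \<longlonglongrightarrow> (\<integral>z. f z \<partial>M)"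
    using vague_sequentially_compact[of \<mu> 1 "q + 1", OF sets bound zero_less_one low] by blast
  note [measurable_cong] = M(1)
  have spM: "space M = UNIV" using M(1) by (metis sets_eq_imp_space_eq space_borel)
  have fin\<mu>: "emeasure (\<mu> k) (cball 0 R) < \<infinity>" for k R
    using bound[of R] by (metis ennreal_less_top infinity_ennreal_def le_less_trans)
  have AE\<mu>: "AE z in \<mu> k. z \<in> J0" for k
  proof -
    have "- J0 \<in> sets borel" by simp
    have "emeasure (om k) (- J0) = 0"
      using word_map_J0[OF xJ] by (simp add: om_def emeasure_orbit_measure)
    then show ?thesis by (intro AE_I[of _ _ "- J0"]) (auto simp: \<mu>_def om_def)
  qed
  have null: "emeasure M (- J0) = 0"
  proof -
    have "emeasure M {z. cmod z < R \<and> z \<notin> J0} = 0" for R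
    proof -
      \<comment> \<open>This function is positive exactly at the points of the ball that lie outside
        \<open>J0\<close>. Its integral is 0 for every orbit measure, hence for the limit.\<close>
      define g where "g z = min 1 (infdist z J0) * max 0 (R - cmod z)" for z
      have J0ne: "J0 \<noteq> {}" using xJ by blast
      have gc: "continuous_on UNIV g" unfolding g_def by (intro continuous_intros)
      have gs: "z \<in> cball 0 R" if "g z \<noteq> 0" for z using that by (auto simp: g_def max_def split: if_splits)
      have g0: "0 \<le> g z" for z by (simp add: g_def infdist_nonneg)
      have "(\<integral>z. g z \<partial>\<mu> k) = 0" for k
        by (rule integral_eq_zero_AE, rule AE_mp[OF AE\<mu>]) (auto simp: g_def)
      then have "(\<integral>z. g z \<partial>M) = 0" using lim[OF gc gs] by (simp add: LIMSEQ_const_iff)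
      then have "AE z in M. g z = 0"
        using integral_nonneg_eq_0_iff_AE[OF integral_compact_support_integrable[OF M gc gs]] g0 by simp
      moreover have "{z \<in> space M. g z \<noteq> 0} = {z. cmod z < R \<and> z \<notin> J0}"
      proof -
        have "infdist z J0 = 0 \<longleftrightarrow> z \<in> J0" for z
          using in_closed_iff_infdist_zero[OF closed_J0 J0ne] by simp
        then have "min 1 (infdist z J0) = 0 \<longleftrightarrow> z \<in> J0" for z by (auto simp: min_def split: if_splits)
        then show ?thesis using spM by (auto simp: g_def)
      qed
      moreover have "g \<in> borel_measurable borel" using gc by (rule borel_measurable_continuous_onI)
      ultimately show ?thesis using AE_iff_measurable[of "{z. cmod z < R \<and> z \<notin> J0}" M "\<lambda>z. g z = 0"] M(1)
        by simp
    qed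
    then have "{z. cmod z < real n \<and> z \<notin> J0} \<in> null_sets M" for n
      by (intro null_setsI) (auto simp: M(1))
    then have "(\<Union>n. {z. cmod z < real n \<and> z \<notin> J0}) \<in> null_sets M" by (intro null_sets_UN) auto
    moreover have "(\<Union>n. {z. cmod z < real n \<and> z \<notin> J0}) = - J0" using reals_Archimedean2 by auto
    ultimately show ?thesis by auto
  qed
  show thesis
  proof (rule that[OF M null])
    show "emeasure M J0 \<noteq> 0"
    proof
      assume "emeasure M J0 = 0"
      with null have "J0 \<union> - J0 \<in> null_sets M" by (intro null_sets.Un null_setsI) (auto simp: M(1))
      then have z: "AE z in M. False" by (intro AE_I[of _ _ UNIV]) (auto simp: M(1))
      \<comment> \<open>This function equals 1 on the ball of radius q + 1, which contains the unit
        ball around q, so its integrals are at least 1 before the limit.\<close>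
      define g where "g z = max 0 (min 1 (q + 2 - cmod z))" for z :: complex
      have gc: "continuous_on UNIV g" unfolding g_def by (intro continuous_intros)
      have gs: "z \<in> cball 0 (q + 2)" if "g z \<noteq> 0" for z using that by (auto simp: g_def max_def split: if_splits)
      have "(\<integral>z. g z \<partial>M) = 0" by (rule integral_eq_zero_AE, rule AE_mp[OF z]) auto
      moreover have "1 \<le> (\<integral>z. g z \<partial>\<mu> k)" for k
      proof -
        have "1 \<le> measure (\<mu> k) (cball 0 (q + 1))"
          using low[of k] fin\<mu>[of k "q + 1"] by (simp add: emeasure_eq_ennreal_measure less_top[symmetric])
        also have "\<dots> = (\<integral>z. indicator (cball 0 (q + 1)) z \<partial>\<mu> k)" by (simp add: sets)
        also have "\<dots> \<le> (\<integral>z. g z \<partial>\<mu> k)"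
        proof (rule integral_mono)
          show "integrable (\<mu> k) (indicator (cball 0 (q + 1)) :: complex \<Rightarrow> real)"
            using fin\<mu>[of k "q + 1"] by (simp add: integrable_indicator_iff sets)
          show "integrable (\<mu> k) g" by (rule integral_compact_support_integrable[OF sets fin\<mu> gc gs])
        qed (auto simp: g_def indicator_def)
        finally show ?thesis .
      qed
      ultimately show False using LIMSEQ_le_const[OF lim[OF gc gs], of 1] by auto
    qed
  next
    fix j R and f :: "complex \<Rightarrow> real"
    assume f: "continuous_on UNIV f" "\<And>z. 0 \<le> f z" "\<And>z. f z \<noteq> 0 \<Longrightarrow> z \<in> cball 0 R"
    define F where "F z = pullback j f z * max 1 (cmod z) powr \<beta>" for z
    obtain P where P: "\<And>z. z \<in> branch_image j R \<Longrightarrow> cmod z \<le> P"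
      using compact_imp_bounded[OF compact_branch_image] unfolding bounded_iff by blast
    define P' where "P' = max 1 P"
    have nn: "0 \<le> pullback j f z" for z using f(2) cutoff_props(2) by (simp add: pullback_def)
    have pc: "continuous_on UNIV (pullback j f)" by (rule continuous_on_pullback[OF f(1,3)])
    have Fc: "continuous_on UNIV F" unfolding F_def by (intro continuous_intros pc) auto
    have ps: "z \<in> cball 0 P'" if "pullback j f z \<noteq> 0" for z
      using P[OF pullback_support[OF f(3) that]] by (simp add: P'_def)
    have Fs: "z \<in> cball 0 P'" if "F z \<noteq> 0" for z using ps that by (auto simp: F_def)
    let ?p = "\<lambda>k. P' powr (1 / real (Suc (r k)))"
    \<comment> \<open>The identity for \<open>\<mu> (r k)\<close> holds with the exponent
      \<open>b (r k)\<close> in place of \<beta>. On the support of the pullback, where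
      \<open>max 1 (cmod z)\<close> lies between 1 and \<open>P'\<close>, the two powers differ by a
      factor between 1 and \<open>?p k\<close>, and the latter tends to 1.\<close>
    have Fk: "\<forall>\<^sub>F k in sequentially. (\<integral>z. F z \<partial>\<mu> (r k)) \<le> (\<integral>z. f z \<partial>\<mu> (r k)) \<and>
       (\<integral>z. f z \<partial>\<mu> (r k)) \<le> ?p k * (\<integral>z. F z \<partial>\<mu> (r k))"
    proof -
      obtain N where N: "R \<le> real N" using real_arch_simple by blast
      show ?thesis unfolding eventually_sequentially
      proof (intro exI[of _ N] allI impI)
        fix k assume "N \<le> k"
        moreover have "k \<le> r k" using r by (rule seq_suble)
        ultimately have "R < cmod (E (x (r k)))" using Ex[of "r k"] N by linarith
        \<comment> \<open>From index N on, the image of the exceptional point lies outside the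
          support of f.\<close>
        then have f0: "f (E (x (r k))) = 0" using f(3)[of "E (x (r k))"] by auto
        let ?G = "\<lambda>z. pullback j f z * max 1 (cmod z) powr b (r k)"
        have eq: "(\<integral>z. f z \<partial>\<mu> (r k)) = (\<integral>z. ?G z \<partial>\<mu> (r k))"
          unfolding \<mu>_def om_def by (rule orbit_measure_pullback[OF f(1,2) xJ f0, symmetric])
        have iF: "integrable (\<mu> (r k)) F" by (rule integral_compact_support_integrable[OF sets fin\<mu> Fc Fs])
        have iG: "integrable (\<mu> (r k)) ?G"
        proof (rule integral_compact_support_integrable[OF sets fin\<mu>])
          show "continuous_on UNIV ?G" by (intro continuous_intros pc) auto
          show "z \<in> cball 0 P'" if "?G z \<noteq> 0" for z using ps that by auto
        qed
        have "F z \<le> ?G z" for z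
          unfolding F_def using b(2) nn by (intro mult_left_mono powr_mono) auto
        then have 1: "(\<integral>z. F z \<partial>\<mu> (r k)) \<le> (\<integral>z. ?G z \<partial>\<mu> (r k))" by (intro integral_mono iF iG)
        have "?G z \<le> ?p k * F z" for z
        proof (cases "pullback j f z = 0")
          case False
          then have "max 1 (cmod z) \<le> P'" using ps[OF False] by (simp add: P'_def)
          then have "max 1 (cmod z) powr (1 / real (Suc (r k))) \<le> ?p k"
            by (intro powr_mono2) auto
          then have "pullback j f z * max 1 (cmod z) powr \<beta> * max 1 (cmod z) powr (1 / real (Suc (r k)))
             \<le> pullback j f z * max 1 (cmod z) powr \<beta> * ?p k"
            using nn by (intro mult_left_mono) auto
          moreover have "max 1 (cmod z) powr b (r k) = max 1 (cmod z) powr \<beta> * max 1 (cmod z) powr (1 / real (Suc (r k)))"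
            unfolding b_def by (rule powr_add)
          ultimately show ?thesis by (simp add: F_def mult_ac)
        qed (simp add: F_def)
        then have "(\<integral>z. ?G z \<partial>\<mu> (r k)) \<le> (\<integral>z. ?p k * F z \<partial>\<mu> (r k))"
          by (intro integral_mono integrable_mult_right iF iG)
        with 1 eq show "(\<integral>z. F z \<partial>\<mu> (r k)) \<le> (\<integral>z. f z \<partial>\<mu> (r k)) \<and>
           (\<integral>z. f z \<partial>\<mu> (r k)) \<le> ?p k * (\<integral>z. F z \<partial>\<mu> (r k))" by simp
      qed
    qed
    have limF: "(\<lambda>k. \<integral>z. F z \<partial>\<mu> (r k)) \<longlonglongrightarrow> (\<integral>z. F z \<partial>M)" by (rule lim[OF Fc Fs])
    have limf: "(\<lambda>k. \<integral>z. f z \<partial>\<mu> (r k)) \<longlonglongrightarrow> (\<integral>z. f z \<partial>M)" by (rule lim[OF f(1,3)])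
    have "(\<lambda>k. P' powr (1 / real (Suc k))) \<longlonglongrightarrow> P' powr 0"
      by (intro tendsto_powr tendsto_const LIMSEQ_Suc[OF lim_1_over_n]) (simp add: P'_def)
    then have "(\<lambda>k. ?p k) \<longlonglongrightarrow> P' powr 0"
      using LIMSEQ_subseq_LIMSEQ[OF _ r] by (auto simp: o_def)
    then have limP: "(\<lambda>k. ?p k * (\<integral>z. F z \<partial>\<mu> (r k))) \<longlonglongrightarrow> P' powr 0 * (\<integral>z. F z \<partial>M)"
      by (intro tendsto_mult limF)
    have "(\<integral>z. F z \<partial>M) \<le> (\<integral>z. f z \<partial>M)"
      by (rule tendsto_le[OF _ limf limF]) (use Fk in \<open>auto elim: eventually_mono\<close>)
    moreover have "(\<integral>z. f z \<partial>M) \<le> P' powr 0 * (\<integral>z. F z \<partial>M)"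
      by (rule tendsto_le[OF _ limP limf]) (use Fk in \<open>auto elim: eventually_mono\<close>)
    moreover have "P' powr 0 = 1" by (simp add: P'_def)
    ultimately show "(\<integral>z. pullback j f z * max 1 (cmod z) powr \<beta> \<partial>M) = (\<integral>z. f z \<partial>M)"
      unfolding F_def by simp
  qed
qed


section \<open>From test functions to Borel sets\<close>

lemma AE_J0I:
  assumes "sets M = sets borel" "emeasure M (- J0) = 0"
  shows "AE z in M. z \<in> J0"
  by (rule AE_I[of _ _ "- J0"]) (use assms in auto)

text \<open>Every strip alone reproduces the whole measure, because E maps the part of
  \<open>J0\<close> in it onto \<open>J0\<close>. Both sides are locally finite and agree on test
  functions; almost everywhere the cutoff and the maximum with 1 disappear.\<close>

lemma measure_eq_distr_branch:
  assumes M: "sets M = sets borel" "\<And>R. emeasure M (cball 0 R) < \<infinity>"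
    and null: "emeasure M (- J0) = 0" and \<beta>: "0 \<le> \<beta>"
    and eq: "\<And>f R. continuous_on UNIV f \<Longrightarrow> (\<And>z. 0 \<le> f z) \<Longrightarrow> (\<And>z. f z \<noteq> 0 \<Longrightarrow> z \<in> cball 0 R) \<Longrightarrow>
       (\<integral>z. pullback j f z * max 1 (cmod z) powr \<beta> \<partial>M) = (\<integral>z. f z \<partial>M)"
  shows "M = distr (density M (\<lambda>z. indicator (strip j \<inter> J0) z * ennreal (cmod z powr \<beta>))) borel E"
    (is "M = ?N")
proof (rule borel_measure_eqI_integral)
  note [measurable_cong] = M(1)
  let ?d = "\<lambda>z. indicator (strip j \<inter> J0) z * ennreal (cmod z powr \<beta>)"
  have AEM: "AE z in M. z \<in> J0" by (rule AE_J0I[OF M(1) null])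
  show "sets M = sets borel" "sets ?N = sets borel" "\<And>R. emeasure M (cball 0 R) < \<infinity>"
    using M by simp_all
  have nnN: "(\<integral>\<^sup>+z. u z \<partial>?N) = (\<integral>\<^sup>+z. ?d z * u (E z) \<partial>M)"
    if [measurable]: "u \<in> borel_measurable borel" for u
    by (subst nn_integral_distr, simp, simp, subst nn_integral_density) simp_all
  show "emeasure ?N (cball 0 R) < \<infinity>" for R
  proof -
    obtain P where P: "\<And>z. z \<in> branch_image j R \<Longrightarrow> cmod z \<le> P"
      using compact_imp_bounded[OF compact_branch_image] unfolding bounded_iff by blast
    have "emeasure ?N (cball 0 R) = (\<integral>\<^sup>+z. indicator (cball 0 R) z \<partial>?N)" by simp
    also have "\<dots> = (\<integral>\<^sup>+z. ?d z * indicator (cball 0 R) (E z) \<partial>M)"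
      by (rule nnN, rule borel_measurable_indicator) simp
    also have "\<dots> \<le> (\<integral>\<^sup>+z. ennreal (P powr \<beta>) * indicator (cball 0 P) z \<partial>M)"
    proof (rule nn_integral_mono)
      fix z
      show "?d z * indicator (cball 0 R) (E z)
        \<le> ennreal (P powr \<beta>) * indicator (cball 0 P) z"
      proof (cases "z \<in> strip j \<and> z \<in> J0 \<and> E z \<in> cball 0 R")
        case True
        then have "1/2 \<le> Re (E z)" using halfplaneD(1)[OF J0_halfplane[OF J0_E]] q_gt_1 by fastforce
        then have "cmod z \<le> P" using P in_branch_image True by blast
        then show ?thesis using \<beta> True by (auto simp: indicator_def intro!: ennreal_leI powr_mono2)
      qed (auto simp: indicator_def)
    qed
    also have "\<dots> = ennreal (P powr \<beta>) * emeasure M (cball 0 P)"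
      by (rule nn_integral_cmult_indicator) (simp add: M)
    also have "\<dots> < \<infinity>" using M(2)[of P] by (simp add: ennreal_mult_less_top)
    finally show ?thesis .
  qed
  fix f :: "complex \<Rightarrow> real" and R
  assume f: "continuous_on UNIV f" "\<And>z. 0 \<le> f z" "\<And>z. f z \<noteq> 0 \<Longrightarrow> z \<in> cball 0 R"
  have [measurable]: "f \<in> borel_measurable borel" using f(1) by (rule borel_measurable_continuous_onI)
  have [measurable]: "pullback j f \<in> borel_measurable borel"
    using continuous_on_pullback[OF f(1,3)] by (rule borel_measurable_continuous_onI)
  have nn: "0 \<le> pullback j f z" for z using f(2) cutoff_props(2) by (simp add: pullback_def)
  have "(\<integral>\<^sup>+z. ennreal (f z) \<partial>?N) = (\<integral>\<^sup>+z. ?d z * ennreal (f (E z)) \<partial>M)"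
    by (rule nnN) simp
  also have "\<dots> = (\<integral>\<^sup>+z. ennreal (pullback j f z * max 1 (cmod z) powr \<beta>) \<partial>M)"
  proof (rule nn_integral_cong_AE, rule AE_mp[OF AEM], intro AE_I2 impI)
    fix z assume z: "z \<in> J0"
    then show "?d z * ennreal (f (E z))
        = ennreal (pullback j f z * max 1 (cmod z) powr \<beta>)"
      using cutoff_props(3)[OF J0_E[OF z]] f(2) max_1_cmod_J0[OF z]
      by (simp add: pullback_def indicator_def ennreal_mult mult.commute)
  qed
  finally have "(\<integral>z. f z \<partial>?N) = (\<integral>z. pullback j f z * max 1 (cmod z) powr \<beta> \<partial>M)"
    using nn f(2) by (simp add: integral_eq_nn_integral)
  then show "(\<integral>z. f z \<partial>M) = (\<integral>z. f z \<partial>?N)" using eq[OF f] by simp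
qed

text \<open>This turns a forward image into a preimage under a continuous branch, which makes it
  Borel.\<close>

lemma E_image_strip:
  assumes "A \<subseteq> J0"
  shows "E ` (A \<inter> strip j) = {w. 0 < Re w} \<inter> branch j -` A"
proof (intro set_eqI iffI)
  fix w assume "w \<in> E ` (A \<inter> strip j)"
  then obtain z where z: "z \<in> A" "z \<in> strip j" "w = E z" by blast
  then have "w \<in> halfplane" using assms J0_E J0_halfplane by blast
  then show "w \<in> {w. 0 < Re w} \<inter> branch j -` A"
    using z branch_E[OF z(2)] halfplaneD(1)[of w] q_gt_1 by auto
next
  fix w assume w: "w \<in> {w. 0 < Re w} \<inter> branch j -` A"
  then have "E (branch j w) = w" by (intro E_branch) auto
  moreover have "branch j w \<in> A \<inter> strip j" using w branch_in_strip by auto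
  ultimately show "w \<in> E ` (A \<inter> strip j)" by (metis image_eqI)
qed

lemma borel_E_image_strip:
  assumes "A \<subseteq> J0" "A \<in> sets borel" shows "E ` (A \<inter> strip j) \<in> sets borel"
proof -
  have "{w. 0 < Re w} \<in> sets (borel :: complex measure)"
    using open_halfspace_Re_gt[of 0] by simp
  moreover have "branch j \<in> borel_measurable (restrict_space borel {w. 0 < Re w})"
    by (rule borel_measurable_continuous_on_restrict[OF continuous_on_branch])
  then have "branch j -` A \<inter> space (restrict_space borel {w. 0 < Re w}) \<in> sets (restrict_space borel {w. 0 < Re w})"
    using assms(2) by (rule measurable_sets)
  ultimately show ?thesis
    unfolding E_image_strip[OF assms(1)] by (simp add: sets_restrict_space_iff space_restrict_space Int_commute)
qed

lemma UN_strip: "A \<subseteq> J0 \<Longrightarrow> A = (\<Union>j. A \<inter> strip j)"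
proof -
  assume A: "A \<subseteq> J0"
  have "\<exists>j. z \<in> strip j" if "z \<in> A" for z
  proof -
    have "0 < Re (E z)" using halfplaneD(1)[OF J0_halfplane[OF J0_E]] A that q_gt_1 by fastforce
    then show ?thesis using in_some_strip by blast
  qed
  then show ?thesis by blast
qed

theorem exists_conformal_measure:
  assumes dim: "hausdorff_dim (radial_julia_set E) \<le> ereal \<beta>"
  shows "\<exists>m. conformal_measure E (julia_set E) (\<lambda>z. \<beta> * ln (cmod z)) m"
proof -
  have \<beta>: "0 \<le> \<beta>" by (rule hausdorff_dim_le_nonneg[OF dim])
  obtain M where M: "sets M = sets borel" "\<And>R. emeasure M (cball 0 R) < \<infinity>"
    and null: "emeasure M (- J0) = 0" and pos: "emeasure M J0 \<noteq> 0"
    and eq: "\<And>j f R. continuous_on UNIV f \<Longrightarrow> (\<And>z. 0 \<le> f z) \<Longrightarrow> (\<And>z. f z \<noteq> 0 \<Longrightarrow> z \<in> cball 0 R) \<Longrightarrow>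
       (\<integral>z. pullback j f z * max 1 (cmod z) powr \<beta> \<partial>M) = (\<integral>z. f z \<partial>M)"
    using exists_limit_measure[OF dim] by blast
  note [measurable_cong] = M(1)
  have spM: "space M = UNIV" using M(1) by (metis sets_eq_imp_space_eq space_borel)
  define m where "m = restrict_space M J0"
  have em: "emeasure m A = emeasure M A" if "A \<subseteq> J0" for A
    unfolding m_def using that spM by (intro emeasure_restrict_space) (auto simp: M)
  have branch_eq: "emeasure M (E ` (A \<inter> strip j)) = (\<integral>\<^sup>+z. ennreal (cmod z powr \<beta>) * indicator (A \<inter> strip j) z \<partial>M)"
    if A: "A \<subseteq> J0" "A \<in> sets borel" for A j
  proof -
    let ?d = "\<lambda>z. indicator (strip j \<inter> J0) z * ennreal (cmod z powr \<beta>)"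
    have im: "E ` (A \<inter> strip j) \<in> sets borel" by (rule borel_E_image_strip[OF A])
    have "emeasure M (E ` (A \<inter> strip j)) = emeasure (distr (density M ?d) borel E) (E ` (A \<inter> strip j))"
      by (subst measure_eq_distr_branch[OF M null \<beta> eq]) auto
    also have "\<dots> = emeasure (density M ?d) (E -` (E ` (A \<inter> strip j)))"
      using im spM by (subst emeasure_distr) auto
    also have "\<dots> = (\<integral>\<^sup>+z. ?d z * indicator (E -` (E ` (A \<inter> strip j))) z \<partial>M)"
      using im measurable_sets[OF borel_measurable_E im] by (intro emeasure_density) (auto simp: M)
    also have "\<dots> = (\<integral>\<^sup>+z. ennreal (cmod z powr \<beta>) * indicator (A \<inter> strip j) z \<partial>M)"
    proof (intro nn_integral_cong)
      fix z
      have "z \<in> E -` (E ` (A \<inter> strip j)) \<longleftrightarrow> z \<in> A" if "z \<in> strip j"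
        using that branch_E by (auto, metis)
      then show "?d z * indicator (E -` (E ` (A \<inter> strip j))) z = ennreal (cmod z powr \<beta>) * indicator (A \<inter> strip j) z"
        using A(1) by (auto simp: indicator_def)
    qed
    finally show ?thesis .
  qed
  have "conformal_measure E J0 (\<lambda>z. \<beta> * ln (cmod z)) m"
    unfolding conformal_measure_def
  proof (intro conjI ballI impI)
    show "regular_borel_measure_on J0 m"
      unfolding m_def by (rule regular_borel_measure_on_restrict_space[OF M]) simp
    show "emeasure m J0 \<noteq> 0" using pos by (simp add: em)
    fix A assume "A \<in> sets m" and inj: "inj_on E A"
    then have A: "A \<subseteq> J0" "A \<in> sets borel" by (auto simp: m_def sets_restrict_space M)
    define W where "W = density M (\<lambda>z. ennreal (cmod z powr \<beta>))"
    have [measurable_cong]: "sets W = sets borel" by (simp add: W_def M)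
    have "E ` A = (\<Union>j. E ` (A \<inter> strip j))" using UN_strip[OF A(1)] by blast
    then have "emeasure m (E ` A) = emeasure M (\<Union>j. E ` (A \<inter> strip j))"
      using em[of "E ` A"] A(1) J0_E by auto
    also have "emeasure M (\<Union>j. E ` (A \<inter> strip j)) = (\<integral>\<^sup>+j. emeasure M (E ` (A \<inter> strip j)) \<partial>count_space UNIV)"
    proof (rule emeasure_UN_countable)
      show "E ` (A \<inter> strip j) \<in> sets M" for j using borel_E_image_strip[OF A] by (simp add: M)
      \<comment> \<open>Within one strip E is injective anyway. Injectivity on all of
        \<open>A\<close> is used here, to keep the images of pieces from different strips
        apart.\<close>
      show "disjoint_family (\<lambda>j. E ` (A \<inter> strip j))"
        unfolding disjoint_family_on_def
      proof (intro ballI impI)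
        fix i j :: int assume "i \<noteq> j"
        show "E ` (A \<inter> strip i) \<inter> E ` (A \<inter> strip j) = {}"
        proof (rule ccontr)
          assume "E ` (A \<inter> strip i) \<inter> E ` (A \<inter> strip j) \<noteq> {}"
          then obtain z w where "z \<in> A" "z \<in> strip i" "w \<in> A" "w \<in> strip j" "E z = E w" by blast
          then have "z = w" using inj by (simp add: inj_on_def)
          then show False using disjoint_strip \<open>z \<in> strip i\<close> \<open>w \<in> strip j\<close> \<open>i \<noteq> j\<close> by blast
        qed
      qed
    qed simp
    also have "\<dots> = (\<integral>\<^sup>+j. emeasure W (A \<inter> strip j) \<partial>count_space UNIV)"
    proof (intro nn_integral_cong)
      fix j
      show "emeasure M (E ` (A \<inter> strip j)) = emeasure W (A \<inter> strip j)"
        unfolding branch_eq[OF A] W_def using A by (intro emeasure_density[symmetric]) (auto simp: M)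
    qed
    also have "\<dots> = emeasure W (\<Union>j. A \<inter> strip j)"
    proof (rule emeasure_UN_countable[symmetric])
      show "disjoint_family (\<lambda>j. A \<inter> strip j)"
        unfolding disjoint_family_on_def using disjoint_strip by blast
    qed (use A in auto)
    also have "(\<Union>j. A \<inter> strip j) = A" using UN_strip[OF A(1)] by simp
    also have "emeasure W A = (\<integral>\<^sup>+z. ennreal (cmod z powr \<beta>) * indicator A z \<partial>M)"
      unfolding W_def using A by (intro emeasure_density) (auto simp: M)
    also have "\<dots> = (\<integral>\<^sup>+z. ennreal (exp (\<beta> * ln (cmod z))) * indicator A z * indicator J0 z \<partial>M)"
    proof (intro nn_integral_cong)
      fix z
      show "ennreal (cmod z powr \<beta>) * indicator A z = ennreal (exp (\<beta> * ln (cmod z))) * indicator A z * indicator J0 z"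
      proof (cases "z \<in> A")
        case True
        then have "z \<noteq> 0" "z \<in> J0" using A(1) halfplaneD(2)[OF J0_halfplane, of z] q_gt_1 by auto
        then show ?thesis by (simp add: powr_def)
      qed simp
    qed
    also have "\<dots> = (\<integral>\<^sup>+z\<in>A. ennreal (exp (\<beta> * ln (cmod z))) \<partial>m)"
      unfolding m_def by (rule nn_integral_restrict_space[symmetric]) (simp add: spM M)
    finally show "emeasure m (E ` A) = (\<integral>\<^sup>+z\<in>A. ennreal (exp (\<beta> * ln (cmod z))) \<partial>m)" .
  qed
  then show ?thesis by (auto simp: julia_set_eq)
qed

end

section \<open>Dissipativity\<close>

lemma emeasure_UN_le_count_space:
  assumes "countable I" "\<And>i. i \<in> I \<Longrightarrow> A i \<in> sets M"
  shows "emeasure M (\<Union>i\<in>I. A i) \<le> (\<integral>\<^sup>+i. emeasure M (A i) \<partial>count_space I)"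
proof -
  have U: "(\<Union>i\<in>I. A i) \<in> sets M" using assms by (intro sets.countable_UN'') auto
  have "emeasure M (\<Union>i\<in>I. A i) = (\<integral>\<^sup>+z. indicator (\<Union>i\<in>I. A i) z \<partial>M)" using U by simp
  also have "\<dots> \<le> (\<integral>\<^sup>+z. \<integral>\<^sup>+i. indicator (A i) z \<partial>count_space I \<partial>M)"
  proof (rule nn_integral_mono)
    fix z
    show "indicator (\<Union>i\<in>I. A i) z \<le> (\<integral>\<^sup>+i. indicator (A i) z \<partial>count_space I)"
    proof (cases "z \<in> (\<Union>i\<in>I. A i)")
      case True
      then obtain i where "i \<in> I" "z \<in> A i" by blast
      then show ?thesis using nn_integral_ge_point[of i I "\<lambda>i. indicator (A i) z"] True by simp
    qed simp
  qed
  also have "\<dots> = (\<integral>\<^sup>+i. \<integral>\<^sup>+z. indicator (A i) z \<partial>M \<partial>count_space I)"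
    by (rule nn_integral_count_space_nn_integral) (use assms in auto)
  also have "\<dots> = (\<integral>\<^sup>+i. emeasure M (A i) \<partial>count_space I)"
    using assms by (intro nn_integral_cong) simp
  finally show ?thesis .
qed

text \<open>Points are sorted by a level R and the time k of the last visit to the set where h is at
  most R. If such a point came back to its class after j > 0 steps, it would have a visit at time k
  + j.\<close>

lemma dissipative_of_escaping:
  fixes h :: "'a \<Rightarrow> real"
  assumes escape: "AE z in m. \<forall>R::nat. \<forall>\<^sub>F n in sequentially. real R < h ((T ^^ n) z)"
    and meas: "\<And>n. (\<lambda>z. h ((T ^^ n) z)) \<in> borel_measurable m"
  shows "dissipative T m"
proof -
  define D where "D R k = {z \<in> space m. h ((T ^^ k) z) \<le> real R \<and> (\<forall>n>k. real R < h ((T ^^ n) z))}" for R k :: nat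
  have [measurable]: "(\<lambda>z. h ((T ^^ n) z)) \<in> borel_measurable m" for n by (rule meas)
  have Dm: "D R k \<in> sets m" for R k unfolding D_def by measurable
  have wand: "wandering T (D R k)" for R k
    unfolding wandering_def
  proof (intro allI impI)
    fix j :: nat assume "1 \<le> j"
    show "D R k \<inter> (T ^^ j) -` D R k = {}"
    proof (rule ccontr)
      assume "D R k \<inter> (T ^^ j) -` D R k \<noteq> {}"
      then obtain z where "z \<in> D R k" "(T ^^ j) z \<in> D R k" by blast
      then have "real R < h ((T ^^ (k + j)) z)" "h ((T ^^ k) ((T ^^ j) z)) \<le> real R"
        using \<open>1 \<le> j\<close> by (auto simp: D_def)
      then show False by (simp add: funpow_add)
    qed
  qed
  define \<D> where "\<D> = (\<lambda>(R, k). D R k) ` (UNIV :: (nat \<times> nat) set)"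
  have "AE z in m. z \<in> \<Union>\<D>"
  proof (rule AE_mp[OF escape], intro AE_I2 impI)
    fix z assume z: "z \<in> space m" and esc: "\<forall>R::nat. \<forall>\<^sub>F n in sequentially. real R < h ((T ^^ n) z)"
    \<comment> \<open>The level is large enough for time 0 to count as a visit, so the finite set of
      visits has a maximum.\<close>
    obtain R :: nat where R: "h z \<le> real R" using real_arch_simple by blast
    define S where "S = {n. h ((T ^^ n) z) \<le> real R}"
    obtain N where N: "\<And>n. N \<le> n \<Longrightarrow> real R < h ((T ^^ n) z)"
      using esc unfolding eventually_sequentially by blast
    have "S \<subseteq> {..<N}" using N by (auto simp: S_def not_le[symmetric])
    then have fin: "finite S" by (rule finite_subset) simp
    moreover have "0 \<in> S" using R by (simp add: S_def)
    ultimately have "Max S \<in> S" by (intro Max_in) auto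
    moreover have "n \<notin> S" if "Max S < n" for n using Max_ge[OF fin, of n] that by auto
    ultimately have "z \<in> D R (Max S)" using z by (auto simp: D_def S_def not_le)
    then show "z \<in> \<Union>\<D>" by (auto simp: \<D>_def)
  qed
  moreover have UD: "\<Union>\<D> \<in> sets m" unfolding \<D>_def using Dm by (intro sets.countable_Union) auto
  moreover have "{z \<in> space m. z \<notin> \<Union>\<D>} = space m - \<Union>\<D>" by blast
  ultimately have "space m - \<Union>\<D> \<in> null_sets m"
    using AE_iff_null[of m "\<lambda>z. z \<in> \<Union>\<D>"] by simp
  then show ?thesis
    unfolding dissipative_def using Dm wand by (intro exI[of _ \<D>]) (auto simp: \<D>_def)
qed

context exp_dynamics
begin

lemma branch_image_eq: "B \<subseteq> J0 \<Longrightarrow> branch j ` B = strip j \<inter> E -` B"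
proof (intro set_eqI iffI)
  fix z assume "B \<subseteq> J0" "z \<in> branch j ` B"
  then obtain w where "w \<in> B" "w \<in> halfplane" "z = branch j w" using J0_halfplane by blast
  then show "z \<in> strip j \<inter> E -` B"
    using E_branch_halfplane branch_in_strip[of w j] halfplaneD(1)[of w] q_gt_1 by auto
next
  fix z assume "z \<in> strip j \<inter> E -` B"
  then show "z \<in> branch j ` B" using branch_E by (metis IntD1 IntD2 image_eqI vimageD)
qed

lemma word_map_image_borel:
  assumes "B \<subseteq> J0" "B \<in> sets borel"
  shows "word_map v ` B \<in> sets borel"
proof (induction v)
  case (Cons j v)
  have "word_map v ` B \<subseteq> J0" using assms(1) word_map_J0 by blast
  from branch_image_eq[OF this, of j] have "word_map (j # v) ` B = strip j \<inter> E -` (word_map v ` B)"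
    by (simp add: image_image)
  then show ?case using Cons measurable_sets[OF borel_measurable_E Cons] by simp
qed (use assms in simp)

lemma J0_word:
  assumes "z \<in> J0" shows "\<exists>v. length v = n \<and> z = word_map v ((E ^^ n) z)"
  using assms
proof (induction n arbitrary: z)
  case (Suc n)
  obtain v where v: "length v = n" "E z = word_map v ((E ^^ n) (E z))" using Suc.IH[OF J0_E[OF Suc.prems]] by blast
  have "0 < Re (E z)" using halfplaneD(1)[OF J0_halfplane[OF J0_E[OF Suc.prems]]] q_gt_1 by linarith
  then obtain j where "z \<in> strip j" using in_some_strip by blast
  then have "z = word_map (j # v) ((E ^^ Suc n) z)" using branch_E v(2) by (simp add: funpow_swap1)
  then show ?case using v(1) by (intro exI[of _ "j # v"]) simp
qed simp

text \<open>Conformality is applied once per letter: a branch divides the measure by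
  \<open>cmod z powr \<beta>\<close>, and this norm is at least the norm at the image of q up to a
  factor exp(|R| / q^k). The errors form a geometric series. The bound holds for every conformal
  measure, not only for the one constructed above.\<close>

lemma conformal_word_map_le:
  assumes conf: "conformal_measure E J0 (\<lambda>z. \<beta> * ln (cmod z)) m" and \<beta>: "0 \<le> \<beta>"
    and B: "B \<subseteq> J0" "B \<in> sets borel" "\<And>z. z \<in> B \<Longrightarrow> dist z q \<le> R"
  shows "emeasure m (word_map v ` B)
    \<le> ennreal (exp (\<beta> * \<bar>R\<bar> / (q - 1)) * weight v q powr (- \<beta>)) * emeasure m B"
proof -
  have sm: "sets m = sets (restrict_space borel J0)"
    using conf by (simp add: conformal_measure_def regular_borel_measure_on_def)
  have setsm: "A \<in> sets m \<longleftrightarrow> A \<subseteq> J0 \<and> A \<in> sets borel" for A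
    unfolding sm by (subst sets_restrict_space_iff) auto
  \<comment> \<open>The induction carries the partial sum of the geometric series. The absolute
    value covers a negative R, for which \<open>B\<close> is empty.\<close>
  let ?e = "\<lambda>n. \<beta> * \<bar>R\<bar> * (1 - 1 / q ^ n) / (q - 1)"
  have "emeasure m (word_map v ` B)
    \<le> ennreal (exp (?e (length v)) * weight v q powr (- \<beta>)) * emeasure m B"
  proof (induction v)
    case (Cons j v)
    define B' where "B' = word_map v ` B"
    define A where "A = branch j ` B'"
    have A_eq: "A = word_map (j # v) ` B" by (simp add: A_def B'_def image_image)
    have Am: "A \<in> sets m"
      unfolding setsm A_eq using word_map_J0 B(1) word_map_image_borel[OF B(1,2), of "j # v"] by blast
    have B'J: "B' \<subseteq> J0" using B(1) word_map_J0 by (auto simp: B'_def)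
    have A_strip: "A \<subseteq> strip j" unfolding A_def branch_image_eq[OF B'J] by blast
    have inj: "inj_on E A" by (rule inj_on_inverseI[of _ "branch j"]) (use A_strip branch_E in blast)
    have EA: "E ` A = B'"
    proof -
      have "E (branch j w) = w" if "w \<in> B'" for w using that B'J J0_halfplane E_branch_halfplane by blast
      then show ?thesis unfolding A_def image_image by simp
    qed
    let ?a = "exp (- (\<bar>R\<bar> / q ^ Suc (length v))) * cmod (branch j (word_map v q))"
    have bpos: "0 < cmod (branch j (word_map v q))"
      using halfplaneD(2)[OF branch_in_halfplane[OF word_map_halfplane[OF q_halfplane]], of j v] q_gt_1 by linarith
    have a: "?a \<le> cmod z" if z: "z \<in> A" for z
    proof -
      obtain w where w: "w \<in> B" "z = word_map (j # v) w" using z A_eq by auto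
      have wH: "w \<in> halfplane" using w(1) B(1) J0_halfplane by blast
      have "cmod (word_map (j # v) q) \<le> cmod z * exp (dist (word_map (j # v) q) z)"
        by (rule norm_le_exp_dist) (use w word_map_halfplane[OF wH, of "j # v"] in simp)
      also have "dist (word_map (j # v) q) z \<le> dist (of_real q) w / q ^ length (j # v)"
        unfolding w(2) by (rule word_map_contracting[OF q_halfplane wH])
      also have "dist (of_real q) w / q ^ length (j # v) \<le> \<bar>R\<bar> / q ^ Suc (length v)"
        using B(3)[OF w(1)] q_gt_1 by (auto intro!: divide_right_mono simp: dist_commute)
      finally have "cmod (branch j (word_map v q)) \<le> cmod z * exp (\<bar>R\<bar> / q ^ Suc (length v))"
        by (simp add: mult_left_mono)
      then show ?thesis by (simp add: exp_minus field_simps)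
    qed
    have "ennreal (?a powr \<beta>) * emeasure m A = (\<integral>\<^sup>+z. ennreal (?a powr \<beta>) * indicator A z \<partial>m)"
      by (rule nn_integral_cmult_indicator[symmetric]) (rule Am)
    also have "\<dots> \<le> (\<integral>\<^sup>+z\<in>A. ennreal (exp (\<beta> * ln (cmod z))) \<partial>m)"
    proof (rule nn_integral_mono)
      fix z
      show "ennreal (?a powr \<beta>) * indicator A z \<le> ennreal (exp (\<beta> * ln (cmod z))) * indicator A z"
      proof (cases "z \<in> A")
        case True
        have "0 < cmod z" using a[OF True] bpos by (smt (verit) exp_gt_zero mult_pos_pos)
        then have "exp (\<beta> * ln (cmod z)) = cmod z powr \<beta>" by (simp add: powr_def)
        moreover have "?a powr \<beta> \<le> cmod z powr \<beta>" using a[OF True] \<beta> by (intro powr_mono2) auto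
        ultimately show ?thesis using True by (auto intro!: ennreal_leI)
      qed simp
    qed
    also have "\<dots> = emeasure m B'" using conf Am inj unfolding conformal_measure_def EA[symmetric] by simp
    also have "\<dots> \<le> ennreal (exp (?e (length v)) * weight v q powr (- \<beta>)) * emeasure m B"
      unfolding B'_def by (rule Cons)
    finally have "ennreal (?a powr (- \<beta>)) * (ennreal (?a powr \<beta>) * emeasure m A)
       \<le> ennreal (?a powr (- \<beta>)) * (ennreal (exp (?e (length v)) * weight v q powr (- \<beta>)) * emeasure m B)"
      by (rule mult_left_mono) simp
    moreover have "ennreal (?a powr (- \<beta>)) * (ennreal (?a powr \<beta>) * emeasure m A) = emeasure m A"
      using bpos by (simp add: mult.assoc[symmetric] ennreal_mult[symmetric] powr_add[symmetric])
    moreover have "ennreal (?a powr (- \<beta>)) * (ennreal (exp (?e (length v)) * weight v q powr (- \<beta>)) * emeasure m B)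
       = ennreal (exp (?e (length (j # v))) * weight (j # v) q powr (- \<beta>)) * emeasure m B"
    proof -
      have "?a powr (- \<beta>) = exp (\<beta> * \<bar>R\<bar> / q ^ Suc (length v)) * cmod (branch j (word_map v q)) powr (- \<beta>)"
        using bpos by (subst powr_mult) (auto simp: powr_def)
      then have "?a powr (- \<beta>) * (exp (?e (length v)) * weight v q powr (- \<beta>))
         = (exp (\<beta> * \<bar>R\<bar> / q ^ Suc (length v)) * exp (?e (length v))) * (weight (j # v) q powr (- \<beta>))"
        using weight_pos[OF q_halfplane, of v] by (simp add: powr_mult mult_ac)
      also have "exp (\<beta> * \<bar>R\<bar> / q ^ Suc (length v)) * exp (?e (length v)) = exp (?e (length (j # v)))"
        unfolding exp_add[symmetric] using q_gt_1 by (intro arg_cong[where f = exp]) (simp add: field_simps)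
      finally show ?thesis by (simp add: mult.assoc[symmetric] ennreal_mult[symmetric])
    qed
    ultimately show ?case by (simp only: A_eq)
  qed simp
  also have "\<dots> \<le> ennreal (exp (\<beta> * \<bar>R\<bar> / (q - 1)) * weight v q powr (- \<beta>)) * emeasure m B"
  proof (intro mult_right_mono ennreal_leI iffD2[OF exp_le_cancel_iff] divide_right_mono)
    show "\<beta> * \<bar>R\<bar> * (1 - 1 / q ^ length v) \<le> \<beta> * \<bar>R\<bar>" using \<beta> q_gt_1 by (intro mult_left_le) auto
  qed (use q_gt_1 in auto)
  finally show ?thesis .
qed

theorem conformal_measure_dissipative:
  assumes dim: "hausdorff_dim (radial_julia_set E) < ereal \<beta>"
    and conf: "conformal_measure E (julia_set E) (\<lambda>z. \<beta> * ln (cmod z)) m"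
  shows "dissipative E m"
proof -
  have \<beta>: "0 \<le> \<beta>" by (rule hausdorff_dim_le_nonneg[OF less_imp_le[OF dim]])
  have conf: "conformal_measure E J0 (\<lambda>z. \<beta> * ln (cmod z)) m" using conf by (simp add: julia_set_eq)
  have sm: "sets m = sets (restrict_space borel J0)"
    using conf by (simp add: conformal_measure_def regular_borel_measure_on_def)
  have setsm: "A \<in> sets m \<longleftrightarrow> A \<subseteq> J0 \<and> A \<in> sets borel" for A
    unfolding sm by (subst sets_restrict_space_iff) auto
  have spm: "space m = J0" using sets_eq_imp_space_eq[OF sm] by (simp add: space_restrict_space)
  have [measurable]: "(E ^^ n) \<in> borel_measurable borel" for n
    using continuous_on_iterate by (rule borel_measurable_continuous_onI)
  have AER: "AE z in m. \<forall>\<^sub>F n in sequentially. \<not> (dist z q \<le> R \<and> dist ((E ^^ n) z) q \<le> R)" for R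
  proof -
    \<comment> \<open>The measure may be infinite, so Borel-Cantelli is applied to the returns to a
      compact set, whose measure is finite by regularity.\<close>
    define K where "K = J0 \<inter> cball q R"
    have K: "compact K" "K \<subseteq> J0" "K \<in> sets borel" "\<And>z. z \<in> K \<Longrightarrow> dist z q \<le> R"
      using closed_Int_compact[OF closed_J0 compact_cball[of "of_real q" R]] by (auto simp: K_def dist_commute)
    have Kfin: "emeasure m K < \<infinity>"
      using conf K(1,2) by (simp add: conformal_measure_def regular_borel_measure_on_def)
    define B where "B n = {z \<in> K. (E ^^ n) z \<in> K}" for n
    have Bm: "B n \<in> sets m" for n
    proof -
      have "B n = K \<inter> (E ^^ n) -` K" by (auto simp: B_def)
      then show ?thesis using K measurable_sets[of "E ^^ n" borel borel K] by (auto simp: setsm)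
    qed
    have Bfin: "emeasure m (B n) < \<infinity>" for n
    proof -
      have "emeasure m (B n) \<le> emeasure m K" using K by (intro emeasure_mono) (auto simp: B_def setsm)
      then show ?thesis using Kfin by (rule le_less_trans)
    qed
    define C where "C = exp (\<beta> * \<bar>R\<bar> / (q - 1))"
    define f where "f v = ennreal (weight v q powr (- \<beta>)) *
     indicator {v. dist (word_map v q) q \<le> 2 * R} v" for v
    let ?I = "\<lambda>n. \<integral>\<^sup>+v. f v * indicator {v. length v = n} v \<partial>count_space UNIV"
    have Bbound: "emeasure m (B n) \<le> ennreal C * emeasure m K * ?I n" for n
    proof -
      \<comment> \<open>The radius doubles: if z and its n-th iterate are both within R of q, then
        the word that leads back from the iterate to z does not increase distances, so it takes q to
        a point within R of z.\<close>
      define V where "V = {v. length v = n \<and> dist (word_map v q) q \<le> 2 * R}"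
      have sub: "B n \<subseteq> (\<Union>v\<in>V. word_map v ` K)"
      proof
        fix z assume z: "z \<in> B n"
        then have zK: "z \<in> K" "(E ^^ n) z \<in> K" by (auto simp: B_def)
        obtain v where v: "length v = n" "z = word_map v ((E ^^ n) z)" using J0_word K(2) zK(1) by blast
        have "dist (word_map v q) z \<le> dist (of_real q) ((E ^^ n) z)"
          by (subst v(2)) (rule dist_word_map_le[OF q_halfplane], use zK K(2) J0_halfplane in blast)
        then have "dist (word_map v q) q \<le> 2 * R"
          using dist_triangle[of "word_map v q" q z] K(4)[OF zK(1)] K(4)[OF zK(2)] by (simp add: dist_commute)
        then have "v \<in> V" using v(1) by (simp add: V_def)
        then show "z \<in> (\<Union>v\<in>V. word_map v ` K)" using v(2) zK(2) by blast
      qed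
      have wm: "word_map v ` K \<in> sets m" for v
        unfolding setsm using word_map_J0 K(2) word_map_image_borel[OF K(2,3)] by blast
      have "emeasure m (B n) \<le> emeasure m (\<Union>v\<in>V. word_map v ` K)"
        using sub wm by (intro emeasure_mono sets.countable_UN'') auto
      also have "\<dots> \<le> (\<integral>\<^sup>+v. emeasure m (word_map v ` K) \<partial>count_space V)"
        by (rule emeasure_UN_le_count_space) (use wm in auto)
      also have "\<dots> = (\<integral>\<^sup>+v. emeasure m (word_map v ` K) * indicator V v \<partial>count_space UNIV)"
        by (subst nn_integral_count_space_indicator) simp_all
      also have "\<dots> \<le> (\<integral>\<^sup>+v. ennreal C * emeasure m K * (f v * indicator {v. length v = n} v) \<partial>count_space UNIV)"
      proof (rule nn_integral_mono)
        fix v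
        show "emeasure m (word_map v ` K) * indicator V v \<le> ennreal C * emeasure m K * (f v * indicator {v. length v = n} v)"
        proof (cases "v \<in> V")
          case True
          have "emeasure m (word_map v ` K) \<le> ennreal (C * weight v q powr (- \<beta>)) * emeasure m K"
            unfolding C_def by (rule conformal_word_map_le[OF conf \<beta> K(2,3,4)])
          then show ?thesis using True by (simp add: V_def f_def C_def ennreal_mult mult_ac)
        qed simp
      qed
      also have "\<dots> = ennreal C * emeasure m K * ?I n"
        by (rule nn_integral_cmult) simp
      finally show ?thesis .
    qed
    have "(\<Sum>n. ennreal (measure m (B n))) = (\<Sum>n. emeasure m (B n))"
      using Bfin by (simp add: emeasure_eq_ennreal_measure less_top[symmetric])
    also have "\<dots> \<le> (\<Sum>n. ennreal C * emeasure m K * ?I n)"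
      by (intro suminf_le Bbound) auto
    also have "\<dots> = ennreal C * emeasure m K * (\<Sum>n. ?I n)"
      by (rule ennreal_suminf_cmult)
    also have "(\<Sum>n. ?I n) = word_series \<beta> (2 * R)"
      unfolding word_series_def f_def by (rule nn_integral_by_length[symmetric])
    also have "ennreal C * emeasure m K * word_series \<beta> (2 * R) < \<infinity>"
      using word_series_finite[OF dim] Kfin by (simp add: ennreal_mult_less_top)
    finally have "summable (\<lambda>n. measure m (B n))" by (intro summable_suminf_not_top) auto
    from borel_cantelli_AE1[OF Bm Bfin this] show ?thesis
    proof (rule AE_mp, intro AE_I2 impI)
      fix z assume "z \<in> space m" "\<forall>\<^sub>F n in sequentially. z \<in> space m - B n"
      then show "\<forall>\<^sub>F n in sequentially. \<not> (dist z q \<le> R \<and> dist ((E ^^ n) z) q \<le> R)"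
        using J0_iterate by (auto simp: spm B_def K_def dist_commute elim!: eventually_mono)
    qed
  qed
  show ?thesis
  proof (rule dissipative_of_escaping[where h = "\<lambda>z. dist z (of_real q)"])
    have escape: "\<forall>\<^sub>F n in sequentially. real R < dist ((E ^^ n) z) q"
      if *: "\<forall>R::nat. \<forall>\<^sub>F n in sequentially. \<not> (dist z q \<le> real R \<and> dist ((E ^^ n) z) q \<le> real R)"
      for z :: complex and R :: nat
    proof -
      \<comment> \<open>The preceding statement only excludes infinitely many returns for points
        that start inside the ball, so the ball is enlarged until it contains z.\<close>
      obtain R' :: nat where R': "dist z q \<le> real R'" using real_arch_simple by blast
      from *[rule_format, of "max R R'"] show ?thesis
        by (rule eventually_mono) (use R' in auto)
    qed
    have "AE z in m. \<forall>R::nat. \<forall>\<^sub>F n in sequentially. \<not> (dist z q \<le> real R \<and> dist ((E ^^ n) z) q \<le> real R)"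
      unfolding AE_all_countable using AER by blast
    then show "AE z in m. \<forall>R::nat. \<forall>\<^sub>F n in sequentially. real R < dist ((E ^^ n) z) q"
      by (rule AE_mp) (intro AE_I2 impI allI, erule escape)
    show "(\<lambda>z. dist ((E ^^ n) z) (of_real q)) \<in> borel_measurable m" for n
    proof -
      have "(\<lambda>z. dist ((E ^^ n) z) (of_real q)) \<in> borel_measurable (restrict_space borel J0)"
        by (intro measurable_restrict_space1) measurable
      then show ?thesis using measurable_cong_sets[OF sm refl] by blast
    qed
  qed
qed

end

theorem proposition6p3:
  fixes l \<beta> :: real
  assumes "0 < l" and "l < exp (- 1)"
  defines "E \<equiv> exp_map l"
  shows "(hausdorff_dim (radial_julia_set E) \<le> ereal \<beta> \<longrightarrow>
            (\<exists>m. conformal_measure E (julia_set E) (\<lambda>z. \<beta> * ln (cmod z)) m)) \<and>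
         (hausdorff_dim (radial_julia_set E) < ereal \<beta> \<longrightarrow>
            (\<forall>m. conformal_measure E (julia_set E) (\<lambda>z. \<beta> * ln (cmod z)) m \<longrightarrow>
               dissipative E m))"
proof -
  obtain q where "1 < q" "l * exp q = q"
    using exists_repelling_fixed_point[OF assms(1,2)] by blast
  then interpret exp_dynamics l q using assms(1) by unfold_locales
  show ?thesis
    unfolding E_def using exists_conformal_measure conformal_measure_dissipative by blast
qed

end
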